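(* Let $z_1,\dots,z_n\in\mathbb{C}$, and let $\star:\mathbb{C}[\mathfrak{S}_n]\to\mathbb{C}[\mathfrak{S}_n]$ be the involutive $\mathbb{C}$-algebra automorphism given by $\star\sigma=\mathrm{sgn}(\sigma)\sigma$ for all $\sigma\in\mathfrak{S}_n$. The map $\star$ restricted to $\mathcal{B}_n(z_1,\dots,z_n)$ is an involutive algebra automorphism (of $\mathcal{B}_n(z_1,\dots,z_n)$), sending $\beta^\lambda(t)\mapsto\beta^{\lambda^*}(t)$ for all partitions $\lambda$.
   Context: $[n]=\{1,\dots,n\}$; $\chi^\lambda$ is the character of the irreducible representation (Specht module) of $\mathfrak{S}_{|\lambda|}$ attached to the partition $\lambda$; $\lambda^*$ is the conjugate (transpose) partition. For $X\subseteq[n]$, $\mathfrak{S}_X\subseteq\mathfrak{S}_n$ is the group of permutations of $X$, and for $|X|=|\lambda|$, $\chi^\lambda$ is regarded as a function on $\mathfrak{S}_X\cong\mathfrak{S}_{|X|}$. For $t\in\mathbb{C}$ put $$\beta^\lambda(t):=\sum_{X\subseteq[n],\,|X|=|\lambda|}\ \sum_{\sigma\in\mathfrak{S}_X}\chi^\lambda(\sigma)\sigma\prod_{i\in[n]\setminus X}(z_i+t)\in\mathbb{C}[\mathfrak{S}_n].$$ The Bethe algebra $\mathcal{B}_n(z_1,\dots,z_n)\subseteq\mathbb{C}[\mathfrak{S}_n]$ is the subalgebra generated by all $\beta^{1^k}(t)$ for $k\ge0$, $t\in\mathbb{C}$, where $1^k=(1,\dots,1)$. *)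

theory Defs
  imports
    Complex_Main
    "HOL-Library.Function_Algebras"
    "HOL-Library.FuncSet"
    "HOL-Combinatorics.Permutations"
    "HOL-Algebra.QuotRing"
    "HOL-Algebra.Sym_Groups"
begin

section \<open>Complex vector spaces of functions\<close>

definition scl :: "complex \<Rightarrow> ('a \<Rightarrow> complex) \<Rightarrow> 'a \<Rightarrow> complex" where
  "scl c f = (\<lambda>x. c * f x)"

global_interpretation fvs: vector_space "scl :: complex \<Rightarrow> ('a \<Rightarrow> complex) \<Rightarrow> 'a \<Rightarrow> complex"
  by unfold_locales (auto simp: scl_def fun_eq_iff algebra_simps)

definition bvec :: "'a \<Rightarrow> 'a \<Rightarrow> complex" where
  "bvec x = (\<lambda>y. if y = x then 1 else 0)"

text \<open>Trace of a linear endomorphism \<open>f\<close> of a finite-dimensional space \<open>V\<close>: the sum of the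
  diagonal entries of the matrix of \<open>f\<close> in some basis of \<open>V\<close>.\<close>

definition trace_on :: "('a \<Rightarrow> complex) set \<Rightarrow> (('a \<Rightarrow> complex) \<Rightarrow> ('a \<Rightarrow> complex)) \<Rightarrow> complex" where
  "trace_on V f =
    (let B = (SOME B. fvs.independent B \<and> fvs.span B = V)
     in \<Sum>b\<in>B. fvs.representation B (f b) b)"


section \<open>Partitions and tableaux\<close>

definition is_partition :: "nat list \<Rightarrow> bool" where
  "is_partition \<mu> \<longleftrightarrow> sorted_wrt (\<ge>) \<mu> \<and> 0 \<notin> set \<mu>"

text \<open>The size of \<open>\<mu>\<close> is \<open>sum_list \<mu>\<close>.  The number of columns of the diagram of \<open>\<mu>\<close> is the
  largest part, that is \<open>foldr max \<mu> 0\<close>.\<close>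

definition conj_partition :: "nat list \<Rightarrow> nat list" where
  "conj_partition \<mu> = map (\<lambda>j. length (filter (\<lambda>p. j < p) \<mu>)) [0..<foldr max \<mu> 0]"

definition diagram :: "nat list \<Rightarrow> (nat \<times> nat) set" where
  "diagram \<mu> = {(i, j). i < length \<mu> \<and> j < \<mu> ! i}"

definition row :: "nat list \<Rightarrow> nat \<Rightarrow> (nat \<times> nat) set" where
  "row \<mu> i = {c \<in> diagram \<mu>. fst c = i}"

definition column :: "nat list \<Rightarrow> nat \<Rightarrow> (nat \<times> nat) set" where
  "column \<mu> j = {c \<in> diagram \<mu>. snd c = j}"

type_synonym tableau = "nat \<times> nat \<Rightarrow> nat"

definition tableaux :: "nat list \<Rightarrow> tableau set" where
  "tableaux \<mu> =
    {T \<in> extensional (diagram \<mu>). bij_betw T (diagram \<mu>) {1..sum_list \<mu>}}"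

definition act_tableau :: "nat list \<Rightarrow> (nat \<Rightarrow> nat) \<Rightarrow> tableau \<Rightarrow> tableau" where
  "act_tableau \<mu> \<pi> T = compose (diagram \<mu>) \<pi> T"

definition tabloid :: "nat list \<Rightarrow> tableau \<Rightarrow> tableau set" where
  "tabloid \<mu> T = {S \<in> tableaux \<mu>. \<forall>i. S ` row \<mu> i = T ` row \<mu> i}"

definition column_group :: "nat list \<Rightarrow> tableau \<Rightarrow> (nat \<Rightarrow> nat) set" where
  "column_group \<mu> T =
    {\<pi>. \<pi> permutes {1..sum_list \<mu>} \<and> (\<forall>j. \<pi> ` T ` column \<mu> j = T ` column \<mu> j)}"


section \<open>Specht modules and their characters\<close>

text \<open>Elements of the permutation module on tabloids are functions on tabloids; \<open>bvec {T}\<close> is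
  the basis vector given by a tabloid.\<close>

definition polytabloid :: "nat list \<Rightarrow> tableau \<Rightarrow> tableau set \<Rightarrow> complex" where
  "polytabloid \<mu> T =
    (\<Sum>\<pi>\<in>column_group \<mu> T. scl (of_int (sign \<pi>)) (bvec (tabloid \<mu> (act_tableau \<mu> \<pi> T))))"

definition specht :: "nat list \<Rightarrow> (tableau set \<Rightarrow> complex) set" where
  "specht \<mu> = fvs.span (polytabloid \<mu> ` tableaux \<mu>)"

text \<open>The linear action determined by \<open>\<pi> \<cdot> bvec A = bvec (\<pi> A)\<close> for tabloids \<open>A\<close>.\<close>

definition act_module ::
  "nat list \<Rightarrow> (nat \<Rightarrow> nat) \<Rightarrow> (tableau set \<Rightarrow> complex) \<Rightarrow> tableau set \<Rightarrow> complex" where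
  "act_module \<mu> \<pi> v =
    (\<Sum>A\<in>tabloid \<mu> ` tableaux \<mu>. scl (v A) (bvec (act_tableau \<mu> \<pi> ` A)))"

definition specht_char :: "nat list \<Rightarrow> (nat \<Rightarrow> nat) \<Rightarrow> complex" where
  "specht_char \<mu> \<pi> = trace_on (specht \<mu>) (act_module \<mu> \<pi>)"

text \<open>A function on the symmetric group of \<open>{1..k}\<close> is regarded as a function on the symmetric
  group of a set \<open>X\<close> with \<open>k\<close> elements by relabelling \<open>X\<close> in increasing order.  (Characters are
  class functions, so any other relabelling gives the same result.)\<close>

definition specht_char_on :: "nat set \<Rightarrow> nat list \<Rightarrow> (nat \<Rightarrow> nat) \<Rightarrow> complex" where
  "specht_char_on X \<mu> \<sigma> =
    specht_char \<mu> (map_permutation X (\<lambda>i. card {j \<in> X. j \<le> i}) \<sigma>)"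


section \<open>The group algebra of the symmetric group\<close>

definition group_algebra :: "('g, 'm) monoid_scheme \<Rightarrow> ('g \<Rightarrow> complex) ring" where
  "group_algebra G =
    \<lparr>carrier = {f. \<forall>x. x \<notin> carrier G \<longrightarrow> f x = 0},
     monoid.mult = (\<lambda>f g. \<Sum>x\<in>carrier G. \<Sum>y\<in>carrier G. scl (f x * g y) (bvec (x \<otimes>\<^bsub>G\<^esub> y))),
     one = bvec \<one>\<^bsub>G\<^esub>,
     zero = 0,
     add = (+)\<rparr>"

abbreviation CS :: "nat \<Rightarrow> ((nat \<Rightarrow> nat) \<Rightarrow> complex) ring" where
  "CS n \<equiv> group_algebra (sym_group n)"

definition involutive_algebra_automorphism ::
  "('a \<Rightarrow> complex) ring \<Rightarrow> (('a \<Rightarrow> complex) \<Rightarrow> ('a \<Rightarrow> complex)) \<Rightarrow> bool" where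
  "involutive_algebra_automorphism A \<phi> \<longleftrightarrow>
    \<phi> \<in> ring_iso A A \<and>
    (\<forall>c. \<forall>a\<in>carrier A. \<phi> (scl c a) = scl c (\<phi> a)) \<and>
    (\<forall>a\<in>carrier A. \<phi> (\<phi> a) = a)"

definition star :: "nat \<Rightarrow> ((nat \<Rightarrow> nat) \<Rightarrow> complex) \<Rightarrow> (nat \<Rightarrow> nat) \<Rightarrow> complex" where
  "star n f = (\<Sum>\<sigma> | \<sigma> permutes {1..n}. scl (f \<sigma>) (scl (of_int (sign \<sigma>)) (bvec \<sigma>)))"


section \<open>The Bethe algebra\<close>

definition beta ::
  "nat \<Rightarrow> (nat \<Rightarrow> complex) \<Rightarrow> nat list \<Rightarrow> complex \<Rightarrow> (nat \<Rightarrow> nat) \<Rightarrow> complex" where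
  "beta n z \<mu> t =
    (\<Sum>X | X \<subseteq> {1..n} \<and> card X = sum_list \<mu>. \<Sum>\<sigma> | \<sigma> permutes X.
      scl (specht_char_on X \<mu> \<sigma> * (\<Prod>i\<in>{1..n} - X. (z i + t))) (bvec \<sigma>))"

inductive_set generated_algebra :: "('a \<Rightarrow> complex) ring \<Rightarrow> ('a \<Rightarrow> complex) set \<Rightarrow> ('a \<Rightarrow> complex) set"
  for A :: "('a \<Rightarrow> complex) ring" and S :: "('a \<Rightarrow> complex) set" where
  one: "\<one>\<^bsub>A\<^esub> \<in> generated_algebra A S"
| gen: "a \<in> S \<Longrightarrow> a \<in> generated_algebra A S"
| scale: "a \<in> generated_algebra A S \<Longrightarrow> scl c a \<in> generated_algebra A S"
| add: "a \<in> generated_algebra A S \<Longrightarrow> b \<in> generated_algebra A S \<Longrightarrow> a \<oplus>\<^bsub>A\<^esub> b \<in> generated_algebra A S"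
| mult: "a \<in> generated_algebra A S \<Longrightarrow> b \<in> generated_algebra A S \<Longrightarrow> a \<otimes>\<^bsub>A\<^esub> b \<in> generated_algebra A S"

definition bethe_algebra :: "nat \<Rightarrow> (nat \<Rightarrow> complex) \<Rightarrow> ((nat \<Rightarrow> nat) \<Rightarrow> complex) ring" where
  "bethe_algebra n z =
    (CS n)\<lparr>carrier := generated_algebra (CS n) {beta n z (replicate k 1) t | k t. True}\<rparr>"


text \<open>The map \<open>star n\<close> is the involutive automorphism of the group algebra with
  \<open>\<sigma> \<mapsto> sgn(\<sigma>) \<sigma>\<close>.\<close>

lemma sum_fun_apply: "(\<Sum>i\<in>I. F i) x = (\<Sum>i\<in>I. F i (x :: 'a) :: complex)"
  by (induction I rule: infinite_finite_induct) auto

lemma star_apply: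
  "star n f \<sigma> = (if \<sigma> permutes {1..n} then of_int (sign \<sigma>) * f \<sigma> else 0)"
proof -
  have fin: "finite {\<sigma>. \<sigma> permutes {1..n}}"
    by (simp add: finite_permutations)
  have "star n f \<sigma> =
      (\<Sum>\<tau> | \<tau> permutes {1..n}. if \<sigma> = \<tau> then of_int (sign \<sigma>) * f \<sigma> else 0)"
    unfolding star_def sum_fun_apply
    by (intro sum.cong refl) (auto simp: scl_def bvec_def)
  also have "\<dots> = (if \<sigma> permutes {1..n} then of_int (sign \<sigma>) * f \<sigma> else 0)"
    by (subst sum.delta'[OF fin]) simp
  finally show ?thesis .
qed

lemma star_bvec:
  "\<sigma> permutes {1..n} \<Longrightarrow> star n (bvec \<sigma>) = scl (of_int (sign \<sigma>)) (bvec \<sigma>)"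
  by (rule ext) (auto simp: star_apply bvec_def scl_def)

lemma sign_sq: "of_int (sign \<sigma>) * (of_int (sign \<sigma>) * c) = (c :: complex)"
  by (auto simp: sign_def)

lemma CS_carrier: "f \<in> carrier (CS n) \<longleftrightarrow> (\<forall>\<sigma>. \<not> \<sigma> permutes {1..n} \<longrightarrow> f \<sigma> = 0)"
  by (simp add: group_algebra_def sym_group_def)

lemma CS_mult_apply:
  "(f \<otimes>\<^bsub>CS n\<^esub> g) \<rho> = (\<Sum>\<sigma> | \<sigma> permutes {1..n}. \<Sum>\<tau> | \<tau> permutes {1..n}.
     if \<rho> = \<sigma> \<circ> \<tau> then f \<sigma> * g \<tau> else 0)"
  unfolding group_algebra_def sym_group_def
  by (simp add: sum_fun_apply scl_def bvec_def if_distrib cong: if_cong)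

lemma star_mult: "star n (f \<otimes>\<^bsub>CS n\<^esub> g) = star n f \<otimes>\<^bsub>CS n\<^esub> star n g"
proof
  fix \<rho>
  show "star n (f \<otimes>\<^bsub>CS n\<^esub> g) \<rho> = (star n f \<otimes>\<^bsub>CS n\<^esub> star n g) \<rho>"
  proof (cases "\<rho> permutes {1..n}")
    case True
    have sgn: "sign (\<sigma> \<circ> \<tau>) = sign \<sigma> * sign \<tau>"
      if "\<sigma> permutes {Suc 0..n}" "\<tau> permutes {Suc 0..n}" for \<sigma> \<tau>
      using that by (intro sign_compose) (auto simp: permutation_permutes)
    from True show ?thesis
      unfolding star_apply CS_mult_apply
      by (auto simp: sum_distrib_left star_apply sgn intro!: sum.cong)
  next
    case False
    then have "\<rho> \<noteq> \<sigma> \<circ> \<tau>" if "\<sigma> permutes {1..n}" "\<tau> permutes {1..n}" for \<sigma> \<tau>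
      using permutes_compose that by blast
    then show ?thesis
      using False by (simp add: star_apply CS_mult_apply)
  qed
qed

lemma star_star: "f \<in> carrier (CS n) \<Longrightarrow> star n (star n f) = f"
  by (auto simp: fun_eq_iff star_apply CS_carrier sign_sq)

lemma star_closed: "star n f \<in> carrier (CS n)"
  by (simp add: CS_carrier star_apply)

lemma involutive_algebra_automorphism_star:
  "involutive_algebra_automorphism (CS n) (star n)"
proof -
  have "star n (f \<oplus>\<^bsub>CS n\<^esub> g) = star n f \<oplus>\<^bsub>CS n\<^esub> star n g" for f g
    by (auto simp: fun_eq_iff star_apply group_algebra_def algebra_simps)
  moreover have "star n \<one>\<^bsub>CS n\<^esub> = \<one>\<^bsub>CS n\<^esub>"
    by (rule ext) (auto simp: star_apply group_algebra_def sym_group_def bvec_def permutes_id)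
  ultimately have "star n \<in> ring_hom (CS n) (CS n)"
    by (auto simp: ring_hom_def star_closed star_mult)
  moreover have "bij_betw (star n) (carrier (CS n)) (carrier (CS n))"
    by (rule bij_betwI[where g = "star n"]) (auto simp: star_closed star_star)
  ultimately show ?thesis
    by (auto simp: involutive_algebra_automorphism_def ring_iso_def star_star
        fun_eq_iff star_apply scl_def)
qed

end

theory Submission
  imports
    Defs
    "HOL-Combinatorics.Orbits"
    "HOL-Complex_Analysis.Complex_Analysis"
    "HOL-Computational_Algebra.Primes"
begin

text \<open>
  By Frobenius, the generating function of the \<open>\<beta>\<^sup>\<lambda>(t)\<close> against Schur functions is
  \<open>\<tau>(p) = (\<Sum>\<sigma>. \<sigma> (\<Prod>c. p\<^bsub>|c|\<^esub> + [c = {i}] (z\<^sub>i + t)))\<close>, where \<open>c\<close> runs through the cycles of \<open>\<sigma>\<close>.  Let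
  \<open>\<tau>\<^sub>A\<close> be its value at the power sums of the negative of an alphabet \<open>A\<close>; one letter gives the \<open>\<beta>\<close> of the
  single columns.  The \<open>\<tau>\<^sub>A\<close> satisfy the three-term (Fay) relation of the KP hierarchy.  To see
  this, deform the weight \<open>p\<^bsub>|c|\<^esub>\<close> to a divided difference at distinct nodes \<open>\<zeta>\<^sub>i\<close>, \<open>i \<in> c\<close>.  The deformed sums
  live in the crossed product of functions of \<open>z\<close> with the symmetric group; as functions of a letter \<open>y\<close>
  their products have vanishing residues at the nodes, so the relation is the residue theorem, and the
  nodes may be made to collide.  To first order in a third letter the relation writes \<open>\<tau>\<^sub>A\<^sub>+\<^sub>a\<^sub>+\<^sub>b \<tau>\<^sub>A\<close> in terms of
  \<open>\<tau>\<^sub>A\<^sub>+\<^sub>a\<close>, \<open>\<tau>\<^sub>A\<^sub>+\<^sub>b\<close> and their \<open>t\<close>-derivatives; since \<open>\<tau>\<^sub>A\<close> is monic in \<open>t\<close>, the Bethe algebra contains every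
  \<open>\<tau>\<^sub>A\<close>, hence every \<open>\<tau>(p)\<close> and every sum of this kind with a class function in place of a character.

  For the transposed partition, let \<open>r\<close> and \<open>c\<close> be the row symmetrizer and the column antisymmetrizer on functions of
  tableaux.  The Specht module is the image of \<open>r c\<close>, and that of the transposed shape, twisted by the
  sign, is the image of \<open>c r\<close>.  Each of \<open>c\<close> and \<open>r\<close> maps one image injectively into the other.
\<close>

hide_const (open) Finite_Cartesian_Product.transpose
  Finite_Cartesian_Product.row Finite_Cartesian_Product.column
unbundle no m_inv_syntax

section \<open>Orbits of a permutation and transpositions\<close>

text \<open>\<open>star\<close> sends the generator of a column of height k to the
  \<open>beta\<close> of a row of length k. So stability of the Bethe algebra under
  \<open>star\<close> means that the columns generate the rows, and the whole analytic half serves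
  this.

  If all nodes were equal, the pole belonging to a cycle would have the length of the cycle as its
  order, and residues would involve high derivatives. With distinct nodes a sum has at most simple
  poles, a product of two sums at most double poles, and a residue is one first derivative. That
  derivative is multiplication by an element of Gaudin type, which can be moved from one factor of a
  product to the other.

  One Vandermonde argument, \<open>subspace_exponential_sum\<close>, extracts all coefficients: with
  ratios \<open>2 ^ k\<close> for polynomial curves and for isolating a single power sum, with
  products of primes for cycle types. Curves are sampled at \<open>s0 * 2 ^ i\<close>, so that equal
  letters are avoided and multiplicities of letters are integers.

  The injectivity of c and r on the two images comes from a positive definite inner product for
  which both are self-adjoint.\<close>

definition orbs :: "('a \<Rightarrow> 'a) \<Rightarrow> 'a set \<Rightarrow> 'a set set" where
  "orbs \<sigma> S = orbit \<sigma> ` S"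

lemma finite_orbs [simp]: "finite S \<Longrightarrow> finite (orbs \<sigma> S)"
  by (simp add: orbs_def)

lemma permutes_self_in_orbit:
  assumes "\<sigma> permutes N" "finite N"
  shows "x \<in> orbit \<sigma> x"
  by (rule permutation_self_in_orbit) (use assms in \<open>auto simp: permutation_permutes\<close>)

lemma permutes_orbit_eq:
  assumes "\<sigma> permutes N" "finite N" "y \<in> orbit \<sigma> x"
  shows "orbit \<sigma> y = orbit \<sigma> x"
proof
  have x: "x \<in> orbit \<sigma> x"
    by (rule permutes_self_in_orbit[OF assms(1,2)])
  have "x \<in> orbit \<sigma> y"
    by (rule orbit_swap[OF x assms(3)])
  then show "orbit \<sigma> x \<subseteq> orbit \<sigma> y"
    by (auto intro: orbit_trans)
  show "orbit \<sigma> y \<subseteq> orbit \<sigma> x"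
    using assms(3) by (auto intro: orbit_trans)
qed

lemma orbit_in_orbs: "x \<in> S \<Longrightarrow> orbit \<sigma> x \<in> orbs \<sigma> S"
  by (simp add: orbs_def)

lemma orbs_eq_orbit:
  assumes "\<sigma> permutes N" "finite N" "c \<in> orbs \<sigma> S" "y \<in> c"
  shows "c = orbit \<sigma> y"
  using assms permutes_orbit_eq[OF assms(1,2)] by (auto simp: orbs_def)

lemma orbs_subset:
  assumes "\<sigma> permutes N" "c \<in> orbs \<sigma> N"
  shows "c \<subseteq> N"
  using assms permutes_orbit_subset[OF assms(1)] by (auto simp: orbs_def)

lemma orbs_nonempty: "c \<in> orbs \<sigma> N \<Longrightarrow> c \<noteq> {}"
  by (auto simp: orbs_def orbit_nonempty)

lemma orbs_disjoint:
  assumes "\<sigma> permutes N" "finite N" "c \<in> orbs \<sigma> N" "d \<in> orbs \<sigma> N" "c \<noteq> d"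
  shows "c \<inter> d = {}"
  using orbs_eq_orbit[OF assms(1,2,3)] orbs_eq_orbit[OF assms(1,2,4)] assms(5) by auto

lemma Union_orbs:
  assumes "\<sigma> permutes N" "finite N"
  shows "\<Union>(orbs \<sigma> N) = N"
proof
  show "\<Union>(orbs \<sigma> N) \<subseteq> N"
    using orbs_subset[OF assms(1)] by blast
  show "N \<subseteq> \<Union>(orbs \<sigma> N)"
    using permutes_self_in_orbit[OF assms] by (auto simp: orbs_def)
qed

lemma finite_in_orbs: "\<sigma> permutes N \<Longrightarrow> finite N \<Longrightarrow> c \<in> orbs \<sigma> N \<Longrightarrow> finite c"
  using orbs_subset finite_subset by metis

lemma orbit_enum:
  fixes x :: 'a
  assumes "\<sigma> permutes N" "finite N"
  defines "m \<equiv> card (orbit \<sigma> x)"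
  shows "m > 0" "(\<sigma> ^^ m) x = x" "orbit \<sigma> x = (\<lambda>j. (\<sigma> ^^ j) x) ` {..<m}"
    "inj_on (\<lambda>j. (\<sigma> ^^ j) x) {..<m}"
proof -
  have self: "x \<in> orbit \<sigma> x"
    by (rule permutes_self_in_orbit[OF assms(1,2)])
  define k where "k = funpow_dist1 \<sigma> x x"
  have k: "k > 0" "(\<sigma> ^^ k) x = x"
    using funpow_dist1_prop[OF self] by (simp_all add: k_def)
  have inj: "inj_on (\<lambda>j. (\<sigma> ^^ j) x) {..<k}"
    using inj_on_funpow_dist1[OF self] unfolding k_def lessThan_atLeast0 .
  have orb: "orbit \<sigma> x = (\<lambda>j. (\<sigma> ^^ j) x) ` {..<k}"
    unfolding orbit_altdef_bounded[OF k(2,1)] by auto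
  have "m = k"
    unfolding m_def orb using card_image[OF inj] by simp
  with k inj orb show "m > 0" "(\<sigma> ^^ m) x = x"
      "orbit \<sigma> x = (\<lambda>j. (\<sigma> ^^ j) x) ` {..<m}" "inj_on (\<lambda>j. (\<sigma> ^^ j) x) {..<m}"
    by auto
qed

text \<open>Left multiplication by a transposition changes only the steps of \<open>\<sigma>\<close>
  that end in \<alpha> or \<beta>; before the first such step the path of x is unchanged.\<close>

lemma funpow_transpose_comp:
  fixes \<sigma> :: "'a \<Rightarrow> 'a"
  assumes "\<And>j. 0 < j \<Longrightarrow> j < k \<Longrightarrow> (\<sigma> ^^ j) x \<noteq> \<alpha> \<and> (\<sigma> ^^ j) x \<noteq> \<beta>"
  shows "j < k \<Longrightarrow> ((transpose \<alpha> \<beta> \<circ> \<sigma>) ^^ j) x = (\<sigma> ^^ j) x"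
    "k > 0 \<Longrightarrow> ((transpose \<alpha> \<beta> \<circ> \<sigma>) ^^ k) x = transpose \<alpha> \<beta> ((\<sigma> ^^ k) x)"
proof -
  have *: "((transpose \<alpha> \<beta> \<circ> \<sigma>) ^^ j) x = (\<sigma> ^^ j) x" if "j < k" for j
    using that
  proof (induction j)
    case (Suc j)
    then show ?case
      using assms[of "Suc j"] transpose_apply_other[of "\<sigma> ((\<sigma> ^^ j) x)" \<alpha> \<beta>] by simp
  qed auto
  show "j < k \<Longrightarrow> ((transpose \<alpha> \<beta> \<circ> \<sigma>) ^^ j) x = (\<sigma> ^^ j) x"
    by (rule *)
  show "((transpose \<alpha> \<beta> \<circ> \<sigma>) ^^ k) x = transpose \<alpha> \<beta> ((\<sigma> ^^ k) x)" if "k > 0"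
    using that *[of "k - 1"] by (cases k) auto
qed

lemma orbit_transpose_other:
  assumes "\<sigma> permutes N" "finite N" "\<alpha> \<notin> orbit \<sigma> x" "\<beta> \<notin> orbit \<sigma> x"
  shows "orbit (transpose \<alpha> \<beta> \<circ> \<sigma>) x = orbit \<sigma> x"
proof -
  define m where "m = card (orbit \<sigma> x)"
  note en = orbit_enum[OF assms(1,2), of x, folded m_def]
  have ne: "(\<sigma> ^^ j) x \<noteq> \<alpha> \<and> (\<sigma> ^^ j) x \<noteq> \<beta>" for j
    using funpow_in_orbit[OF permutes_self_in_orbit[OF assms(1,2)]] assms(3,4) by metis
  have 1: "((transpose \<alpha> \<beta> \<circ> \<sigma>) ^^ j) x = (\<sigma> ^^ j) x" for j
    by (rule funpow_transpose_comp(1)[of "Suc j"]) (use ne in auto)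
  have "((transpose \<alpha> \<beta> \<circ> \<sigma>) ^^ m) x = x"
    using 1 en by simp
  from orbit_altdef_bounded[OF this en(1)] show ?thesis
    by (auto simp: 1 en(3))
qed

text \<open>The path of \<alpha> runs through its own cycle; the step back to \<alpha> is diverted
  to \<beta>, and after the cycle of \<beta> the step back to \<beta> is diverted to
  \<alpha>.\<close>

lemma orbit_transpose_merge:
  assumes "\<sigma> permutes N" "finite N" "\<beta> \<notin> orbit \<sigma> \<alpha>"
  shows "orbit (transpose \<alpha> \<beta> \<circ> \<sigma>) \<alpha> = orbit \<sigma> \<alpha> \<union> orbit \<sigma> \<beta>"
proof -
  let ?s = "transpose \<alpha> \<beta> \<circ> \<sigma>"
  define k l where "k = card (orbit \<sigma> \<alpha>)" and "l = card (orbit \<sigma> \<beta>)"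
  note ea = orbit_enum[OF assms(1,2), of \<alpha>, folded k_def]
  note eb = orbit_enum[OF assms(1,2), of \<beta>, folded l_def]
  have self: "\<And>x. x \<in> orbit \<sigma> x"
    by (rule permutes_self_in_orbit[OF assms(1,2)])
  have \<alpha>: "\<alpha> \<notin> orbit \<sigma> \<beta>"
    using orbit_swap[OF self, of \<alpha> \<beta>] assms(3) by blast
  have na: "(\<sigma> ^^ j) \<alpha> \<noteq> \<alpha> \<and> (\<sigma> ^^ j) \<alpha> \<noteq> \<beta>" if "0 < j" "j < k" for j
    using inj_onD[OF ea(4), of j 0] that funpow_in_orbit[OF self[of \<alpha>], of j] assms(3) by auto
  have nb: "(\<sigma> ^^ j) \<beta> \<noteq> \<alpha> \<and> (\<sigma> ^^ j) \<beta> \<noteq> \<beta>" if "0 < j" "j < l" for j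
    using inj_onD[OF eb(4), of j 0] that funpow_in_orbit[OF self[of \<beta>], of j] \<alpha> by auto
  have a: "j < k \<Longrightarrow> (?s ^^ j) \<alpha> = (\<sigma> ^^ j) \<alpha>" "(?s ^^ k) \<alpha> = \<beta>" for j
    using funpow_transpose_comp[of k \<sigma> \<alpha> \<alpha> \<beta>, OF na] ea by auto
  have b: "j < l \<Longrightarrow> (?s ^^ j) \<beta> = (\<sigma> ^^ j) \<beta>" "(?s ^^ l) \<beta> = \<alpha>" for j
    using funpow_transpose_comp[of l \<sigma> \<beta> \<alpha> \<beta>, OF nb] eb by auto
  have ab: "(?s ^^ (j + k)) \<alpha> = (?s ^^ j) \<beta>" for j
    by (simp add: funpow_add a(2))
  have per: "(?s ^^ (l + k)) \<alpha> = \<alpha>" "l + k > 0"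
    using ea(1) by (simp_all add: ab b(2))
  have "orbit ?s \<alpha> = (\<lambda>j. (?s ^^ j) \<alpha>) ` {..<l + k}"
    unfolding orbit_altdef_bounded[OF per] by auto
  also have "{..<l + k} = {..<k} \<union> (\<lambda>j. j + k) ` {..<l}"
    by (simp add: lessThan_atLeast0 image_add_atLeastLessThan' ivl_disj_un_two(3))
  also have "(\<lambda>j. (?s ^^ j) \<alpha>) ` \<dots> = orbit \<sigma> \<alpha> \<union> orbit \<sigma> \<beta>"
    unfolding ea(3) eb(3) image_Un image_image ab
    using a(1) b(1) by (intro arg_cong2[of _ _ _ _ "(\<union>)"] image_cong) auto
  finally show ?thesis .
qed

text \<open>The step that reaches \<beta> is diverted to \<alpha> and closes the first part;
  starting from \<beta>, the step that reaches \<alpha> is diverted to \<beta> and closes the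
  second.\<close>

lemma orbit_transpose_split:
  assumes "\<sigma> permutes N" "finite N" "0 < i" "i < card (orbit \<sigma> \<alpha>)"
  defines "\<beta> \<equiv> (\<sigma> ^^ i) \<alpha>"
  shows "orbit (transpose \<alpha> \<beta> \<circ> \<sigma>) \<alpha> = (\<lambda>j. (\<sigma> ^^ j) \<alpha>) ` {..<i}"
    "orbit (transpose \<alpha> \<beta> \<circ> \<sigma>) \<beta> = (\<lambda>j. (\<sigma> ^^ j) \<alpha>) ` {i..<card (orbit \<sigma> \<alpha>)}"
proof -
  let ?s = "transpose \<alpha> \<beta> \<circ> \<sigma>"
  define k where "k = card (orbit \<sigma> \<alpha>)"
  note ea = orbit_enum[OF assms(1,2), of \<alpha>, folded k_def]
  have ik: "0 < i" "i < k"
    using assms(3,4) by (simp_all add: k_def)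
  have ne: "(\<sigma> ^^ j) \<alpha> \<noteq> \<alpha> \<and> (\<sigma> ^^ j) \<alpha> \<noteq> \<beta>" if "0 < j" "j < k" "j \<noteq> i" for j
    using inj_onD[OF ea(4), of j 0] inj_onD[OF ea(4), of j i] that ik by (auto simp: \<beta>_def)
  have a: "j < i \<Longrightarrow> (?s ^^ j) \<alpha> = (\<sigma> ^^ j) \<alpha>" "(?s ^^ i) \<alpha> = \<alpha>" for j
    using funpow_transpose_comp[of i \<sigma> \<alpha> \<alpha> \<beta>] ne ik by (auto simp: \<beta>_def)
  have add: "(\<sigma> ^^ j) \<beta> = (\<sigma> ^^ (j + i)) \<alpha>" for j
    by (simp add: funpow_add \<beta>_def)
  have nb: "(\<sigma> ^^ j) \<beta> \<noteq> \<alpha> \<and> (\<sigma> ^^ j) \<beta> \<noteq> \<beta>" if "0 < j" "j < k - i" for j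
    using ne[of "j + i"] that by (simp add: add)
  have b: "j < k - i \<Longrightarrow> (?s ^^ j) \<beta> = (\<sigma> ^^ (j + i)) \<alpha>" "(?s ^^ (k - i)) \<beta> = \<beta>" for j
    using funpow_transpose_comp[of "k - i" \<sigma> \<beta> \<alpha> \<beta>, OF nb] ea ik by (auto simp: add)
  show "orbit ?s \<alpha> = (\<lambda>j. (\<sigma> ^^ j) \<alpha>) ` {..<i}"
    unfolding orbit_altdef_bounded[OF a(2) ik(1)] image_Collect[symmetric] lessThan_def
    by (intro image_cong) (use a(1) in auto)
  have "orbit ?s \<beta> = (\<lambda>j. (\<sigma> ^^ (j + i)) \<alpha>) ` {..<k - i}"
    unfolding orbit_altdef_bounded[OF b(2) zero_less_diff[THEN iffD2, OF ik(2)]]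
      image_Collect[symmetric] lessThan_def
    by (intro image_cong) (use b(1) in auto)
  also have "\<dots> = (\<lambda>j. (\<sigma> ^^ j) \<alpha>) ` ((\<lambda>j. j + i) ` {..<k - i})"
    by (simp add: image_image)
  also have "(\<lambda>j. j + i) ` {..<k - i} = {i..<k}"
    using ik by (simp add: lessThan_atLeast0 image_add_atLeastLessThan')
  finally show "orbit ?s \<beta> = (\<lambda>j. (\<sigma> ^^ j) \<alpha>) ` {i..<card (orbit \<sigma> \<alpha>)}"
    unfolding k_def .
qed

lemma permutes_transpose_comp:
  "\<sigma> permutes N \<Longrightarrow> \<alpha> \<in> N \<Longrightarrow> \<beta> \<in> N \<Longrightarrow> transpose \<alpha> \<beta> \<circ> \<sigma> permutes N"
  by (intro permutes_compose permutes_swap_id)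

lemma orbs_transpose:
  assumes "\<sigma> permutes N" "finite N" "\<alpha> \<in> N" "\<beta> \<in> N"
  shows "orbs (transpose \<alpha> \<beta> \<circ> \<sigma>) N =
    {orbit (transpose \<alpha> \<beta> \<circ> \<sigma>) \<alpha>, orbit (transpose \<alpha> \<beta> \<circ> \<sigma>) \<beta>} \<union> (orbs \<sigma> N - {orbit \<sigma> \<alpha>, orbit \<sigma> \<beta>})"
    (is "orbs ?s N = ?O \<union> ?R")
proof -
  have self: "\<And>x. x \<in> orbit \<sigma> x"
    by (rule permutes_self_in_orbit[OF assms(1,2)])
  have out: "\<alpha> \<notin> orbit \<sigma> x \<and> \<beta> \<notin> orbit \<sigma> x \<longleftrightarrow> orbit \<sigma> x \<notin> {orbit \<sigma> \<alpha>, orbit \<sigma> \<beta>}" for x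
    using permutes_orbit_eq[OF assms(1,2)] self by blast
  have s: "?s permutes N"
    by (rule permutes_transpose_comp[OF assms(1,3,4)])
  note selfs = permutes_self_in_orbit[OF s assms(2)]
  \<comment> \<open>The transposition is an involution, so orbits of \<open>?s\<close> that avoid
    \<alpha> and \<beta> are also orbits of \<open>\<sigma>\<close>.\<close>
  have swap: "\<sigma> = transpose \<alpha> \<beta> \<circ> ?s"
    by (simp add: fun_eq_iff)
  have "orbit ?s x \<in> ?O \<union> ?R" if "x \<in> N" for x
  proof (cases "\<alpha> \<in> orbit ?s x \<or> \<beta> \<in> orbit ?s x")
    case True
    then show ?thesis
      using permutes_orbit_eq[OF s assms(2)] by blast
  next
    case False
    then have eq: "orbit \<sigma> x = orbit ?s x"
      using orbit_transpose_other[OF s assms(2), of \<alpha> x \<beta>] swap by simp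
    with False out[of x] show ?thesis
      using orbit_in_orbs[OF that, of \<sigma>] by auto
  qed
  moreover have "c \<in> orbs ?s N" if "c \<in> ?R" for c
  proof -
    from that obtain x where x: "x \<in> N" "c = orbit \<sigma> x"
      by (auto simp: orbs_def)
    with that out[of x] have "orbit ?s x = c"
      using orbit_transpose_other[OF assms(1,2), of \<alpha> x \<beta>] by auto
    with x(1) show ?thesis
      by (auto simp: orbs_def)
  qed
  ultimately show ?thesis
    using assms(3,4) by (auto simp: orbs_def)
qed

text \<open>The cycle of \<alpha> is kept apart from the others because \<open>Xfun\<close> and
  \<open>Dfun\<close> treat it separately.\<close>

lemma orbs_merge:
  assumes "\<sigma> permutes N" "finite N" "\<alpha> \<in> N" "\<beta> \<in> N" "\<beta> \<notin> orbit \<sigma> \<alpha>"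
  defines "\<sigma>' \<equiv> transpose \<alpha> \<beta> \<circ> \<sigma>"
  shows "orbit \<sigma>' \<alpha> = orbit \<sigma> \<alpha> \<union> orbit \<sigma> \<beta>"
    "orbs \<sigma>' N - {orbit \<sigma>' \<alpha>} = orbs \<sigma> N - {orbit \<sigma> \<alpha>} - {orbit \<sigma> \<beta>}"
proof -
  show oa: "orbit \<sigma>' \<alpha> = orbit \<sigma> \<alpha> \<union> orbit \<sigma> \<beta>"
    unfolding \<sigma>'_def by (rule orbit_transpose_merge[OF assms(1,2,5)])
  have s: "\<sigma>' permutes N"
    unfolding \<sigma>'_def by (rule permutes_transpose_comp[OF assms(1,3,4)])
  have self: "\<And>x. x \<in> orbit \<sigma> x"
    by (rule permutes_self_in_orbit[OF assms(1,2)])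
  have "\<beta> \<in> orbit \<sigma>' \<alpha>"
    using self by (auto simp: oa)
  then have ob: "orbit \<sigma>' \<beta> = orbit \<sigma>' \<alpha>"
    by (rule permutes_orbit_eq[OF s assms(2)])
  have "orbit \<sigma>' \<alpha> \<notin> orbs \<sigma> N"
  proof
    assume "orbit \<sigma>' \<alpha> \<in> orbs \<sigma> N"
    then have "orbit \<sigma>' \<alpha> = orbit \<sigma> \<alpha>"
      by (rule orbs_eq_orbit[OF assms(1,2)]) (use self oa in auto)
    with oa self assms(5) show False by blast
  qed
  then show "orbs \<sigma>' N - {orbit \<sigma>' \<alpha>} = orbs \<sigma> N - {orbit \<sigma> \<alpha>} - {orbit \<sigma> \<beta>}"
    using orbs_transpose[OF assms(1-4), folded \<sigma>'_def] by (auto simp: ob)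
qed

lemma orbs_split:
  assumes "\<sigma> permutes N" "finite N" "\<alpha> \<in> N" "0 < i" "i < card (orbit \<sigma> \<alpha>)"
  defines "\<beta> \<equiv> (\<sigma> ^^ i) \<alpha>"
  defines "\<sigma>' \<equiv> transpose \<alpha> \<beta> \<circ> \<sigma>"
  defines "B \<equiv> (\<lambda>j. (\<sigma> ^^ j) \<alpha>) ` {i..<card (orbit \<sigma> \<alpha>)}"
  shows "orbit \<sigma>' \<alpha> = (\<lambda>j. (\<sigma> ^^ j) \<alpha>) ` {..<i}"
    "orbs \<sigma>' N - {orbit \<sigma>' \<alpha>} = insert B (orbs \<sigma> N - {orbit \<sigma> \<alpha>})"
    "B \<notin> orbs \<sigma> N"
proof -
  define k where "k = card (orbit \<sigma> \<alpha>)"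
  note ea = orbit_enum[OF assms(1,2), of \<alpha>, folded k_def]
  have ik: "0 < i" "i < k"
    using assms(4,5) by (simp_all add: k_def)
  show oa: "orbit \<sigma>' \<alpha> = (\<lambda>j. (\<sigma> ^^ j) \<alpha>) ` {..<i}"
    unfolding \<sigma>'_def \<beta>_def by (rule orbit_transpose_split(1)[OF assms(1,2,4,5)])
  have ob: "orbit \<sigma>' \<beta> = B"
    unfolding \<sigma>'_def \<beta>_def B_def by (rule orbit_transpose_split(2)[OF assms(1,2,4,5)])
  have self: "\<And>x. x \<in> orbit \<sigma> x"
    by (rule permutes_self_in_orbit[OF assms(1,2)])
  have \<beta>o: "\<beta> \<in> orbit \<sigma> \<alpha>"
    unfolding \<beta>_def by (rule funpow_in_orbit[OF self])
  then have \<beta>N: "\<beta> \<in> N" and eq: "orbit \<sigma> \<beta> = orbit \<sigma> \<alpha>"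
    using permutes_orbit_subset[OF assms(1,3)] permutes_orbit_eq[OF assms(1,2)] by auto
  have s: "\<sigma>' permutes N"
    unfolding \<sigma>'_def by (rule permutes_transpose_comp[OF assms(1,3) \<beta>N])
  have \<alpha>B: "\<alpha> \<notin> B"
    using inj_onD[OF ea(4), of 0] ik by (force simp: B_def k_def[symmetric])
  have \<beta>B: "\<beta> \<in> B"
    using ik by (auto simp: B_def k_def[symmetric] \<beta>_def)
  have Bsub: "B \<subseteq> orbit \<sigma> \<alpha>"
    using funpow_in_orbit[OF self] by (auto simp: B_def)
  show Bnot: "B \<notin> orbs \<sigma> N"
    using orbs_eq_orbit[OF assms(1,2) _ \<beta>B] eq \<alpha>B self by metis
  have \<alpha>': "\<alpha> \<in> orbit \<sigma>' \<alpha>"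
    by (rule permutes_self_in_orbit[OF s assms(2)])
  have ne: "orbit \<sigma>' \<alpha> \<noteq> B"
    using \<alpha>B \<alpha>' by auto
  have "orbit \<sigma>' \<alpha> \<notin> orbs \<sigma> N - {orbit \<sigma> \<alpha>}"
    using orbs_eq_orbit[OF assms(1,2) _ \<alpha>'] by blast
  then show "orbs \<sigma>' N - {orbit \<sigma>' \<alpha>} = insert B (orbs \<sigma> N - {orbit \<sigma> \<alpha>})"
    using orbs_transpose[OF assms(1-3) \<beta>N, folded \<sigma>'_def] ne by (auto simp: ob eq)
qed

section \<open>Parity of the number of cycles, and the sign\<close>

lemma card_orbs_transpose_parity:
  assumes "\<sigma> permutes N" "finite N" "\<alpha> \<in> N" "\<beta> \<in> N" "\<alpha> \<noteq> \<beta>"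
  shows "(-1) ^ card (orbs (transpose \<alpha> \<beta> \<circ> \<sigma>) N) = - ((-1) ^ card (orbs \<sigma> N) :: 'a :: ring_1)"
proof -
  let ?s = "transpose \<alpha> \<beta> \<circ> \<sigma>"
  have fin: "finite (orbs \<sigma> N)" "finite (orbs ?s N)"
    using assms(2) by simp_all
  have card': "card (orbs ?s N) = Suc (card (orbs ?s N - {orbit ?s \<alpha>}))"
    using card.remove[OF fin(2) orbit_in_orbs[OF assms(3)]] .
  have card: "card (orbs \<sigma> N) = Suc (card (orbs \<sigma> N - {orbit \<sigma> \<alpha>}))"
    using card.remove[OF fin(1) orbit_in_orbs[OF assms(3)]] .
  show ?thesis
  proof (cases "\<beta> \<in> orbit \<sigma> \<alpha>")
    case False
    have "orbit \<sigma> \<beta> \<in> orbs \<sigma> N - {orbit \<sigma> \<alpha>}"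
      using False permutes_self_in_orbit[OF assms(1,2), of \<beta>] orbit_in_orbs[OF assms(4), of \<sigma>]
      by auto
    from card.remove[OF _ this] have "card (orbs \<sigma> N) = Suc (card (orbs ?s N))"
      using fin card card' orbs_merge(2)[OF assms(1-4) False] by simp
    then show ?thesis by simp
  next
    case True
    note en = orbit_enum[OF assms(1,2), of \<alpha>]
    from True en(3) obtain i where i: "i < card (orbit \<sigma> \<alpha>)" "\<beta> = (\<sigma> ^^ i) \<alpha>"
      by auto
    with assms(5) have "i > 0" by (cases i) auto
    note sp = orbs_split[OF assms(1-3) this i(1), folded i(2)]
    have "card (orbs ?s N) = Suc (card (orbs \<sigma> N))"
      using card card' fin sp(2,3) by simp
    then show ?thesis by simp
  qed
qed

lemma fixed_orbs:
  assumes "\<And>x. x \<in> Y \<Longrightarrow> \<sigma> x = x"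
  shows "orbs \<sigma> Y = (\<lambda>x. {x}) ` Y"
  unfolding orbs_def by (intro image_cong refl) (simp add: assms orbit_eq_singleton_iff)

lemma orbs_id: "orbs id N = (\<lambda>x. {x}) ` N"
  by (rule fixed_orbs) simp

text \<open>Both sides change sign under multiplication by a transposition, the right one because
  two cycles merge or one splits. The exponent is a sum, which has the parity of the
  difference.\<close>

lemma sign_orbs:
  assumes "\<sigma> permutes N" "finite N"
  shows "of_int (sign \<sigma>) = ((-1) ^ (card N + card (orbs \<sigma> N)) :: 'a :: comm_ring_1)"
  using assms
proof (induction rule: permutes_induct)
  case id
  have "card (orbs id N) = card N"
    unfolding orbs_id by (simp add: card_image)
  then show ?case
    unfolding sign_id by (simp only:) (simp flip: mult_2)
next
  case (swap a b p)
  have sgn: "sign (transpose a b \<circ> p) = - sign p"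
    using swap assms(2) sign_compose[OF permutation_swap_id, of p a b]
    by (simp add: sign_swap_id permutation_permutes) metis
  have "of_int (- sign p) = - ((-1) ^ card N * (-1) ^ card (orbs p N) :: 'a)"
    using swap.IH by (simp add: power_add)
  then show ?case
    unfolding sgn power_add
      card_orbs_transpose_parity[OF swap.hyps(4) assms(2) swap.hyps(1-3), where ?'a = 'a]
    by (simp only: mult_minus_right)
qed

lemma orbs_conj:
  assumes "bij \<psi>" "\<sigma> permutes N" "finite N"
  shows "orbs (\<psi> \<circ> \<sigma> \<circ> inv \<psi>) (\<psi> ` N) = (`) \<psi> ` orbs \<sigma> N"
proof -
  have "orbit (\<psi> \<circ> \<sigma> \<circ> inv \<psi>) (\<psi> x) = \<psi> ` orbit \<sigma> x" for x
  proof -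
    have pow: "((\<psi> \<circ> \<sigma> \<circ> inv \<psi>) ^^ j) (\<psi> x) = \<psi> ((\<sigma> ^^ j) x)" for j
      using assms(1) by (induction j) (auto simp: bij_is_inj)
    show ?thesis
      unfolding orbit_altdef by (auto simp: pow)
  qed
  then show ?thesis
    by (auto simp: orbs_def image_image)
qed

lemma orbs_inv:
  assumes "\<sigma> permutes N" "finite N"
  shows "orbs (inv \<sigma>) N = orbs \<sigma> N"
proof -
  have "permutation \<sigma>"
    using assms by (auto simp: permutation_permutes)
  then show ?thesis
    by (simp add: orbs_def orbit_inv_eq)
qed

section \<open>Deformed sums over permutations\<close>

text \<open>The term \<open>z i + t\<close> of a fixed point. With value 0 on longer cycles, every
  cycle has a factor of the same form \<open>w c + fixw u c\<close>.\<close>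

definition fixw :: "(nat \<Rightarrow> complex) \<Rightarrow> nat set \<Rightarrow> complex" where
  "fixw u c = (if card c = 1 then u (the_elem c) else 0)"

text \<open>For \<open>w c = p (card c)\<close> this is the coefficient of \<open>\<sigma>\<close>
  in \<tau>(p). The function u stays an argument because the crossed product permutes it.\<close>

definition cyc_weight :: "nat set \<Rightarrow> (nat set \<Rightarrow> complex) \<Rightarrow> (nat \<Rightarrow> complex) \<Rightarrow> (nat \<Rightarrow> nat) \<Rightarrow> complex" where
  "cyc_weight N w u \<sigma> = (\<Prod>c\<in>orbs \<sigma> N. w c + fixw u c)"

lemma fixw_singleton [simp]: "fixw u {x} = u x"
  by (simp add: fixw_def)

lemma fixw_comp_eq:
  assumes "\<And>x. x \<in> c \<Longrightarrow> u x = v x"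
  shows "fixw u c = fixw v c"
  using assms by (auto simp: fixw_def card_1_singleton_iff)

text \<open>Solves the recursion of divided differences along a cycle; k will be the number of
  points of the cycle other than its base point.\<close>

lemma unroll_recursion:
  fixes a b g :: "nat \<Rightarrow> complex"
  assumes "\<And>i. 1 \<le> i \<Longrightarrow> i \<le> k \<Longrightarrow> a i = g i * (a (Suc i) - b i)"
  shows "a 1 = (\<Prod>j\<in>{1..k}. g j) * a (Suc k) - (\<Sum>i\<in>{1..k}. (\<Prod>j\<in>{1..i}. g j) * b i)"
  using assms
proof (induction k)
  case (Suc k)
  have "a 1 = (\<Prod>j\<in>{1..k}. g j) * a (Suc k) - (\<Sum>i\<in>{1..k}. (\<Prod>j\<in>{1..i}. g j) * b i)"
    by (rule Suc.IH) (use Suc.prems in auto)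
  also have "a (Suc k) = g (Suc k) * (a (Suc (Suc k)) - b (Suc k))"
    by (rule Suc.prems) auto
  finally show ?case
    by (simp add: algebra_simps)
qed auto

text \<open>A deformed power of a letter: with all nodes at 0 the value is
  \<open>(1 / x) ^ card c\<close>. Hence the reciprocal letters in the limit of colliding
  nodes.\<close>

definition recip_prod :: "(nat \<Rightarrow> complex) \<Rightarrow> complex \<Rightarrow> nat set \<Rightarrow> complex" where
  "recip_prod \<zeta> x c = (\<Prod>\<gamma>\<in>c. 1 / (x - \<zeta> \<gamma>))"

section \<open>Divided differences and poles at distinct nodes\<close>

locale distinct_nodes =
  fixes N :: "nat set" and \<zeta> :: "nat \<Rightarrow> complex"
  assumes fin: "finite N" and inj: "inj_on \<zeta> N"
begin

abbreviation R :: "complex \<Rightarrow> nat set \<Rightarrow> complex" where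
  "R \<equiv> recip_prod \<zeta>"

text \<open>Divided differences of a function at the nodes \<open>\<zeta>\<close>; \<open>R x\<close> arises in this way from
  \<open>z \<mapsto> 1 / (x - z)\<close>.\<close>

definition divdiff :: "(nat set \<Rightarrow> complex) \<Rightarrow> bool" where
  "divdiff w \<longleftrightarrow> (\<forall>c \<alpha> \<beta>. c \<subseteq> N \<and> \<alpha> \<in> N - c \<and> \<beta> \<in> N - c \<and> \<alpha> \<noteq> \<beta> \<longrightarrow>
     (\<zeta> \<alpha> - \<zeta> \<beta>) * w (insert \<alpha> (insert \<beta> c)) = w (insert \<alpha> c) - w (insert \<beta> c))"

text \<open>Partial fractions: \<open>1 / (x - \<zeta> \<alpha>) - 1 / (x - \<zeta> \<beta>)\<close>
  has the numerator \<open>\<zeta> \<alpha> - \<zeta> \<beta>\<close>.\<close>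

lemma divdiff_R:
  assumes "x \<notin> \<zeta> ` N"
  shows "divdiff (R x)"
  unfolding divdiff_def
proof (intro allI impI, elim conjE)
  fix c \<alpha> \<beta>
  assume *: "c \<subseteq> N" "\<alpha> \<in> N - c" "\<beta> \<in> N - c" "\<alpha> \<noteq> \<beta>"
  then have ne: "x - \<zeta> \<alpha> \<noteq> 0" "x - \<zeta> \<beta> \<noteq> 0"
    using assms by auto
  have "finite c"
    using * fin finite_subset by blast
  with * ne show "(\<zeta> \<alpha> - \<zeta> \<beta>) * R x (insert \<alpha> (insert \<beta> c)) = R x (insert \<alpha> c) - R x (insert \<beta> c)"
    by (simp add: recip_prod_def field_simps)
qed

lemma divdiff_diff:
  assumes "divdiff w" "divdiff v"
  shows "divdiff (\<lambda>c. w c - v c)"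
  unfolding divdiff_def
proof (intro allI impI)
  fix c \<alpha> \<beta>
  assume *: "c \<subseteq> N \<and> \<alpha> \<in> N - c \<and> \<beta> \<in> N - c \<and> \<alpha> \<noteq> \<beta>"
  show "(\<zeta> \<alpha> - \<zeta> \<beta>) * (w (insert \<alpha> (insert \<beta> c)) - v (insert \<alpha> (insert \<beta> c))) =
      w (insert \<alpha> c) - v (insert \<alpha> c) - (w (insert \<beta> c) - v (insert \<beta> c))"
    using assms[unfolded divdiff_def, rule_format, OF *] by (simp add: right_diff_distrib)
qed

lemma divdiff_zero: "divdiff (\<lambda>c. 0)"
  by (simp add: divdiff_def)

lemma node_eq_iff: "\<alpha> \<in> N \<Longrightarrow> \<beta> \<in> N \<Longrightarrow> \<zeta> \<alpha> = \<zeta> \<beta> \<longleftrightarrow> \<alpha> = \<beta>"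
  using inj by (auto dest: inj_onD)

text \<open>Near the node \<open>\<zeta> \<alpha>\<close> the function \<open>y \<mapsto> cyc_weight N (w - \<epsilon> R y) u \<psi>\<close> has at most a simple pole;
  \<open>Xfun\<close> is its product with \<open>y - \<zeta> \<alpha>\<close>, and \<open>- \<epsilon> * Dfun\<close> is its residue.\<close>

definition Xfun :: "nat \<Rightarrow> complex \<Rightarrow> (nat set \<Rightarrow> complex) \<Rightarrow> complex \<Rightarrow> (nat \<Rightarrow> complex) \<Rightarrow> (nat \<Rightarrow> nat) \<Rightarrow> complex" where
  "Xfun \<alpha> \<epsilon> w y u \<psi> =
    ((y - \<zeta> \<alpha>) * (w (orbit \<psi> \<alpha>) + fixw u (orbit \<psi> \<alpha>)) - \<epsilon> * R y (orbit \<psi> \<alpha> - {\<alpha>})) *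
    (\<Prod>d\<in>orbs \<psi> N - {orbit \<psi> \<alpha>}. w d - \<epsilon> * R y d + fixw u d)"

definition Dfun :: "nat \<Rightarrow> complex \<Rightarrow> (nat set \<Rightarrow> complex) \<Rightarrow> (nat \<Rightarrow> complex) \<Rightarrow> (nat \<Rightarrow> nat) \<Rightarrow> complex" where
  "Dfun \<alpha> \<epsilon> w u \<psi> = R (\<zeta> \<alpha>) (orbit \<psi> \<alpha> - {\<alpha>}) *
    (\<Prod>d\<in>orbs \<psi> N - {orbit \<psi> \<alpha>}. w d - \<epsilon> * R (\<zeta> \<alpha>) d + fixw u d)"

lemma Xfun_node: "Xfun \<alpha> \<epsilon> w (\<zeta> \<alpha>) u \<psi> = - \<epsilon> * Dfun \<alpha> \<epsilon> w u \<psi>"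
  by (simp add: Xfun_def Dfun_def)

text \<open>The cycles are disjoint and the nodes distinct, so the pole at
  \<open>\<zeta> \<alpha>\<close> sits in the factor of one cycle and is simple there.\<close>

lemma cyc_weight_Xfun:
  assumes "\<psi> permutes N" "\<alpha> \<in> N" "y \<noteq> \<zeta> \<alpha>"
  shows "cyc_weight N (\<lambda>c. w c - \<epsilon> * R y c) u \<psi> = Xfun \<alpha> \<epsilon> w y u \<psi> / (y - \<zeta> \<alpha>)"
proof -
  let ?c = "orbit \<psi> \<alpha>"
  have c: "?c \<in> orbs \<psi> N" "\<alpha> \<in> ?c" "finite ?c"
    using orbit_in_orbs[OF assms(2)] permutes_self_in_orbit[OF assms(1) fin]
      finite_in_orbs[OF assms(1) fin] by auto
  have "R y ?c = 1 / (y - \<zeta> \<alpha>) * R y (?c - {\<alpha>})"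
    unfolding recip_prod_def using prod.remove[OF c(3,2)] .
  then have "w ?c - \<epsilon> * R y ?c + fixw u ?c =
      ((y - \<zeta> \<alpha>) * (w ?c + fixw u ?c) - \<epsilon> * R y (?c - {\<alpha>})) / (y - \<zeta> \<alpha>)"
    using assms(3) by (simp add: field_simps)
  then show ?thesis
    unfolding cyc_weight_def Xfun_def using c(1) fin by (simp add: prod.remove)
qed

lemma R_deriv:
  assumes "c \<subseteq> N" "y \<notin> \<zeta> ` c"
  shows "((\<lambda>y. R y c) has_field_derivative - R y c * (\<Sum>\<gamma>\<in>c. 1 / (y - \<zeta> \<gamma>))) (at y)"
proof -
  have c: "finite c"
    using assms(1) fin finite_subset by blast
  have ne: "y - \<zeta> \<gamma> \<noteq> 0" if "\<gamma> \<in> c" for \<gamma>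
    using assms(2) that by auto
  have "((\<lambda>y. R y c) has_field_derivative
      (\<Sum>\<gamma>\<in>c. (- 1 / (y - \<zeta> \<gamma>)\<^sup>2) * (\<Prod>\<delta>\<in>c - {\<gamma>}. 1 / (y - \<zeta> \<delta>)))) (at y)"
    unfolding recip_prod_def
    by (rule has_field_derivative_prod)
      (use ne in \<open>auto intro!: derivative_eq_intros simp: power2_eq_square divide_simps\<close>)
  also have "(\<Sum>\<gamma>\<in>c. (- 1 / (y - \<zeta> \<gamma>)\<^sup>2) * (\<Prod>\<delta>\<in>c - {\<gamma>}. 1 / (y - \<zeta> \<delta>))) =
      (\<Sum>\<gamma>\<in>c. - R y c * (1 / (y - \<zeta> \<gamma>)))"
  proof (rule sum.cong[OF refl])
    fix \<gamma> assume "\<gamma> \<in> c"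
    then have "R y c = 1 / (y - \<zeta> \<gamma>) * (\<Prod>\<delta>\<in>c - {\<gamma>}. 1 / (y - \<zeta> \<delta>))"
      unfolding recip_prod_def by (rule prod.remove[OF c])
    then show "- 1 / (y - \<zeta> \<gamma>)\<^sup>2 * (\<Prod>\<delta>\<in>c - {\<gamma>}. 1 / (y - \<zeta> \<delta>)) = - R y c * (1 / (y - \<zeta> \<gamma>))"
      by (simp add: power2_eq_square)
  qed
  finally show ?thesis
    by (simp add: sum_distrib_left)
qed

lemma divdiff_orbit:
  assumes w: "divdiff w" and \<psi>: "\<psi> permutes N" and \<alpha>: "\<alpha> \<in> N"
  defines "k \<equiv> card (orbit \<psi> \<alpha>) - 1"
  defines "x \<equiv> (\<lambda>j. (\<psi> ^^ j) \<alpha>)"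
  defines "g \<equiv> (\<lambda>j. 1 / (\<zeta> \<alpha> - \<zeta> (x j)))"
  shows "w (orbit \<psi> \<alpha>) = (\<Prod>j\<in>{1..k}. g j) * w {\<alpha>} - (\<Sum>i\<in>{1..k}. (\<Prod>j\<in>{1..i}. g j) * w (x ` {i..<Suc k}))"
proof -
  have k: "card (orbit \<psi> \<alpha>) = Suc k"
    using orbit_enum(1)[OF \<psi> fin, of \<alpha>] by (simp add: k_def)
  have orb: "orbit \<psi> \<alpha> = x ` {..<Suc k}" and xinj: "inj_on x {..<Suc k}"
    using orbit_enum(3,4)[OF \<psi> fin, of \<alpha>] unfolding k x_def by auto
  have xN: "x j \<in> N" for j
    unfolding x_def using \<psi> \<alpha> by (induction j) (auto simp: permutes_in_image)
  have x0: "x 0 = \<alpha>"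
    by (simp add: x_def)
  have rec: "w (insert \<alpha> (x ` {i..<Suc k})) = g i * (w (insert \<alpha> (x ` {Suc i..<Suc k})) - w (x ` {i..<Suc k}))"
    if i: "1 \<le> i" "i \<le> k" for i
  proof -
    have ins: "x ` {i..<Suc k} = insert (x i) (x ` {Suc i..<Suc k})"
    proof -
      have "{i..<Suc k} = insert i {Suc i..<Suc k}"
        using i by auto
      then show ?thesis by simp
    qed
    have xi: "x i \<noteq> \<alpha>" "x i \<notin> x ` {Suc i..<Suc k}" "\<alpha> \<notin> x ` {Suc i..<Suc k}"
      using inj_onD[OF xinj, of i 0] inj_onD[OF xinj, of i] inj_onD[OF xinj, of 0] i x0 by force+
    have "(\<zeta> \<alpha> - \<zeta> (x i)) * w (insert \<alpha> (insert (x i) (x ` {Suc i..<Suc k}))) =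
        w (insert \<alpha> (x ` {Suc i..<Suc k})) - w (insert (x i) (x ` {Suc i..<Suc k}))"
      using w[unfolded divdiff_def, rule_format, of "x ` {Suc i..<Suc k}" \<alpha> "x i"] xi xN \<alpha> by auto
    moreover have "\<zeta> \<alpha> - \<zeta> (x i) \<noteq> 0"
      using node_eq_iff[OF \<alpha> xN] xi by auto
    ultimately show ?thesis
      unfolding ins g_def by (simp add: field_simps)
  qed
  have "w (insert \<alpha> (x ` {1..<Suc k})) = (\<Prod>j\<in>{1..k}. g j) * w (insert \<alpha> (x ` {Suc k..<Suc k})) -
     (\<Sum>i\<in>{1..k}. (\<Prod>j\<in>{1..i}. g j) * w (x ` {i..<Suc k}))"
    by (rule unroll_recursion[where a = "\<lambda>i. w (insert \<alpha> (x ` {i..<Suc k}))"]) (rule rec)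
  moreover have "insert \<alpha> (x ` {1..<Suc k}) = orbit \<psi> \<alpha>"
  proof -
    have "{..<Suc k} = insert 0 {1..<Suc k}"
      by auto
    then show ?thesis
      unfolding orb by (simp add: x0)
  qed
  ultimately show ?thesis
    by simp
qed

text \<open>The derivative of \<open>Xfun\<close> at the node is the product, in the crossed product of functions of \<open>u\<close>
  with the symmetric group, of \<open>u \<alpha> - (\<Sum>\<beta>. (\<alpha> \<beta>) / (\<zeta> \<alpha> - \<zeta> \<beta>))\<close> and \<open>Dfun\<close>, up to the scalar \<open>w {\<alpha>}\<close>.\<close>

lemma Xfun_deriv:
  assumes w: "divdiff w" and \<psi>: "\<psi> permutes N" and \<alpha>: "\<alpha> \<in> N" and \<epsilon>: "\<epsilon> * \<epsilon> = 1"
  shows "((\<lambda>y. Xfun \<alpha> \<epsilon> w y u \<psi>) has_field_derivative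
    (w {\<alpha>} + u \<alpha>) * Dfun \<alpha> \<epsilon> w u \<psi> -
    (\<Sum>\<beta>\<in>N - {\<alpha>}. Dfun \<alpha> \<epsilon> w (u \<circ> transpose \<alpha> \<beta>) (transpose \<alpha> \<beta> \<circ> \<psi>) / (\<zeta> \<alpha> - \<zeta> \<beta>))) (at (\<zeta> \<alpha>))"
proof -
  define c where "c = orbit \<psi> \<alpha>"
  define O' where "O' = orbs \<psi> N - {c}"
  define V where "V = (\<lambda>d. w d - \<epsilon> * R (\<zeta> \<alpha>) d + fixw u d)"
  define h where "h = (\<lambda>\<gamma>. 1 / (\<zeta> \<alpha> - \<zeta> \<gamma>))"
  define G where "G = R (\<zeta> \<alpha>) (c - {\<alpha>})"
  define PV where "PV = (\<Prod>d\<in>O'. V d)"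
  define k where "k = card c - 1"
  define x where "x = (\<lambda>j. (\<psi> ^^ j) \<alpha>)"
  define g where "g = (\<lambda>j. 1 / (\<zeta> \<alpha> - \<zeta> (x j)))"
  define B where "B = (\<lambda>i. x ` {i..<Suc k})"
  have k: "card c = Suc k"
    using orbit_enum(1)[OF \<psi> fin, of \<alpha>] by (simp add: k_def c_def)
  have orb: "c = x ` {..<Suc k}" and xinj: "inj_on x {..<Suc k}"
    using orbit_enum(3,4)[OF \<psi> fin, of \<alpha>] unfolding x_def[symmetric] c_def[symmetric] k .
  have x0: "x 0 = \<alpha>"
    by (simp add: x_def)
  have cN: "c \<subseteq> N" and \<alpha>c: "\<alpha> \<in> c" and finc: "finite c" and cO: "c \<in> orbs \<psi> N"
    using permutes_orbit_subset[OF \<psi> \<alpha>] permutes_self_in_orbit[OF \<psi> fin] fin finite_subset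
      orbit_in_orbs[OF \<alpha>]
    by (auto simp: c_def)
  have c_minus: "c - {\<alpha>} = x ` {1..k}"
  proof -
    have "{..<Suc k} = insert 0 {1..k}"
      by auto
    moreover have "\<alpha> \<notin> x ` {1..k}"
      using inj_onD[OF xinj, of 0] x0 by force
    ultimately show ?thesis
      unfolding orb by (simp add: x0)
  qed
  have xinj': "inj_on x {1..k}"
    by (rule inj_on_subset[OF xinj]) auto
  have G: "G = (\<Prod>j\<in>{1..k}. g j)"
    unfolding G_def recip_prod_def c_minus g_def by (simp only: prod.reindex[OF xinj'] comp_def)
  have O'N: "d \<subseteq> N" "\<alpha> \<notin> d" "finite d" if "d \<in> O'" for d
    using that orbs_subset[OF \<psi>, of d] orbs_disjoint[OF \<psi> fin, of d c] \<alpha>c cO finite_in_orbs[OF \<psi> fin, of d]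
    by (auto simp: O'_def)
  have node: "\<zeta> \<alpha> \<notin> \<zeta> ` d" if "d \<subseteq> N" "\<alpha> \<notin> d" for d
    using that node_eq_iff[OF \<alpha>] by auto
  have finO': "finite O'"
    by (simp add: O'_def fin)
  have R_h: "R (\<zeta> \<alpha>) d = (\<Prod>\<gamma>\<in>d. h \<gamma>)" for d
    by (simp add: recip_prod_def h_def)

  let ?f = "\<lambda>y. (y - \<zeta> \<alpha>) * (w c + fixw u c) - \<epsilon> * R y (c - {\<alpha>})"
  have d1: "(?f has_field_derivative (w c + fixw u c) + \<epsilon> * G * (\<Sum>\<gamma>\<in>c - {\<alpha>}. h \<gamma>)) (at (\<zeta> \<alpha>))"
    by (rule derivative_eq_intros R_deriv node refl | use cN in \<open>force simp: G_def h_def\<close>)+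
  have d2: "((\<lambda>y. \<Prod>d\<in>O'. w d - \<epsilon> * R y d + fixw u d) has_field_derivative
      (\<Sum>d\<in>O'. \<epsilon> * (R (\<zeta> \<alpha>) d * (\<Sum>\<gamma>\<in>d. h \<gamma>)) * (\<Prod>e\<in>O' - {d}. w e - \<epsilon> * R (\<zeta> \<alpha>) e + fixw u e))) (at (\<zeta> \<alpha>))"
    by (rule has_field_derivative_prod)
      (rule derivative_eq_intros R_deriv node refl | use O'N in \<open>force simp: h_def\<close>)+
  have dX: "((\<lambda>y. Xfun \<alpha> \<epsilon> w y u \<psi>) has_field_derivative
      ((w c + fixw u c) + \<epsilon> * G * (\<Sum>\<gamma>\<in>c - {\<alpha>}. h \<gamma>)) * PV +
      (\<Sum>d\<in>O'. \<epsilon> * (R (\<zeta> \<alpha>) d * (\<Sum>\<gamma>\<in>d. h \<gamma>)) * (\<Prod>e\<in>O' - {d}. V e)) * (- \<epsilon> * G)) (at (\<zeta> \<alpha>))"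
    using DERIV_mult[OF d1 d2] by (simp add: Xfun_def c_def O'_def PV_def V_def G_def)
  \<comment> \<open>One \<epsilon> comes from the value at the node of the factor for the cycle of
    \<alpha>, the other from the derivative of another factor; their product is 1, as the merging
    terms require.\<close>
  have e1: "(\<Sum>d\<in>O'. \<epsilon> * (R (\<zeta> \<alpha>) d * (\<Sum>\<gamma>\<in>d. h \<gamma>)) * (\<Prod>e\<in>O' - {d}. V e)) * (- \<epsilon> * G) =
      - (\<epsilon> * \<epsilon>) * G * (\<Sum>d\<in>O'. R (\<zeta> \<alpha>) d * (\<Sum>\<gamma>\<in>d. h \<gamma>) * (\<Prod>e\<in>O' - {d}. V e))"
    by (simp add: sum_distrib_left sum_distrib_right mult_ac flip: sum_negf)
  \<comment> \<open>A \<beta> outside the cycle of \<alpha> merges its cycle d with it. The terms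
    for one d add up to the derivative of \<open>R y d\<close>.\<close>
  have merge: "(\<Sum>\<beta>\<in>N - c. Dfun \<alpha> \<epsilon> w (u \<circ> transpose \<alpha> \<beta>) (transpose \<alpha> \<beta> \<circ> \<psi>) / (\<zeta> \<alpha> - \<zeta> \<beta>)) =
      G * (\<Sum>d\<in>O'. R (\<zeta> \<alpha>) d * (\<Sum>\<gamma>\<in>d. h \<gamma>) * (\<Prod>e\<in>O' - {d}. V e))"
  proof -
    have D: "Dfun \<alpha> \<epsilon> w (u \<circ> transpose \<alpha> \<beta>) (transpose \<alpha> \<beta> \<circ> \<psi>) =
        G * R (\<zeta> \<alpha>) d * (\<Prod>e\<in>O' - {d}. V e)" if d: "d \<in> O'" "\<beta> \<in> d" for d \<beta>
    proof -
      have \<beta>N: "\<beta> \<in> N"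
        using O'N d by blast
      have od: "orbit \<psi> \<beta> = d"
        using orbs_eq_orbit[OF \<psi> fin _ d(2)] d(1) by (auto simp: O'_def)
      have \<beta>c: "\<beta> \<notin> orbit \<psi> \<alpha>"
        using orbs_disjoint[OF \<psi> fin, of d c] d cO by (auto simp: O'_def c_def)
      note m = orbs_merge[OF \<psi> fin \<alpha> \<beta>N \<beta>c, folded c_def, unfolded od, folded O'_def]
      have dis: "(c - {\<alpha>}) \<inter> d = {}"
        using orbs_disjoint[OF \<psi> fin, of d c] d cO by (auto simp: O'_def)
      have "c \<union> d - {\<alpha>} = (c - {\<alpha>}) \<union> d"
        using O'N(2)[OF d(1)] by auto
      then have R: "R (\<zeta> \<alpha>) (c \<union> d - {\<alpha>}) = G * R (\<zeta> \<alpha>) d"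
        using dis finc O'N(3)[OF d(1)] by (simp add: G_def recip_prod_def prod.union_disjoint)
      have V: "w e - \<epsilon> * R (\<zeta> \<alpha>) e + fixw (u \<circ> transpose \<alpha> \<beta>) e = V e" if e: "e \<in> O' - {d}" for e
      proof -
        have "\<beta> \<notin> e"
          using orbs_eq_orbit[OF \<psi> fin, of e N \<beta>] e od by (auto simp: O'_def)
        then have "fixw (u \<circ> transpose \<alpha> \<beta>) e = fixw u e"
          using O'N(2)[of e] e transpose_apply_other[of _ \<alpha> \<beta>]
          by (intro fixw_comp_eq) (metis DiffD1 comp_apply)
        then show ?thesis
          by (simp add: V_def)
      qed
      have P: "(\<Prod>e\<in>O' - {d}. w e - \<epsilon> * R (\<zeta> \<alpha>) e + fixw (u \<circ> transpose \<alpha> \<beta>) e) = (\<Prod>e\<in>O' - {d}. V e)"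
        by (rule prod.cong[OF refl V])
      show ?thesis
        unfolding Dfun_def m(2) P unfolding m(1) R by simp
    qed
    have "N - c = \<Union> O'"
      using Union_orbs[OF \<psi> fin] orbs_disjoint[OF \<psi> fin _ cO] by (auto simp: O'_def)
    then have "(\<Sum>\<beta>\<in>N - c. Dfun \<alpha> \<epsilon> w (u \<circ> transpose \<alpha> \<beta>) (transpose \<alpha> \<beta> \<circ> \<psi>) / (\<zeta> \<alpha> - \<zeta> \<beta>)) =
        (\<Sum>d\<in>O'. \<Sum>\<beta>\<in>d. Dfun \<alpha> \<epsilon> w (u \<circ> transpose \<alpha> \<beta>) (transpose \<alpha> \<beta> \<circ> \<psi>) / (\<zeta> \<alpha> - \<zeta> \<beta>))"
      using O'N(3) orbs_disjoint[OF \<psi> fin]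
      by (simp add: sum.Union_disjoint O'_def)
    also have "\<dots> = (\<Sum>d\<in>O'. \<Sum>\<beta>\<in>d. G * R (\<zeta> \<alpha>) d * (\<Prod>e\<in>O' - {d}. V e) * h \<beta>)"
      by (intro sum.cong refl) (simp add: D h_def)
    also have "\<dots> = G * (\<Sum>d\<in>O'. R (\<zeta> \<alpha>) d * (\<Sum>\<gamma>\<in>d. h \<gamma>) * (\<Prod>e\<in>O' - {d}. V e))"
      unfolding sum_distrib_left
      by (intro sum.cong refl) (simp add: sum_distrib_left sum_distrib_right mult_ac)
    finally show ?thesis .
  qed
  \<comment> \<open>A \<beta> inside the cycle cuts off a tail \<open>B i\<close>. The values
    \<open>w (B i)\<close> recombine to \<open>w c\<close> by \<open>divdiff_orbit\<close>, and the
    remaining products give the derivative of \<open>R y (c - {\<alpha>})\<close>.\<close>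
  have split: "(\<Sum>\<beta>\<in>c - {\<alpha>}. Dfun \<alpha> \<epsilon> w (u \<circ> transpose \<alpha> \<beta>) (transpose \<alpha> \<beta> \<circ> \<psi>) / (\<zeta> \<alpha> - \<zeta> \<beta>)) =
      PV * ((\<Sum>i\<in>{1..k}. (\<Prod>j\<in>{1..i}. g j) * w (B i)) - \<epsilon> * G * (\<Sum>\<gamma>\<in>c - {\<alpha>}. h \<gamma>)
        + (if k = 0 then 0 else G * u \<alpha>))"
  proof -
    have D: "Dfun \<alpha> \<epsilon> w (u \<circ> transpose \<alpha> (x i)) (transpose \<alpha> (x i) \<circ> \<psi>) / (\<zeta> \<alpha> - \<zeta> (x i)) =
        PV * ((\<Prod>j\<in>{1..i}. g j) * w (B i) - \<epsilon> * G * h (x i) + (if i = k then G * u \<alpha> else 0))"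
      if i: "i \<in> {1..k}" for i
    proof -
      have i': "0 < i" "i < card (orbit \<psi> \<alpha>)"
        using i k by (auto simp: c_def)
      have xi: "(\<psi> ^^ i) \<alpha> = x i"
        by (simp add: x_def)
      note s = orbs_split[OF \<psi> fin \<alpha> i', folded c_def, unfolded k xi, folded x_def, folded O'_def]
      have Bi: "x ` {i..<Suc k} = B i"
        by (simp add: B_def)
      have xm: "x ` {..<i} - {\<alpha>} = x ` {1..<i}"
      proof -
        have "{..<i} = insert 0 {1..<i}"
          using i by auto
        moreover have "\<alpha> \<notin> x ` {1..<i}"
          using inj_onD[OF xinj, of 0] x0 i by force
        ultimately show ?thesis
          by (simp add: x0)
      qed
      have xsub: "inj_on x {1..<i}" "inj_on x {i..<Suc k}"
        by (rule inj_on_subset[OF xinj], use i in auto)+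
      have R1: "R (\<zeta> \<alpha>) (x ` {1..<i}) = (\<Prod>j\<in>{1..<i}. g j)"
        unfolding recip_prod_def g_def by (simp only: prod.reindex[OF xsub(1)] comp_def)
      have R2: "R (\<zeta> \<alpha>) (B i) = (\<Prod>j\<in>{i..<Suc k}. g j)"
        unfolding recip_prod_def B_def g_def by (simp only: prod.reindex[OF xsub(2)] comp_def)
      have G2: "(\<Prod>j\<in>{1..<i}. g j) * (\<Prod>j\<in>{i..<Suc k}. g j) = G"
        unfolding G atLeastLessThanSuc_atLeastAtMost[symmetric]
        by (rule prod.atLeastLessThan_concat) (use i in auto)
      have P1: "(\<Prod>j\<in>{1..i}. g j) = (\<Prod>j\<in>{1..<i}. g j) * g i"
        using i by (simp add: prod.last_plus mult.commute)
      \<comment> \<open>Only the last tail \<open>B k = {x k}\<close> is a fixed point; the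
        transposition in the argument of u moves it back to \<alpha>.\<close>
      have fB: "fixw (u \<circ> transpose \<alpha> (x i)) (B i) = (if i = k then u \<alpha> else 0)"
      proof (cases "i = k")
        case True
        then have "B i = {x i}"
          by (auto simp: B_def)
        with True show ?thesis by simp
      next
        case False
        have "card (B i) = Suc k - i"
          unfolding B_def using card_image[OF xsub(2)] by simp
        with False i show ?thesis
          by (simp add: fixw_def)
      qed
      have V: "w e - \<epsilon> * R (\<zeta> \<alpha>) e + fixw (u \<circ> transpose \<alpha> (x i)) e = V e" if e: "e \<in> O'" for e
      proof -
        have "x i \<in> c"
          using i unfolding orb by auto
        then have "x i \<notin> e"
          using orbs_disjoint[OF \<psi> fin, of e c] e cO by (auto simp: O'_def)
        then have "fixw (u \<circ> transpose \<alpha> (x i)) e = fixw u e"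
          using O'N(2)[of e] e transpose_apply_other[of _ \<alpha> "x i"]
          by (intro fixw_comp_eq) (metis comp_apply)
        then show ?thesis
          by (simp add: V_def)
      qed
      have Dx: "Dfun \<alpha> \<epsilon> w (u \<circ> transpose \<alpha> (x i)) (transpose \<alpha> (x i) \<circ> \<psi>) =
          (\<Prod>j\<in>{1..<i}. g j) * ((w (B i) - \<epsilon> * (\<Prod>j\<in>{i..<Suc k}. g j) + (if i = k then u \<alpha> else 0)) * PV)"
      proof -
        have P: "(\<Prod>e\<in>O'. w e - \<epsilon> * R (\<zeta> \<alpha>) e + fixw (u \<circ> transpose \<alpha> (x i)) e) = PV"
          unfolding PV_def by (rule prod.cong[OF refl V])
        have BO: "B i \<notin> O'"
          using s(3) unfolding Bi O'_def by simp
        show ?thesis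
          unfolding Dfun_def s(2) Bi prod.insert[OF finO' BO] P fB R2 unfolding s(1) xm R1 by simp
      qed
      have "Dfun \<alpha> \<epsilon> w (u \<circ> transpose \<alpha> (x i)) (transpose \<alpha> (x i) \<circ> \<psi>) / (\<zeta> \<alpha> - \<zeta> (x i)) =
          (\<Prod>j\<in>{1..<i}. g j) * ((w (B i) - \<epsilon> * (\<Prod>j\<in>{i..<Suc k}. g j) + (if i = k then u \<alpha> else 0)) * PV) * g i"
        unfolding Dx by (simp add: g_def)
      also have "\<dots> = PV * ((\<Prod>j\<in>{1..i}. g j) * w (B i) -
          \<epsilon> * ((\<Prod>j\<in>{1..<i}. g j) * (\<Prod>j\<in>{i..<Suc k}. g j)) * g i +
          (if i = k then (\<Prod>j\<in>{1..i}. g j) * u \<alpha> else 0))"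
        unfolding P1 by (simp add: algebra_simps)
      also have "\<dots> = PV * ((\<Prod>j\<in>{1..i}. g j) * w (B i) - \<epsilon> * G * h (x i) + (if i = k then G * u \<alpha> else 0))"
        unfolding G2 by (simp add: G h_def g_def)
      finally show ?thesis .
    qed
    have "(\<Sum>\<beta>\<in>c - {\<alpha>}. Dfun \<alpha> \<epsilon> w (u \<circ> transpose \<alpha> \<beta>) (transpose \<alpha> \<beta> \<circ> \<psi>) / (\<zeta> \<alpha> - \<zeta> \<beta>)) =
        (\<Sum>i\<in>{1..k}. PV * ((\<Prod>j\<in>{1..i}. g j) * w (B i) - \<epsilon> * G * h (x i) + (if i = k then G * u \<alpha> else 0)))"
      unfolding c_minus sum.reindex[OF xinj'] o_def[of _ x] by (intro sum.cong refl) (use D in \<open>simp add: comp_def\<close>)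
    also have "\<dots> = PV * ((\<Sum>i\<in>{1..k}. (\<Prod>j\<in>{1..i}. g j) * w (B i)) - \<epsilon> * G * (\<Sum>i\<in>{1..k}. h (x i))
        + (\<Sum>i\<in>{1..k}. if i = k then G * u \<alpha> else 0))"
      by (simp only: sum.distrib sum_subtractf sum_distrib_left[symmetric])
    also have "(\<Sum>i\<in>{1..k}. if i = k then G * u \<alpha> else 0) = (if k = 0 then 0 else G * u \<alpha>)"
      by (subst sum.delta) auto
    also have "(\<Sum>i\<in>{1..k}. h (x i)) = (\<Sum>\<gamma>\<in>c - {\<alpha>}. h \<gamma>)"
      unfolding c_minus by (simp only: sum.reindex[OF xinj'] comp_def)
    finally show ?thesis .
  qed
  have wc: "w c = G * w {\<alpha>} - (\<Sum>i\<in>{1..k}. (\<Prod>j\<in>{1..i}. g j) * w (B i))"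
    using divdiff_orbit[OF w \<psi> \<alpha>] unfolding c_def[symmetric] k_def[symmetric] G g_def B_def x_def .
  \<comment> \<open>The term \<open>u \<alpha>\<close> appears exactly once: from \<alpha> itself if
    it is fixed, otherwise from the fixed point cut off at i = k.\<close>
  have fc: "fixw u c + (if k = 0 then 0 else G * u \<alpha>) = G * u \<alpha>"
  proof (cases "k = 0")
    case True
    then have "c = {\<alpha>}"
      by (simp add: orb x0 lessThan_Suc)
    with True show ?thesis
      by (simp add: G)
  next
    case False
    then show ?thesis
      using k by (simp add: fixw_def)
  qed
  have tot: "(\<Sum>\<beta>\<in>N - {\<alpha>}. Dfun \<alpha> \<epsilon> w (u \<circ> transpose \<alpha> \<beta>) (transpose \<alpha> \<beta> \<circ> \<psi>) / (\<zeta> \<alpha> - \<zeta> \<beta>)) =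
      (\<Sum>\<beta>\<in>N - c. Dfun \<alpha> \<epsilon> w (u \<circ> transpose \<alpha> \<beta>) (transpose \<alpha> \<beta> \<circ> \<psi>) / (\<zeta> \<alpha> - \<zeta> \<beta>)) +
      (\<Sum>\<beta>\<in>c - {\<alpha>}. Dfun \<alpha> \<epsilon> w (u \<circ> transpose \<alpha> \<beta>) (transpose \<alpha> \<beta> \<circ> \<psi>) / (\<zeta> \<alpha> - \<zeta> \<beta>))"
  proof -
    have "N - {\<alpha>} = (N - c) \<union> (c - {\<alpha>})"
      using cN \<alpha>c by auto
    then show ?thesis
      using fin finc by (simp only:) (rule sum.union_disjoint; auto)
  qed
  have D: "Dfun \<alpha> \<epsilon> w u \<psi> = G * PV"
    by (simp add: Dfun_def G_def PV_def V_def c_def O'_def)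
  have fc': "fixw u c = G * u \<alpha> - (if k = 0 then 0 else G * u \<alpha>)"
    using fc by (simp add: eq_diff_eq)
  show ?thesis
    using dX unfolding e1 tot merge split D wc fc' \<epsilon>
    by (rule DERIV_cong) (simp add: algebra_simps)
qed

end

text \<open>On a large circle the integral is bounded by the length of the circle times a small
  multiple of its inverse radius. If the sum of residues had norm e > 0, a bound e / 2 for
  \<open>y * f y\<close> would contradict the residue theorem.\<close>

lemma sum_residues_eq_0:
  fixes f :: "complex \<Rightarrow> complex"
  assumes pts: "finite pts" and holo: "f holomorphic_on - pts"
    and lim: "((\<lambda>y. y * f y) \<longlongrightarrow> 0) at_infinity"
  shows "(\<Sum>p\<in>pts. residue f p) = 0"
proof (rule ccontr)
  define e where "e = norm (\<Sum>p\<in>pts. residue f p)"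
  assume "(\<Sum>p\<in>pts. residue f p) \<noteq> 0"
  then have e: "e > 0"
    by (simp add: e_def)
  have "eventually (\<lambda>y. norm (y * f y) < e / 2) at_infinity"
    using tendstoD[OF lim, of "e / 2"] e by simp
  then obtain b where b: "\<And>y. norm y \<ge> b \<Longrightarrow> norm (y * f y) < e / 2"
    unfolding eventually_at_infinity by blast
  obtain m where m: "\<And>p. p \<in> pts \<Longrightarrow> norm p \<le> m"
    using finite_imp_bounded[OF pts] unfolding bounded_iff by blast
  \<comment> \<open>Beyond the threshold b, outside all poles, and at least 1 so that the radius is
    positive also if \<open>pts\<close> is empty.\<close>
  define r where "r = max 1 (max b (m + 1))"
  have r: "r > 0" "r \<ge> b" "\<And>p. p \<in> pts \<Longrightarrow> norm p < r"
    using m by (auto simp: r_def max_def) (smt (verit))+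
  have path: "path_image (circlepath 0 r) \<subseteq> - pts"
    using r(1) by (auto simp: path_image_circlepath dest!: r(3))
  have int: "contour_integral (circlepath 0 r) f =
      2 * pi * \<i> * (\<Sum>p\<in>pts. winding_number (circlepath 0 r) p * residue f p)"
    by (rule Residue_theorem[where S = UNIV]) (use pts holo path in \<open>auto simp: Compl_eq_Diff_UNIV\<close>)
  also have "(\<Sum>p\<in>pts. winding_number (circlepath 0 r) p * residue f p) = (\<Sum>p\<in>pts. residue f p)"
    by (rule sum.cong[OF refl]) (simp add: winding_number_circlepath r)
  finally have "norm (contour_integral (circlepath 0 r) f) = 2 * pi * e"
    by (simp add: norm_mult e_def)
  moreover have "f contour_integrable_on circlepath 0 r"
    using holo path pts by (intro contour_integrable_holomorphic_simple[of _ "- pts"])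
      (auto simp: finite_imp_closed open_Compl)
  then have "(f has_contour_integral contour_integral (circlepath 0 r) f) (circlepath 0 r)"
    by (rule has_contour_integral_integral)
  then have "norm (contour_integral (circlepath 0 r) f) \<le> e / (2 * r) * (2 * pi * r)"
  proof (rule has_contour_integral_bound_circlepath)
    fix y :: complex assume "norm (y - 0) = r"
    then have "r * norm (f y) < e / 2"
      using b[of y] r by (simp add: norm_mult)
    then show "norm (f y) \<le> e / (2 * r)"
      using r(1) by (simp add: field_simps)
  qed (use e r in auto)
  ultimately show False
    using e r(1) by simp
qed

lemma inverse_diff_tendsto: "((\<lambda>y::complex. 1 / (y - z)) \<longlongrightarrow> 0) at_infinity"
proof -
  have "filterlim (\<lambda>y::complex. y + - z) at_infinity at_infinity"
    by (rule tendsto_add_filterlim_at_infinity'[OF filterlim_ident tendsto_const])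
  from filterlim_compose[OF tendsto_inverse_0 this] show ?thesis
    by (simp add: inverse_eq_divide)
qed

text \<open>The product in the crossed product, where \<open>\<sigma> u = (u \<circ> \<sigma>\<^sup>-\<^sup>1) \<sigma>\<close>.\<close>

definition cyc_conv :: "nat set \<Rightarrow> (nat set \<Rightarrow> complex) \<Rightarrow> (nat set \<Rightarrow> complex) \<Rightarrow>
    (nat \<Rightarrow> complex) \<Rightarrow> (nat \<Rightarrow> nat) \<Rightarrow> complex" where
  "cyc_conv N w v u \<tau> =
    (\<Sum>\<psi> | \<psi> permutes N. cyc_weight N w u \<psi> * cyc_weight N v (u \<circ> \<psi>) (inv \<psi> \<circ> \<tau>))"

section \<open>Products in the crossed product and the relation at distinct nodes\<close>

context distinct_nodes
begin

text \<open>A cycle with one point is a fixed point of \<open>\<psi>\<close>, where u and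
  \<open>u \<circ> \<psi>\<close> agree.\<close>

lemma fixw_perm:
  assumes "\<psi> permutes N" "d \<in> orbs \<psi> N"
  shows "fixw (u \<circ> \<psi>) d = fixw u d"
proof -
  have "\<psi> x = x" if "d = {x}" for x
  proof -
    have "orbit \<psi> x = {x}"
      using orbs_eq_orbit[OF assms(1) fin assms(2), of x] that by simp
    then show ?thesis
      by (simp add: orbit_eq_singleton_iff)
  qed
  then show ?thesis
    by (auto simp: fixw_def card_1_singleton_iff)
qed

lemma permutation_of_permutes: "\<psi> permutes N \<Longrightarrow> permutation \<psi>"
  using fin by (auto simp: permutation_permutes)

text \<open>A permutation and its inverse have the same cycles. This turns left multiplication by
  transpositions into right multiplication.\<close>

lemma Dfun_inv:
  assumes "\<psi> permutes N" "\<alpha> \<in> N"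
  shows "Dfun \<alpha> \<epsilon> w (u \<circ> \<psi>) (inv \<psi>) = Dfun \<alpha> \<epsilon> w u \<psi>"
  unfolding Dfun_def orbs_inv[OF assms(1) fin] orbit_inv_eq[OF permutation_of_permutes[OF assms(1)]]
  by (intro arg_cong2[where f = "(*)"] prod.cong refl) (simp add: fixw_perm[OF assms(1)])

lemma Xfun_inv:
  assumes "\<psi> permutes N" "\<alpha> \<in> N"
  shows "Xfun \<alpha> \<epsilon> w y (u \<circ> \<psi>) (inv \<psi>) = Xfun \<alpha> \<epsilon> w y u \<psi>"
  unfolding Xfun_def orbs_inv[OF assms(1) fin] orbit_inv_eq[OF permutation_of_permutes[OF assms(1)]]
  by (intro arg_cong2[where f = "(*)"] prod.cong refl)
    (simp_all add: fixw_perm[OF assms(1)] orbit_in_orbs[OF assms(2)])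

text \<open>The left version at \<open>inv \<psi>\<close> and \<open>u \<circ> \<psi>\<close>. Here
  u is evaluated at \<open>\<psi> \<alpha>\<close>, the same value that the left version yields for
  the second factor of a product.\<close>

lemma Xfun_deriv_right:
  assumes w: "divdiff w" and \<psi>: "\<psi> permutes N" and \<alpha>: "\<alpha> \<in> N" and \<epsilon>: "\<epsilon> * \<epsilon> = 1"
  shows "((\<lambda>y. Xfun \<alpha> \<epsilon> w y u \<psi>) has_field_derivative
    (w {\<alpha>} + u (\<psi> \<alpha>)) * Dfun \<alpha> \<epsilon> w u \<psi> -
    (\<Sum>\<beta>\<in>N - {\<alpha>}. Dfun \<alpha> \<epsilon> w u (\<psi> \<circ> transpose \<alpha> \<beta>) / (\<zeta> \<alpha> - \<zeta> \<beta>))) (at (\<zeta> \<alpha>))"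
proof -
  have D: "Dfun \<alpha> \<epsilon> w (u \<circ> \<psi> \<circ> transpose \<alpha> \<beta>) (transpose \<alpha> \<beta> \<circ> inv \<psi>) = Dfun \<alpha> \<epsilon> w u (\<psi> \<circ> transpose \<alpha> \<beta>)"
    if "\<beta> \<in> N" for \<beta>
  proof -
    have s: "transpose \<alpha> \<beta> permutes N"
      by (rule permutes_swap_id[OF \<alpha> that])
    then have "\<psi> \<circ> transpose \<alpha> \<beta> permutes N"
      by (rule permutes_compose[OF _ \<psi>])
    from Dfun_inv[OF this \<alpha>] show ?thesis
      using o_inv_distrib[OF permutes_bij[OF \<psi>] permutes_bij[OF s]] by (simp add: o_assoc)
  qed
  show ?thesis
    using Xfun_deriv[OF w permutes_inv[OF \<psi>] \<alpha> \<epsilon>, of "u \<circ> \<psi>"]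
    unfolding Xfun_inv[OF \<psi> \<alpha>] Dfun_inv[OF \<psi> \<alpha>]
    by (simp add: D)
qed

abbreviation conv :: "(nat set \<Rightarrow> complex) \<Rightarrow> (nat set \<Rightarrow> complex) \<Rightarrow> (nat \<Rightarrow> complex) \<Rightarrow> (nat \<Rightarrow> nat) \<Rightarrow> complex" where
  "conv \<equiv> cyc_conv N"

text \<open>The two terms with transpositions cancel because multiplication in the crossed product is
  associative.\<close>

lemma deriv_product:
  fixes u :: "nat \<Rightarrow> complex"
  assumes w: "divdiff w" and v: "divdiff v" and \<tau>: "\<tau> permutes N" and \<alpha>: "\<alpha> \<in> N"
  defines "S \<equiv> (\<lambda>y. \<Sum>\<psi> | \<psi> permutes N. Xfun \<alpha> 1 w y u \<psi> * Xfun \<alpha> (-1) v y (u \<circ> \<psi>) (inv \<psi> \<circ> \<tau>))"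
  shows "(S has_field_derivative - (w {\<alpha>} - v {\<alpha>}) * S (\<zeta> \<alpha>)) (at (\<zeta> \<alpha>))"
proof -
  define D where "D = Dfun \<alpha> 1 w u"
  define E where "E = (\<lambda>\<psi>. Dfun \<alpha> (-1) v (u \<circ> \<psi>) (inv \<psi> \<circ> \<tau>))"
  define P where "P = {\<psi>. \<psi> permutes N}"
  have finP: "finite P"
    unfolding P_def by (rule finite_permutations[OF fin])
  have perm: "inv \<psi> \<circ> \<tau> permutes N" if "\<psi> \<in> P" for \<psi>
    using that \<tau> by (auto simp: P_def intro: permutes_compose permutes_inv)
  have E: "Dfun \<alpha> (-1) v (u \<circ> \<psi> \<circ> transpose \<alpha> \<beta>) (transpose \<alpha> \<beta> \<circ> (inv \<psi> \<circ> \<tau>)) = E (\<psi> \<circ> transpose \<alpha> \<beta>)"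
    if "\<psi> \<in> P" "\<beta> \<in> N" for \<psi> \<beta>
    using o_inv_distrib[of \<psi> "transpose \<alpha> \<beta>"] that permutes_bij[of \<psi> N]
    unfolding E_def P_def by (simp add: o_assoc)
  let ?d1 = "\<lambda>\<psi>. (w {\<alpha>} + u (\<psi> \<alpha>)) * D \<psi> - (\<Sum>\<beta>\<in>N - {\<alpha>}. D (\<psi> \<circ> transpose \<alpha> \<beta>) / (\<zeta> \<alpha> - \<zeta> \<beta>))"
  let ?d2 = "\<lambda>\<psi>. (v {\<alpha>} + u (\<psi> \<alpha>)) * E \<psi> - (\<Sum>\<beta>\<in>N - {\<alpha>}. E (\<psi> \<circ> transpose \<alpha> \<beta>) / (\<zeta> \<alpha> - \<zeta> \<beta>))"
  \<comment> \<open>At the node the first factor is \<open>- D \<psi>\<close> and the second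
    \<open>E \<psi>\<close>, because \<epsilon> is 1 in one and -1 in the other. So the two halves
    of the product rule enter with opposite signs.\<close>
  have "(S has_field_derivative (\<Sum>\<psi>\<in>P. ?d1 \<psi> * E \<psi> + ?d2 \<psi> * (- D \<psi>))) (at (\<zeta> \<alpha>))"
    unfolding S_def P_def[symmetric]
  proof (rule DERIV_sum)
    fix \<psi> assume \<psi>: "\<psi> \<in> P"
    have 1: "((\<lambda>y. Xfun \<alpha> 1 w y u \<psi>) has_field_derivative ?d1 \<psi>) (at (\<zeta> \<alpha>))"
      unfolding D_def by (rule Xfun_deriv_right) (use w \<psi> \<alpha> in \<open>auto simp: P_def\<close>)
    have "((\<lambda>y. Xfun \<alpha> (-1) v y (u \<circ> \<psi>) (inv \<psi> \<circ> \<tau>)) has_field_derivative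
        (v {\<alpha>} + (u \<circ> \<psi>) \<alpha>) * Dfun \<alpha> (-1) v (u \<circ> \<psi>) (inv \<psi> \<circ> \<tau>) -
        (\<Sum>\<beta>\<in>N - {\<alpha>}. Dfun \<alpha> (-1) v (u \<circ> \<psi> \<circ> transpose \<alpha> \<beta>) (transpose \<alpha> \<beta> \<circ> (inv \<psi> \<circ> \<tau>)) / (\<zeta> \<alpha> - \<zeta> \<beta>)))
        (at (\<zeta> \<alpha>))"
      by (rule Xfun_deriv) (use v \<psi> \<alpha> perm in auto)
    then have 2: "((\<lambda>y. Xfun \<alpha> (-1) v y (u \<circ> \<psi>) (inv \<psi> \<circ> \<tau>)) has_field_derivative ?d2 \<psi>) (at (\<zeta> \<alpha>))"
      using E[OF \<psi>] by (simp add: E_def)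
    show "((\<lambda>y. Xfun \<alpha> 1 w y u \<psi> * Xfun \<alpha> (-1) v y (u \<circ> \<psi>) (inv \<psi> \<circ> \<tau>)) has_field_derivative
        ?d1 \<psi> * E \<psi> + ?d2 \<psi> * (- D \<psi>)) (at (\<zeta> \<alpha>))"
      using DERIV_mult[OF 1 2] by (simp add: Xfun_node D_def E_def)
  qed
  \<comment> \<open>The terms with \<open>u (\<psi> \<alpha>)\<close> cancel; the constants and the
    transpositions remain.\<close>
  also have "(\<Sum>\<psi>\<in>P. ?d1 \<psi> * E \<psi> + ?d2 \<psi> * (- D \<psi>)) =
      (w {\<alpha>} - v {\<alpha>}) * (\<Sum>\<psi>\<in>P. D \<psi> * E \<psi>) -
      (\<Sum>\<psi>\<in>P. \<Sum>\<beta>\<in>N - {\<alpha>}. D (\<psi> \<circ> transpose \<alpha> \<beta>) * E \<psi> / (\<zeta> \<alpha> - \<zeta> \<beta>)) +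
      (\<Sum>\<psi>\<in>P. \<Sum>\<beta>\<in>N - {\<alpha>}. D \<psi> * E (\<psi> \<circ> transpose \<alpha> \<beta>) / (\<zeta> \<alpha> - \<zeta> \<beta>))"
    unfolding sum_distrib_left sum.distrib[symmetric] sum_subtractf[symmetric]
    by (intro sum.cong refl) (simp add: algebra_simps sum_distrib_left sum_distrib_right sum_negf)
  \<comment> \<open>Replacing \<open>\<psi>\<close> by
    \<open>\<psi> \<circ> transpose \<alpha> \<beta>\<close> moves the transposition from the second
    factor to the first.\<close>
  also have "(\<Sum>\<psi>\<in>P. \<Sum>\<beta>\<in>N - {\<alpha>}. D \<psi> * E (\<psi> \<circ> transpose \<alpha> \<beta>) / (\<zeta> \<alpha> - \<zeta> \<beta>)) =
      (\<Sum>\<psi>\<in>P. \<Sum>\<beta>\<in>N - {\<alpha>}. D (\<psi> \<circ> transpose \<alpha> \<beta>) * E \<psi> / (\<zeta> \<alpha> - \<zeta> \<beta>))"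
    unfolding sum.swap[of _ _ P]
  proof (rule sum.cong[OF refl])
    fix \<beta> assume "\<beta> \<in> N - {\<alpha>}"
    then have s: "transpose \<alpha> \<beta> permutes N"
      by (intro permutes_swap_id \<alpha>) auto
    have inv: "\<psi> \<circ> transpose \<alpha> \<beta> \<circ> transpose \<alpha> \<beta> = \<psi>" for \<psi> :: "nat \<Rightarrow> nat"
      by (simp add: fun_eq_iff)
    show "(\<Sum>\<psi>\<in>P. D \<psi> * E (\<psi> \<circ> transpose \<alpha> \<beta>) / (\<zeta> \<alpha> - \<zeta> \<beta>)) =
        (\<Sum>\<psi>\<in>P. D (\<psi> \<circ> transpose \<alpha> \<beta>) * E \<psi> / (\<zeta> \<alpha> - \<zeta> \<beta>))"
      by (rule sum.reindex_bij_witness[where i = "\<lambda>\<psi>. \<psi> \<circ> transpose \<alpha> \<beta>" and j = "\<lambda>\<psi>. \<psi> \<circ> transpose \<alpha> \<beta>"])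
        (unfold inv, auto simp only: P_def mem_Collect_eq intro: permutes_compose[OF s])
  qed
  also have "(\<Sum>\<psi>\<in>P. D \<psi> * E \<psi>) = - S (\<zeta> \<alpha>)"
    by (simp add: S_def Xfun_node D_def E_def P_def sum_negf)
  finally show ?thesis
    by (simp add: algebra_simps)
qed

lemma R_holomorphic: "c \<subseteq> N \<Longrightarrow> (\<lambda>y. R y c) holomorphic_on (- \<zeta> ` N)"
  unfolding recip_prod_def by (intro holomorphic_intros) auto

lemma R_holomorphic_node:
  assumes "c \<subseteq> N" "\<alpha> \<in> N" "\<alpha> \<notin> c"
  shows "(\<lambda>y. R y c) holomorphic_on (- \<zeta> ` (N - {\<alpha>}))"
  unfolding recip_prod_def using assms by (intro holomorphic_intros) auto

lemma R_tendsto: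
  assumes "finite c" "c \<noteq> {}"
  shows "((\<lambda>y. R y c) \<longlongrightarrow> 0) at_infinity"
proof -
  have "((\<lambda>y. \<Prod>\<gamma>\<in>c. 1 / (y - \<zeta> \<gamma>)) \<longlongrightarrow> (\<Prod>\<gamma>\<in>c. 0)) at_infinity"
    by (intro tendsto_prod inverse_diff_tendsto)
  then show ?thesis
    using assms card_gt_0_iff[of c] by (simp add: recip_prod_def zero_power)
qed

text \<open>Give the two factors the weights \<open>w - R y\<close> and
  \<open>w - R a - R b - R c + R y\<close>. At y = a, b, c this is one of the three products of the
  relation, and the simple poles of \<open>e\<close> there supply the coefficients. The poles at the
  nodes are at most double with residue 0, and the decay at infinity makes the sum of all residues
  vanish.\<close>

lemma three_term:
  assumes w: "divdiff w" and \<tau>: "\<tau> permutes N"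
    and ab: "a \<noteq> b" and bc: "b \<noteq> c" and ca: "c \<noteq> a"
    and nodes: "a \<notin> \<zeta> ` N" "b \<notin> \<zeta> ` N" "c \<notin> \<zeta> ` N"
  shows "(b - c) * conv (\<lambda>d. w d - R a d) (\<lambda>d. w d - R b d - R c d) u \<tau> +
    (c - a) * conv (\<lambda>d. w d - R b d) (\<lambda>d. w d - R c d - R a d) u \<tau> +
    (a - b) * conv (\<lambda>d. w d - R c d) (\<lambda>d. w d - R a d - R b d) u \<tau> = 0"
proof -
  define v where "v = (\<lambda>d. w d - R a d - R b d - R c d)"
  have v: "divdiff v"
    unfolding v_def by (intro divdiff_diff divdiff_R w nodes)
  define \<Phi> where "\<Phi> = (\<lambda>y. conv (\<lambda>d. w d - 1 * R y d) (\<lambda>d. v d - (-1) * R y d) u \<tau>)"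
  define e where "e = (\<lambda>y. 1 / ((y - a) * (y - b) * (y - c)))"
  define f where "f = (\<lambda>y. e y * \<Phi> y)"
  have perm: "inv \<psi> \<circ> \<tau> permutes N" if "\<psi> permutes N" for \<psi>
    using that \<tau> by (auto intro: permutes_compose permutes_inv)
  have \<Phi>_holo: "\<Phi> holomorphic_on (- \<zeta> ` N)"
    unfolding \<Phi>_def cyc_conv_def cyc_weight_def
    by (intro holomorphic_intros R_holomorphic) (auto dest: orbs_subset orbs_subset[OF perm])
  have e_holo: "e holomorphic_on (- {a, b, c})"
    unfolding e_def by (intro holomorphic_intros) auto
  have f_holo: "f holomorphic_on (- (\<zeta> ` N \<union> {a, b, c}))"
    unfolding f_def using \<Phi>_holo e_holo by (intro holomorphic_on_mult) (auto intro: holomorphic_on_subset)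
  have cw_lim: "((\<lambda>y. cyc_weight N (\<lambda>d. x d - \<epsilon> * R y d) u' \<psi>) \<longlongrightarrow> cyc_weight N x u' \<psi>) at_infinity"
    if "\<psi> permutes N" for x \<epsilon> u' \<psi>
    unfolding cyc_weight_def
  proof (rule tendsto_prod)
    fix d assume "d \<in> orbs \<psi> N"
    then have "((\<lambda>y. R y d) \<longlongrightarrow> 0) at_infinity"
      using R_tendsto[of d] finite_in_orbs[OF that fin] orbs_nonempty by auto
    then have "((\<lambda>y. x d - \<epsilon> * R y d + fixw u' d) \<longlongrightarrow> x d - \<epsilon> * 0 + fixw u' d) at_infinity"
      by (intro tendsto_intros)
    then show "((\<lambda>y. x d - \<epsilon> * R y d + fixw u' d) \<longlongrightarrow> x d + fixw u' d) at_infinity"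
      by simp
  qed
  have \<Phi>_lim: "(\<Phi> \<longlongrightarrow> conv w v u \<tau>) at_infinity"
    unfolding \<Phi>_def cyc_conv_def by (intro tendsto_sum tendsto_mult cw_lim) (auto intro: perm)
  \<comment> \<open>Since \<open>y / (y - a) = 1 + a / (y - a)\<close>, this is
    \<open>y * e y\<close> written with factors whose limits are known.\<close>
  have "((\<lambda>y. (1 + a * (1 / (y - a))) * (1 / (y - b)) * (1 / (y - c))) \<longlongrightarrow> (1 + a * 0) * 0 * 0) at_infinity"
    by (intro tendsto_intros inverse_diff_tendsto)
  moreover have "eventually (\<lambda>y. (1 + a * (1 / (y - a))) * (1 / (y - b)) * (1 / (y - c)) = y * e y) at_infinity"
    unfolding eventually_at_infinity
  proof (intro exI allI impI)
    fix y :: complex assume "norm a + 1 \<le> norm y"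
    then have "y - a \<noteq> 0"
      by auto
    then show "(1 + a * (1 / (y - a))) * (1 / (y - b)) * (1 / (y - c)) = y * e y"
      by (simp add: e_def field_simps)
  qed
  ultimately have "((\<lambda>y. y * e y) \<longlongrightarrow> 0) at_infinity"
    using Lim_transform_eventually by fastforce
  from tendsto_mult[OF this \<Phi>_lim] have f_lim: "((\<lambda>y. y * f y) \<longlongrightarrow> 0) at_infinity"
    by (simp add: f_def mult.assoc)
  have res0: "(\<Sum>p\<in>\<zeta> ` N \<union> {a, b, c}. residue f p) = 0"
    by (rule sum_residues_eq_0[OF _ f_holo f_lim]) (simp add: fin)
  have res_node: "residue f (\<zeta> \<alpha>) = 0" if \<alpha>: "\<alpha> \<in> N" for \<alpha>
  proof -
    define S where "S = (\<lambda>y. \<Sum>\<psi> | \<psi> permutes N. Xfun \<alpha> 1 w y u \<psi> * Xfun \<alpha> (-1) v y (u \<circ> \<psi>) (inv \<psi> \<circ> \<tau>))"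
    define A where "A = - (\<zeta> ` (N - {\<alpha>}) \<union> {a, b, c})"
    have A: "open A" "\<zeta> \<alpha> \<in> A"
      using nodes \<alpha> node_eq_iff[OF \<alpha>] fin
      by (auto simp: A_def intro!: open_Compl finite_imp_closed)
    have X_holo: "(\<lambda>y. Xfun \<alpha> \<epsilon> x y u' \<psi>) holomorphic_on A" if "\<psi> permutes N" for \<epsilon> x u' \<psi>
    proof -
      have "(\<lambda>y. Xfun \<alpha> \<epsilon> x y u' \<psi>) holomorphic_on (- \<zeta> ` (N - {\<alpha>}))"
        unfolding Xfun_def
      proof (intro holomorphic_intros R_holomorphic_node \<alpha>)
        show "orbit \<psi> \<alpha> - {\<alpha>} \<subseteq> N"
          using permutes_orbit_subset[OF that \<alpha>] by auto
        fix d assume d: "d \<in> orbs \<psi> N - {orbit \<psi> \<alpha>}"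
        then show "d \<subseteq> N" "\<alpha> \<notin> d"
          using orbs_subset[OF that] orbs_eq_orbit[OF that fin] by auto
      qed auto
      then show ?thesis
        by (rule holomorphic_on_subset) (auto simp: A_def)
    qed
    have S_holo: "S holomorphic_on A"
      unfolding S_def by (intro holomorphic_intros X_holo) (auto intro: perm)
    have e_holo': "e holomorphic_on A"
      by (rule holomorphic_on_subset[OF e_holo]) (auto simp: A_def)
    \<comment> \<open>At most a double pole, so the residue is the first derivative of
      \<open>e y * S y\<close> at the node.\<close>
    have eq: "f y = e y * S y / (y - \<zeta> \<alpha>) ^ Suc 1" if "y \<noteq> \<zeta> \<alpha>" for y
    proof -
      have "\<Phi> y = S y / (y - \<zeta> \<alpha>) ^ Suc 1"
        unfolding \<Phi>_def cyc_conv_def S_def sum_divide_distrib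
      proof (rule sum.cong[OF refl])
        fix \<psi> assume "\<psi> \<in> {\<psi>. \<psi> permutes N}"
        then have \<psi>: "\<psi> permutes N"
          by simp
        show "cyc_weight N (\<lambda>d. w d - 1 * R y d) u \<psi> * cyc_weight N (\<lambda>d. v d - (-1) * R y d) (u \<circ> \<psi>) (inv \<psi> \<circ> \<tau>) =
            Xfun \<alpha> 1 w y u \<psi> * Xfun \<alpha> (-1) v y (u \<circ> \<psi>) (inv \<psi> \<circ> \<tau>) / (y - \<zeta> \<alpha>) ^ Suc 1"
          unfolding cyc_weight_Xfun[OF \<psi> \<alpha> that] cyc_weight_Xfun[OF perm[OF \<psi>] \<alpha> that] by simp
      qed
      then show ?thesis
        by (simp add: f_def)
    qed
    have "residue f (\<zeta> \<alpha>) = residue (\<lambda>y. e y * S y / (y - \<zeta> \<alpha>) ^ Suc 1) (\<zeta> \<alpha>)"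
      by (rule residue_cong) (auto simp: eq eventually_at_filter)
    also have "\<dots> = (deriv ^^ 1) (\<lambda>y. e y * S y) (\<zeta> \<alpha>) / fact 1"
      by (rule residue_holomorphic_over_power[OF A]) (intro holomorphic_intros e_holo' S_holo)
    also have "\<dots> = deriv (\<lambda>y. e y * S y) (\<zeta> \<alpha>)"
      by simp
    also have "\<dots> = 0"
    proof (rule DERIV_imp_deriv)
      have ne: "\<zeta> \<alpha> - a \<noteq> 0" "\<zeta> \<alpha> - b \<noteq> 0" "\<zeta> \<alpha> - c \<noteq> 0"
        using nodes \<alpha> by auto
      then have ne': "a - \<zeta> \<alpha> \<noteq> 0" "b - \<zeta> \<alpha> \<noteq> 0" "c - \<zeta> \<alpha> \<noteq> 0"
        by auto
      \<comment> \<open>This dictates the choice of \<open>e\<close>: its derivative at the node is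
        its value times \<open>w {\<alpha>} - v {\<alpha>}\<close>, and for S the factor is the
        opposite.\<close>
      have wv: "w {\<alpha>} - v {\<alpha>} = 1 / (a - \<zeta> \<alpha>) + 1 / (b - \<zeta> \<alpha>) + 1 / (c - \<zeta> \<alpha>)"
        by (simp add: v_def recip_prod_def)
      have "(e has_field_derivative e (\<zeta> \<alpha>) * (w {\<alpha>} - v {\<alpha>})) (at (\<zeta> \<alpha>))"
        unfolding e_def wv using ne ne'
        by (auto intro!: derivative_eq_intros) (simp add: divide_simps, simp add: algebra_simps)
      moreover have "(S has_field_derivative - (w {\<alpha>} - v {\<alpha>}) * S (\<zeta> \<alpha>)) (at (\<zeta> \<alpha>))"
        unfolding S_def by (rule deriv_product[OF w v \<tau> \<alpha>])
      ultimately
      have "((\<lambda>y. e y * S y) has_field_derivative e (\<zeta> \<alpha>) * (w {\<alpha>} - v {\<alpha>}) * S (\<zeta> \<alpha>) +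
          - (w {\<alpha>} - v {\<alpha>}) * S (\<zeta> \<alpha>) * e (\<zeta> \<alpha>)) (at (\<zeta> \<alpha>))"
        by (rule DERIV_mult)
      then show "((\<lambda>y. e y * S y) has_field_derivative 0) (at (\<zeta> \<alpha>))"
        by (rule DERIV_cong) (simp add: algebra_simps)
    qed
    finally show ?thesis .
  qed
  have res_pt: "residue f p = \<Phi> p / ((p - q) * (p - r))"
    if "p \<notin> \<zeta> ` N" "p \<noteq> q" "p \<noteq> r" "{p, q, r} = {a, b, c}" "\<And>y. e y = 1 / ((y - p) * (y - q) * (y - r))" for p q r
  proof -
    have eq: "f = (\<lambda>y. (\<Phi> y / ((y - q) * (y - r))) / (y - p))"
      by (auto simp: f_def that(5) fun_eq_iff)
    have A: "open (- (\<zeta> ` N \<union> {q, r}))"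
      using fin by (intro open_Compl finite_imp_closed) auto
    show ?thesis
      unfolding eq
      by (rule residue_simple[OF A], use that in simp)
        (intro holomorphic_intros holomorphic_on_subset[OF \<Phi>_holo], auto)
  qed
  have "residue f a = \<Phi> a / ((a - b) * (a - c))"
    by (rule res_pt) (use ab bc ca nodes in \<open>auto simp: e_def mult_ac\<close>)
  moreover have "residue f b = \<Phi> b / ((b - c) * (b - a))"
    by (rule res_pt) (use ab bc ca nodes in \<open>auto simp: e_def mult_ac\<close>)
  moreover have "residue f c = \<Phi> c / ((c - a) * (c - b))"
    by (rule res_pt) (use ab bc ca nodes in \<open>auto simp: e_def mult_ac\<close>)
  moreover have "(\<Sum>p\<in>\<zeta> ` N \<union> {a, b, c}. residue f p) = residue f a + residue f b + residue f c"
  proof -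
    have "(\<Sum>p\<in>\<zeta> ` N \<union> {a, b, c}. residue f p) = (\<Sum>p\<in>{a, b, c}. residue f p)"
      by (rule sum.mono_neutral_right) (use fin res_node in auto)
    then show ?thesis
      using ab bc ca by simp
  qed
  ultimately have "\<Phi> a / ((a - b) * (a - c)) + \<Phi> b / ((b - c) * (b - a)) + \<Phi> c / ((c - a) * (c - b)) = 0"
    using res0 by simp
  then have "(b - c) * \<Phi> a + (c - a) * \<Phi> b + (a - b) * \<Phi> c = 0"
  proof -
    have *: "q * x + r * y + p * z = 0"
      if "x / (p * - r) + y / (q * - p) + z / (r * - q) = 0" "p \<noteq> 0" "q \<noteq> 0" "r \<noteq> 0"
      for p q r x y z :: complex
    proof -
      have eq: "x / (p * - r) + y / (q * - p) + z / (r * - q) = - (q * x + r * y + p * z) / (p * q * r)"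
        using that(2-4) by (simp add: field_simps)
      from that(1)[unfolded eq] that(2-4) show ?thesis
        by (simp only: divide_eq_0_iff neg_equal_0_iff_equal mult_eq_0_iff simp_thms)
    qed
    assume "\<Phi> a / ((a - b) * (a - c)) + \<Phi> b / ((b - c) * (b - a)) + \<Phi> c / ((c - a) * (c - b)) = 0"
    then show ?thesis
      using *[of "\<Phi> a" "a - b" "c - a" "\<Phi> b" "b - c" "\<Phi> c"] ab bc ca by simp
  qed
  moreover have "\<Phi> a = conv (\<lambda>d. w d - R a d) (\<lambda>d. w d - R b d - R c d) u \<tau>"
    "\<Phi> b = conv (\<lambda>d. w d - R b d) (\<lambda>d. w d - R c d - R a d) u \<tau>"
    "\<Phi> c = conv (\<lambda>d. w d - R c d) (\<lambda>d. w d - R a d - R b d) u \<tau>"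
    unfolding \<Phi>_def v_def by (simp_all add: algebra_simps)
  ultimately show ?thesis
    by simp
qed

end

section \<open>The three-term relation in the group algebra\<close>

text \<open>The power sums of the negative of the alphabet \<open>L\<close>.\<close>

definition psum :: "complex list \<Rightarrow> nat \<Rightarrow> complex" where
  "psum L k = - (\<Sum>s\<leftarrow>L. s ^ k)"

definition tau :: "nat \<Rightarrow> (nat \<Rightarrow> complex) \<Rightarrow> (nat \<Rightarrow> complex) \<Rightarrow> complex \<Rightarrow> (nat \<Rightarrow> nat) \<Rightarrow> complex" where
  "tau n z p t \<sigma> =
    (if \<sigma> permutes {1..n} then cyc_weight {1..n} (\<lambda>c. p (card c)) (\<lambda>i. z i + t) \<sigma> else 0)"

text \<open>For weights that depend only on the length of a cycle, a permutation of u can be traded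
  for a conjugation. Thus the crossed product becomes the product of the group algebra.\<close>

lemma cyc_weight_conj:
  assumes "\<psi> permutes N" "\<sigma> permutes N" "finite N"
  shows "cyc_weight N (\<lambda>c. p (card c)) (u \<circ> \<psi>) \<sigma> = cyc_weight N (\<lambda>c. p (card c)) u (\<psi> \<circ> \<sigma> \<circ> inv \<psi>)"
proof -
  have inj: "inj \<psi>" "inj ((`) \<psi>)" and bij: "bij \<psi>"
    using permutes_inj[OF assms(1)] permutes_bij[OF assms(1)] by (auto simp: inj_def inj_image_eq_iff)
  have "cyc_weight N (\<lambda>c. p (card c)) u (\<psi> \<circ> \<sigma> \<circ> inv \<psi>) =
      (\<Prod>c\<in>(`) \<psi> ` orbs \<sigma> N. p (card c) + fixw u c)"
    unfolding cyc_weight_def using orbs_conj[OF bij assms(2,3)] permutes_image[OF assms(1)] by simp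
  also have "\<dots> = (\<Prod>c\<in>orbs \<sigma> N. p (card (\<psi> ` c)) + fixw u (\<psi> ` c))"
    by (subst prod.reindex) (use inj in \<open>auto intro: inj_on_subset\<close>)
  also have "\<dots> = (\<Prod>c\<in>orbs \<sigma> N. p (card c) + fixw (u \<circ> \<psi>) c)"
  proof (rule prod.cong[OF refl])
    fix c
    have card: "card (\<psi> ` c) = card c"
      using inj(1) by (auto intro: card_image inj_on_subset)
    have "fixw u (\<psi> ` c) = fixw (u \<circ> \<psi>) c"
      unfolding fixw_def card by (auto simp: card_1_singleton_iff)
    with card show "p (card (\<psi> ` c)) + fixw u (\<psi> ` c) = p (card c) + fixw (u \<circ> \<psi>) c"
      by simp
  qed
  finally show ?thesis
    by (simp add: cyc_weight_def)
qed

text \<open>The order of the factors is reversed: conjugation by \<open>\<psi>\<close> turns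
  \<open>inv \<psi> \<circ> \<tau>\<close> into \<open>\<tau> \<circ> inv \<psi>\<close>, which
  stands to the left of \<open>\<psi>\<close>.\<close>

lemma conv_eq_CS_mult:
  assumes "\<tau> permutes {1..n}"
  shows "cyc_conv {1..n} (\<lambda>c. p (card c)) (\<lambda>c. r (card c)) (\<lambda>i. z i + t) \<tau> =
    (tau n z r t \<otimes>\<^bsub>CS n\<^esub> tau n z p t) \<tau>"
proof -
  let ?N = "{1..n}" and ?u = "\<lambda>i. z i + t"
  have "(tau n z r t \<otimes>\<^bsub>CS n\<^esub> tau n z p t) \<tau> =
      (\<Sum>\<psi> | \<psi> permutes ?N. \<Sum>\<sigma> | \<sigma> permutes ?N. if \<tau> = \<sigma> \<circ> \<psi> then tau n z r t \<sigma> * tau n z p t \<psi> else 0)"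
    unfolding CS_mult_apply by (rule sum.swap)
  also have "\<dots> = (\<Sum>\<psi> | \<psi> permutes ?N. tau n z r t (\<tau> \<circ> inv \<psi>) * tau n z p t \<psi>)"
  proof (rule sum.cong[OF refl])
    fix \<psi> assume "\<psi> \<in> {\<psi>. \<psi> permutes ?N}"
    then have \<psi>: "\<psi> permutes ?N" by simp
    have eq: "\<tau> = \<sigma> \<circ> \<psi> \<longleftrightarrow> \<sigma> = \<tau> \<circ> inv \<psi>" for \<sigma>
      using permutes_inv_o[OF \<psi>] by (auto simp: o_assoc[symmetric])
    show "(\<Sum>\<sigma> | \<sigma> permutes ?N. if \<tau> = \<sigma> \<circ> \<psi> then tau n z r t \<sigma> * tau n z p t \<psi> else 0) =
        tau n z r t (\<tau> \<circ> inv \<psi>) * tau n z p t \<psi>"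
      unfolding eq
      using permutes_compose[OF permutes_inv[OF \<psi>] assms] finite_permutations[of ?N]
      by (subst sum.delta) auto
  qed
  also have "\<dots> = (\<Sum>\<psi> | \<psi> permutes ?N. cyc_weight ?N (\<lambda>c. p (card c)) ?u \<psi> *
      cyc_weight ?N (\<lambda>c. r (card c)) (?u \<circ> \<psi>) (inv \<psi> \<circ> \<tau>))"
  proof (rule sum.cong[OF refl])
    fix \<psi> assume "\<psi> \<in> {\<psi>. \<psi> permutes ?N}"
    then have \<psi>: "\<psi> permutes ?N" by simp
    have p1: "inv \<psi> \<circ> \<tau> permutes ?N" "\<tau> \<circ> inv \<psi> permutes ?N"
      by (intro permutes_compose permutes_inv \<psi> assms)+
    have "\<psi> \<circ> (inv \<psi> \<circ> \<tau>) \<circ> inv \<psi> = \<tau> \<circ> inv \<psi>"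
      using permutes_inv_o[OF \<psi>] by (simp add: o_assoc)
    then show "tau n z r t (\<tau> \<circ> inv \<psi>) * tau n z p t \<psi> = cyc_weight ?N (\<lambda>c. p (card c)) ?u \<psi> *
        cyc_weight ?N (\<lambda>c. r (card c)) (?u \<circ> \<psi>) (inv \<psi> \<circ> \<tau>)"
      using cyc_weight_conj[OF \<psi> p1(1), of r ?u] \<psi> p1 by (simp add: tau_def)
  qed
  finally show ?thesis
    by (simp add: cyc_conv_def)
qed

lemma cyc_weight_tendsto:
  assumes "finite N" "\<sigma> permutes N" "\<And>d. d \<in> orbs \<sigma> N \<Longrightarrow> ((\<lambda>h. w h d) \<longlongrightarrow> w' d) F"
  shows "((\<lambda>h. cyc_weight N (w h) u \<sigma>) \<longlongrightarrow> cyc_weight N w' u \<sigma>) F"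
  unfolding cyc_weight_def by (intro tendsto_intros assms(3))

lemma cyc_conv_tendsto:
  assumes "finite N" "\<tau> permutes N"
    and "\<And>d. d \<subseteq> N \<Longrightarrow> ((\<lambda>h. w h d) \<longlongrightarrow> w' d) F"
    and "\<And>d. d \<subseteq> N \<Longrightarrow> ((\<lambda>h. v h d) \<longlongrightarrow> v' d) F"
  shows "((\<lambda>h. cyc_conv N (w h) (v h) u \<tau>) \<longlongrightarrow> cyc_conv N w' v' u \<tau>) F"
  unfolding cyc_conv_def
proof (intro tendsto_sum tendsto_mult cyc_weight_tendsto assms(1,3,4))
  fix \<psi> assume "\<psi> \<in> {\<psi>. \<psi> permutes N}"
  then have *: "\<psi> permutes N" "inv \<psi> \<circ> \<tau> permutes N"
    using assms(2) by (auto intro: permutes_compose permutes_inv)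
  then show "\<psi> permutes N" "inv \<psi> \<circ> \<tau> permutes N" .
  show "d \<subseteq> N" if "d \<in> orbs \<psi> N" for d
    by (rule orbs_subset[OF *(1) that])
  show "d \<subseteq> N" if "d \<in> orbs (inv \<psi> \<circ> \<tau>) N" for d
    by (rule orbs_subset[OF *(2) that])
qed

lemma recip_prod_tendsto:
  assumes "finite d" "x \<noteq> 0"
  shows "((\<lambda>h. recip_prod (\<lambda>i. h * of_nat i) x d) \<longlongrightarrow> (1 / x) ^ card d) (at 0)"
proof -
  have "((\<lambda>h. \<Prod>i\<in>d. 1 / (x - h * of_nat i)) \<longlongrightarrow> (\<Prod>i\<in>d. 1 / (x - 0 * of_nat i))) (at 0)"
    using assms(2) by (intro tendsto_intros) auto
  then show ?thesis
    by (simp add: recip_prod_def)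
qed

text \<open>Letting the nodes \<open>h i\<close> collide at \<open>0\<close> turns the weight of a cycle into a power sum of degree
  the length of the cycle.\<close>

lemma three_term_collide:
  fixes a b c :: complex
  assumes \<tau>: "\<tau> permutes {1..n}"
    and ab: "a \<noteq> b" "b \<noteq> c" "c \<noteq> a" and nz: "a \<noteq> 0" "b \<noteq> 0" "c \<noteq> 0" "0 \<notin> set L"
  defines "W \<equiv> (\<lambda>M d. psum (map (\<lambda>x. 1 / x) M) (card d))"
  shows "(b - c) * cyc_conv {1..n} (W (a # L)) (W (b # c # L)) u \<tau> +
    (c - a) * cyc_conv {1..n} (W (b # L)) (W (c # a # L)) u \<tau> +
    (a - b) * cyc_conv {1..n} (W (c # L)) (W (a # b # L)) u \<tau> = 0"
proof -
  let ?N = "{1..n}"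
  define \<zeta> where "\<zeta> = (\<lambda>(h::complex) i::nat. h * of_nat i)"
  define w where "w = (\<lambda>h d. - (\<Sum>x\<leftarrow>L. recip_prod (\<zeta> h) x d))"
  define E where "E = (\<lambda>h. (b - c) * cyc_conv ?N (\<lambda>d. w h d - recip_prod (\<zeta> h) a d) (\<lambda>d. w h d - recip_prod (\<zeta> h) b d - recip_prod (\<zeta> h) c d) u \<tau> +
    (c - a) * cyc_conv ?N (\<lambda>d. w h d - recip_prod (\<zeta> h) b d) (\<lambda>d. w h d - recip_prod (\<zeta> h) c d - recip_prod (\<zeta> h) a d) u \<tau> +
    (a - b) * cyc_conv ?N (\<lambda>d. w h d - recip_prod (\<zeta> h) c d) (\<lambda>d. w h d - recip_prod (\<zeta> h) a d - recip_prod (\<zeta> h) b d) u \<tau>)"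
  \<comment> \<open>The nodes tend to 0 and the letters are nonzero, so a letter is not a node once
    h is small.\<close>
  have avoid: "eventually (\<lambda>h. x \<notin> \<zeta> h ` ?N) (at 0)" if "x \<noteq> 0" for x
  proof -
    have "eventually (\<lambda>h. \<forall>i\<in>?N. \<zeta> h i \<noteq> x) (at 0)"
    proof (rule eventually_ball_finite)
      show "\<forall>i\<in>?N. eventually (\<lambda>h. \<zeta> h i \<noteq> x) (at 0)"
      proof
        fix i
        have "((\<lambda>h. \<zeta> h i) \<longlongrightarrow> 0 * of_nat i) (at 0)"
          unfolding \<zeta>_def by (intro tendsto_intros)
        then show "eventually (\<lambda>h. \<zeta> h i \<noteq> x) (at 0)"
          using that by (intro tendsto_imp_eventually_ne) auto
      qed
    qed simp
    then show ?thesis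
      by eventually_elim auto
  qed
  have "eventually (\<lambda>h. \<forall>x\<in>{a, b, c} \<union> set L. x \<notin> \<zeta> h ` ?N) (at 0)"
  proof (rule eventually_ball_finite)
    show "\<forall>x\<in>{a, b, c} \<union> set L. eventually (\<lambda>h. x \<notin> \<zeta> h ` ?N) (at 0)"
    proof
      fix x assume "x \<in> {a, b, c} \<union> set L"
      then have "x \<noteq> 0"
        using nz by auto
      then show "eventually (\<lambda>h. x \<notin> \<zeta> h ` ?N) (at 0)"
        by (rule avoid)
    qed
  qed simp
  then have "eventually (\<lambda>h. E h = 0) (at 0)"
    using eventually_neq_at_within[of 0 0 UNIV]
  proof eventually_elim
    case (elim h)
    interpret distinct_nodes ?N "\<zeta> h"
      by unfold_locales (use elim in \<open>auto simp: \<zeta>_def inj_on_def\<close>)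
    have "divdiff (\<lambda>d. - (\<Sum>x\<leftarrow>M. recip_prod (\<zeta> h) x d))" if "set M \<subseteq> set L" for M
      using that
    proof (induction M)
      case Nil
      then show ?case
        using divdiff_zero by simp
    next
      case (Cons x M)
      then have "divdiff (\<lambda>d. - (\<Sum>x\<leftarrow>M. recip_prod (\<zeta> h) x d) - recip_prod (\<zeta> h) x d)"
        using elim by (intro divdiff_diff divdiff_R) auto
      moreover have "(\<lambda>d. - (\<Sum>x\<leftarrow>x # M. recip_prod (\<zeta> h) x d)) =
          (\<lambda>d. - (\<Sum>x\<leftarrow>M. recip_prod (\<zeta> h) x d) - recip_prod (\<zeta> h) x d)"
        by (simp add: fun_eq_iff)
      ultimately show ?case
        by (simp only:)
    qed
    then have "divdiff (w h)"
      by (simp add: w_def)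
    then show ?case
      unfolding E_def using elim by (intro three_term \<tau> ab) auto
  qed
  then have lim0: "(E \<longlongrightarrow> 0) (at 0)"
    by (rule tendsto_eventually)
  have R: "((\<lambda>h. recip_prod (\<zeta> h) x d) \<longlongrightarrow> (1 / x) ^ card d) (at 0)" if "d \<subseteq> ?N" "x \<noteq> 0" for x d
    unfolding \<zeta>_def using that finite_subset by (intro recip_prod_tendsto) auto
  have "((\<lambda>h. \<Sum>x\<leftarrow>M. recip_prod (\<zeta> h) x d) \<longlongrightarrow> (\<Sum>x\<leftarrow>M. (1 / x) ^ card d)) (at 0)"
    if "d \<subseteq> ?N" "set M \<subseteq> set L" for M d
    using that(2)
  proof (induction M)
    case (Cons x M)
    then have "x \<noteq> 0"
      using nz by auto
    with Cons show ?case
      using R[OF that(1)] by (auto intro!: tendsto_add)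
  qed simp
  then have w: "((\<lambda>h. w h d) \<longlongrightarrow> W L d) (at 0)" if "d \<subseteq> ?N" for d
    unfolding w_def W_def psum_def map_map o_def using that by (intro tendsto_minus) auto
  have Wc: "W (x # M) d = W M d - (1 / x) ^ card d" for x M d
    by (simp add: W_def psum_def)
  have w1: "((\<lambda>h. w h d - recip_prod (\<zeta> h) x d) \<longlongrightarrow> W (x # L) d) (at 0)"
    if "d \<subseteq> ?N" "x \<noteq> 0" for x d
    using tendsto_diff[OF w R, OF that(1) that] by (simp only: Wc)
  have w2: "((\<lambda>h. w h d - recip_prod (\<zeta> h) x d - recip_prod (\<zeta> h) y d) \<longlongrightarrow> W (x # y # L) d) (at 0)"
    if "d \<subseteq> ?N" "x \<noteq> 0" "y \<noteq> 0" for x y d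
  proof -
    have "W (x # y # L) d = W (x # L) d - (1 / y) ^ card d"
      by (simp add: Wc)
    then show ?thesis
      using tendsto_diff[OF w1 R, OF that(1,2) that(1,3)] by (simp only:)
  qed
  have fin: "finite ?N"
    by simp
  have "(E \<longlongrightarrow> (b - c) * cyc_conv ?N (W (a # L)) (W (b # c # L)) u \<tau> +
    (c - a) * cyc_conv ?N (W (b # L)) (W (c # a # L)) u \<tau> +
    (a - b) * cyc_conv ?N (W (c # L)) (W (a # b # L)) u \<tau>) (at 0)"
    unfolding E_def
    by (intro tendsto_add tendsto_mult tendsto_const cyc_conv_tendsto \<tau> fin w1 w2 nz)
  from tendsto_unique[OF _ this lim0] show ?thesis
    by simp
qed

section \<open>Extracting coefficients inside a subspace\<close>

lemma subspace_scaleD: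
  assumes "fvs.subspace V" "c \<noteq> 0" "scl c x \<in> V"
  shows "x \<in> V"
  using fvs.subspace_scale[OF assms(1,3), of "1 / c"] assms(2) by (simp add: fvs.scale_scale)

text \<open>Vandermonde elimination: subtracting \<open>r k0\<close> times the sum for i from the
  sum for \<open>Suc i\<close> removes the term of \<open>k0\<close> and scales the others by
  nonzero factors.\<close>

lemma subspace_exponential_sum:
  assumes V: "fvs.subspace V" and K: "finite K" and inj: "inj_on r K"
    and mem: "\<And>i::nat. (\<Sum>k\<in>K. scl (r k ^ i) (x k)) \<in> V"
  shows "\<forall>k\<in>K. x k \<in> V"
  using K inj mem
proof (induction K arbitrary: x rule: finite_induct)
  case (insert k0 K)
  have "scl (r k - r k0) (x k) \<in> V" if "k \<in> K" for k
  proof -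
    have "\<forall>k\<in>K. scl (r k - r k0) (x k) \<in> V"
    proof (rule insert.IH)
      show "inj_on r K"
        using insert.prems(1) by simp
      fix i
      have "(\<Sum>k\<in>insert k0 K. scl (r k ^ Suc i) (x k)) - scl (r k0) (\<Sum>k\<in>insert k0 K. scl (r k ^ i) (x k)) \<in> V"
        by (intro fvs.subspace_diff fvs.subspace_scale V insert.prems)
      also have "(\<Sum>k\<in>insert k0 K. scl (r k ^ Suc i) (x k)) - scl (r k0) (\<Sum>k\<in>insert k0 K. scl (r k ^ i) (x k)) =
          (\<Sum>k\<in>insert k0 K. scl (r k ^ i) (scl (r k - r k0) (x k)))"
        unfolding fvs.scale_sum_right sum_subtractf[symmetric]
        by (intro sum.cong refl) (simp add: scl_def fun_eq_iff algebra_simps)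
      also have "\<dots> = (\<Sum>k\<in>K. scl (r k ^ i) (scl (r k - r k0) (x k)))"
        using insert.hyps by simp
      finally show "(\<Sum>k\<in>K. scl (r k ^ i) (scl (r k - r k0) (x k))) \<in> V" .
    qed
    with that show ?thesis by blast
  qed
  moreover have "r k - r k0 \<noteq> 0" if "k \<in> K" for k
    using insert.prems(1) insert.hyps that by (auto simp: inj_on_def)
  ultimately have xK: "x k \<in> V" if "k \<in> K" for k
    using that by (blast intro: subspace_scaleD[OF V])
  moreover have "x k0 \<in> V"
  proof -
    have "(\<Sum>k\<in>insert k0 K. scl (r k ^ 0) (x k)) - (\<Sum>k\<in>K. x k) \<in> V"
      by (intro fvs.subspace_diff fvs.subspace_sum V insert.prems xK)
    then show ?thesis
      using insert.hyps by simp
  qed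
  ultimately show ?case
    using xK by blast
qed simp

lemma poly_eq_sum_upto:
  fixes q :: "complex poly"
  assumes "degree q \<le> m"
  shows "poly q s = (\<Sum>k\<le>m. s ^ k * coeff q k)"
proof -
  have "poly q s = (\<Sum>k\<le>degree q. s ^ k * coeff q k)"
    by (simp add: poly_altdef mult.commute)
  also have "\<dots> = (\<Sum>k\<le>m. s ^ k * coeff q k)"
    by (rule sum.mono_neutral_left) (use assms in \<open>auto simp: coeff_eq_0\<close>)
  finally show ?thesis .
qed

lemma inj_two_power: "inj (\<lambda>k::nat. 2 ^ k :: complex)"
proof (rule injI)
  fix k l :: nat
  assume "(2 :: complex) ^ k = 2 ^ l"
  then have "norm ((2 :: complex) ^ k) = norm ((2 :: complex) ^ l)"
    by (rule arg_cong)
  then show "k = l"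
    by (simp add: norm_power)
qed

text \<open>At the sample points \<open>s0 * 2 ^ i\<close> the monomial of degree k is an
  exponential in i with ratio \<open>2 ^ k\<close>, and these ratios are distinct. The degree bound
  is uniform in x so that finitely many ratios occur.\<close>

lemma polynomial_curve:
  fixes F :: "complex \<Rightarrow> 'x \<Rightarrow> complex"
  assumes V: "fvs.subspace V" and s0: "s0 \<noteq> 0"
    and poly: "\<And>x s. F s x = poly (q x) s" and deg: "\<And>x. degree (q x) \<le> m"
    and mem: "\<And>i::nat. F (s0 * 2 ^ i) \<in> V"
  shows "(\<lambda>x. coeff (q x) k) \<in> V"
proof (cases "k \<le> m")
  case True
  have F: "F s = (\<Sum>k\<le>m. scl (s ^ k) (\<lambda>x. coeff (q x) k))" for s
    by (rule ext) (simp add: poly poly_eq_sum_upto[OF deg] sum_fun_apply scl_def)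
  have "\<forall>k\<in>{..m}. scl (s0 ^ k) (\<lambda>x. coeff (q x) k) \<in> V"
  proof (rule subspace_exponential_sum[OF V, where r = "\<lambda>k. 2 ^ k"])
    show "inj_on (\<lambda>k. 2 ^ k :: complex) {..m}"
      by (rule inj_on_subset[OF inj_two_power]) simp
    fix i :: nat
    have "(\<Sum>k\<le>m. scl ((2 ^ k) ^ i) (scl (s0 ^ k) (\<lambda>x. coeff (q x) k))) = F (s0 * 2 ^ i)"
      unfolding F
    proof (rule sum.cong[OF refl])
      fix k
      have "((2::complex) ^ k) ^ i = (2 ^ i) ^ k"
        by (simp only: power_mult[symmetric] mult.commute)
      then show "scl ((2 ^ k) ^ i) (scl (s0 ^ k) (\<lambda>x. coeff (q x) k)) = scl ((s0 * 2 ^ i) ^ k) (\<lambda>x. coeff (q x) k)"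
        by (simp only: fvs.scale_scale power_mult_distrib mult.commute)
    qed
    then show "(\<Sum>k\<le>m. scl ((2 ^ k) ^ i) (scl (s0 ^ k) (\<lambda>x. coeff (q x) k))) \<in> V"
      using mem by simp
  qed simp
  then show ?thesis
    using s0 True subspace_scaleD[OF V, of "s0 ^ k" "\<lambda>x. coeff (q x) k"] by simp
next
  case False
  have "coeff (q x) k = 0" for x
    by (rule coeff_eq_0) (use deg[of x] False in linarith)
  then have "(\<lambda>x. coeff (q x) k) = 0"
    by (simp add: fun_eq_iff)
  then show ?thesis
    using fvs.subspace_0[OF V] by simp
qed

lemma polynomial_curve_values:
  fixes F :: "complex \<Rightarrow> 'x \<Rightarrow> complex"
  assumes V: "fvs.subspace V"
    and poly: "\<And>x s. F s x = poly (q x) s" and deg: "\<And>x. degree (q x) \<le> m"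
    and mem: "\<And>k. (\<lambda>x. coeff (q x) k) \<in> V"
  shows "F s \<in> V"
proof -
  have "F s = (\<Sum>k\<le>m. scl (s ^ k) (\<lambda>x. coeff (q x) k))"
    by (rule ext) (simp add: poly poly_eq_sum_upto[OF deg] sum_fun_apply scl_def)
  then show ?thesis
    by (simp add: fvs.subspace_sum fvs.subspace_scale V mem)
qed

text \<open>Interpolation: coefficients are recovered from the samples and recombined at any s.
  Finite support gives a common degree bound.\<close>

lemma polynomial_curve_pointwise:
  fixes F :: "complex \<Rightarrow> 'x \<Rightarrow> complex"
  assumes V: "fvs.subspace V" and s0: "s0 \<noteq> 0"
    and poly: "\<And>x. x \<in> S \<Longrightarrow> \<exists>q. \<forall>s. F s x = poly q s"
    and fin: "finite S" and zero: "\<And>x s. x \<notin> S \<Longrightarrow> F s x = 0"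
    and mem: "\<And>i::nat. F (s0 * 2 ^ i) \<in> V"
  shows "F s \<in> V"
proof -
  have "\<exists>q. \<forall>s. F s x = poly q s" for x
  proof (cases "x \<in> S")
    case False
    then have "\<forall>s. F s x = poly 0 s"
      using zero by simp
    then show ?thesis ..
  qed (rule poly)
  then obtain q0 where q0: "F s x = poly (q0 x) s" for s x
    using choice[of "\<lambda>x q. \<forall>s. F s x = poly q s"] by blast
  define q where "q = (\<lambda>x. if x \<in> S then q0 x else 0)"
  define m where "m = Max (insert 0 ((\<lambda>x. degree (q0 x)) ` S))"
  have q: "F s x = poly (q x) s" for x s
    using q0 zero by (simp add: q_def)
  have deg: "degree (q x) \<le> m" for x
    using fin by (auto simp: q_def m_def intro!: Max_ge)
  show ?thesis
    by (rule polynomial_curve_values[OF V q deg polynomial_curve[OF V s0 q deg mem]])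
qed

section \<open>The relation between alphabets and its first-order term\<close>

lemma tau_0: "\<not> \<sigma> permutes {1..n} \<Longrightarrow> tau n z p t \<sigma> = 0"
  by (simp add: tau_def)

lemma CS_mult_0: "\<not> \<rho> permutes {1..n} \<Longrightarrow> (f \<otimes>\<^bsub>CS n\<^esub> g) \<rho> = 0"
  unfolding CS_mult_apply by (intro sum.neutral ballI) (auto intro: permutes_compose)

lemma psum_Cons: "psum (s # L) k = psum L k - s ^ k"
  by (simp add: psum_def)

text \<open>Cycle lengths lie between 1 and n. So \<open>p 0\<close> and the values beyond n are
  free, which permits the letter 0 and truncated sequences.\<close>

lemma tau_cong:
  assumes "\<And>k. 1 \<le> k \<Longrightarrow> k \<le> n \<Longrightarrow> p k = r k"
  shows "tau n z p t = tau n z r t"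
proof
  fix \<sigma>
  have "p (card c) = r (card c)" if "\<sigma> permutes {1..n}" "c \<in> orbs \<sigma> {1..n}" for c
    using orbs_subset[OF that] orbs_nonempty[OF that(2)] card_mono[of "{1..n}" c] finite_subset[of c "{1..n}"]
    by (intro assms) (auto simp: Suc_le_eq card_gt_0_iff)
  then show "tau n z p t \<sigma> = tau n z r t \<sigma>"
    by (auto simp: tau_def cyc_weight_def intro!: prod.cong)
qed

text \<open>Colliding nodes produce power sums of reciprocals, so the relation is taken at
  \<open>1 / a\<close>, \<open>1 / b\<close>, \<open>1 / c\<close> and multiplied by
  \<open>a * b * c\<close>.\<close>

lemma tau_three_term:
  assumes ab: "a \<noteq> b" "b \<noteq> c" "c \<noteq> a" and nz: "a \<noteq> 0" "b \<noteq> 0" "c \<noteq> 0" "0 \<notin> set L"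
  shows "a * (c - b) * (tau n z (psum (c # b # L)) t \<otimes>\<^bsub>CS n\<^esub> tau n z (psum (a # L)) t) \<rho> +
    b * (a - c) * (tau n z (psum (c # a # L)) t \<otimes>\<^bsub>CS n\<^esub> tau n z (psum (b # L)) t) \<rho> +
    c * (b - a) * (tau n z (psum (a # b # L)) t \<otimes>\<^bsub>CS n\<^esub> tau n z (psum (c # L)) t) \<rho> = 0"
proof (cases "\<rho> permutes {1..n}")
  case True
  have swap: "psum (b # c # L) = psum (c # b # L)"
    by (simp add: fun_eq_iff psum_Cons)
  have inv: "map (\<lambda>x. 1 / x) (map (\<lambda>x. 1 / x) L) = L"
    by (simp add: o_def)
  have "(1 / b - 1 / c) * (tau n z (psum (c # b # L)) t \<otimes>\<^bsub>CS n\<^esub> tau n z (psum (a # L)) t) \<rho> +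
    (1 / c - 1 / a) * (tau n z (psum (c # a # L)) t \<otimes>\<^bsub>CS n\<^esub> tau n z (psum (b # L)) t) \<rho> +
    (1 / a - 1 / b) * (tau n z (psum (a # b # L)) t \<otimes>\<^bsub>CS n\<^esub> tau n z (psum (c # L)) t) \<rho> = 0"
    using three_term_collide[OF True, of "1 / a" "1 / b" "1 / c" "map (\<lambda>x. 1 / x) L" "\<lambda>i. z i + t"] assms
    unfolding list.map(2) inv conv_eq_CS_mult[OF True] by (simp add: swap image_iff)
  then have "a * b * c * ((1 / b - 1 / c) * (tau n z (psum (c # b # L)) t \<otimes>\<^bsub>CS n\<^esub> tau n z (psum (a # L)) t) \<rho> +
    (1 / c - 1 / a) * (tau n z (psum (c # a # L)) t \<otimes>\<^bsub>CS n\<^esub> tau n z (psum (b # L)) t) \<rho> +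
    (1 / a - 1 / b) * (tau n z (psum (a # b # L)) t \<otimes>\<^bsub>CS n\<^esub> tau n z (psum (c # L)) t) \<rho>) = 0"
    by (simp only: mult_zero_right)
  moreover have "a * b * c * ((1 / b - 1 / c) * x + (1 / c - 1 / a) * y + (1 / a - 1 / b) * w) =
      a * (c - b) * x + b * (a - c) * y + c * (b - a) * w" for x y w
    using nz by (simp add: field_simps)
  ultimately show ?thesis
    by (simp only:)
qed (simp add: CS_mult_0)

text \<open>The t-derivative by the product rule: one fixed point loses its factor.\<close>

definition dtau :: "nat \<Rightarrow> (nat \<Rightarrow> complex) \<Rightarrow> (nat \<Rightarrow> complex) \<Rightarrow> complex \<Rightarrow> (nat \<Rightarrow> nat) \<Rightarrow> complex" where
  "dtau n z p t \<sigma> =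
    (if \<sigma> permutes {1..n} then
      \<Sum>c\<in>orbs \<sigma> {1..n}. (if card c = 1 then 1 else 0) *
        (\<Prod>d\<in>orbs \<sigma> {1..n} - {c}. p (card d) + fixw (\<lambda>i. z i + t) d)
     else 0)"

lemma fixw_shift: "fixw (\<lambda>i. z i + t) c = fixw z c + (if card c = 1 then t else 0)"
  by (simp add: fixw_def)

lemma tau_deriv: "((\<lambda>t. tau n z p t \<sigma>) has_field_derivative dtau n z p t \<sigma>) (at t)"
proof (cases "\<sigma> permutes {1..n}")
  case True
  have "((\<lambda>t. p (card c) + fixw (\<lambda>i. z i + t) c) has_field_derivative (if card c = 1 then 1 else 0)) (at t)" for c
    unfolding fixw_shift by (auto intro!: derivative_eq_intros)
  from has_field_derivative_prod[OF this] show ?thesis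
    using True by (simp add: tau_def dtau_def cyc_weight_def)
qed (simp add: tau_def dtau_def)

text \<open>For k > 1 the power \<open>s ^ k\<close> has no first-order term at 0. To first order a
  new small letter therefore changes only the factors of fixed points, just as replacing t by t - s
  does.\<close>

lemma tau_letter_deriv:
  "((\<lambda>s. tau n z (\<lambda>k. p k - s ^ k) t \<sigma>) has_field_derivative - dtau n z p t \<sigma>) (at 0)"
proof (cases "\<sigma> permutes {1..n}")
  case True
  have pos: "card c > 0" if "c \<in> orbs \<sigma> {1..n}" for c
    using finite_in_orbs[OF True _ that] orbs_nonempty[OF that] by (simp add: card_gt_0_iff)
  have "((\<lambda>s. p (card c) - s ^ card c + fixw (\<lambda>i. z i + t) c) has_field_derivative
      - (if card c = 1 then 1 else 0)) (at 0)" if "c \<in> orbs \<sigma> {1..n}" for c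
    using pos[OF that] by (auto intro!: derivative_eq_intros simp: power_0_left)
  from has_field_derivative_prod[OF this]
  have "((\<lambda>s. tau n z (\<lambda>k. p k - s ^ k) t \<sigma>) has_field_derivative
      (\<Sum>c\<in>orbs \<sigma> {1..n}. - (if card c = 1 then 1 else 0) *
        (\<Prod>d\<in>orbs \<sigma> {1..n} - {c}. p (card d) - 0 ^ card d + fixw (\<lambda>i. z i + t) d))) (at 0)"
    using True by (simp add: tau_def cyc_weight_def)
  also have "(\<Sum>c\<in>orbs \<sigma> {1..n}. - (if card c = 1 then 1 else 0) *
        (\<Prod>d\<in>orbs \<sigma> {1..n} - {c}. p (card d) - 0 ^ card d + fixw (\<lambda>i. z i + t) d)) = - dtau n z p t \<sigma>"
  proof -
    have "(\<Prod>d\<in>orbs \<sigma> {1..n} - {c}. p (card d) - 0 ^ card d + fixw (\<lambda>i. z i + t) d) =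
        (\<Prod>d\<in>orbs \<sigma> {1..n} - {c}. p (card d) + fixw (\<lambda>i. z i + t) d)" for c
      using pos by (intro prod.cong) (auto simp: zero_power)
    then show ?thesis
      using True by (simp add: dtau_def sum_negf)
  qed
  finally show ?thesis .
qed (simp add: tau_def dtau_def)

lemma CS_mult_deriv_left:
  assumes "\<And>\<sigma>. ((\<lambda>s. f s \<sigma>) has_field_derivative f' \<sigma>) (at x)"
  shows "((\<lambda>s. (f s \<otimes>\<^bsub>CS n\<^esub> g) \<rho>) has_field_derivative (f' \<otimes>\<^bsub>CS n\<^esub> g) \<rho>) (at x)"
  unfolding CS_mult_apply
  by (intro DERIV_sum) (auto intro!: derivative_eq_intros assms)

lemma CS_mult_deriv_right:
  assumes "\<And>\<sigma>. ((\<lambda>s. g s \<sigma>) has_field_derivative g' \<sigma>) (at x)"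
  shows "((\<lambda>s. (f \<otimes>\<^bsub>CS n\<^esub> g s) \<rho>) has_field_derivative (f \<otimes>\<^bsub>CS n\<^esub> g') \<rho>) (at x)"
  unfolding CS_mult_apply
  by (intro DERIV_sum) (auto intro!: derivative_eq_intros assms)

lemma CS_mult_uminus_left: "((\<lambda>\<sigma>. - f \<sigma>) \<otimes>\<^bsub>CS n\<^esub> g) \<rho> = - (f \<otimes>\<^bsub>CS n\<^esub> g) \<rho>"
  unfolding CS_mult_apply by (simp flip: sum_negf add: if_distrib cong: if_cong)

text \<open>The first-order term of \<open>tau_three_term\<close> as the third letter tends to \<open>0\<close>.\<close>

lemma tau_differential:
  fixes n :: nat and z :: "nat \<Rightarrow> complex" and t :: complex
  assumes ab: "a \<noteq> b" and nz: "a \<noteq> 0" "b \<noteq> 0" "0 \<notin> set L"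
  defines "T \<equiv> (\<lambda>M. tau n z (psum M) t)" and "T' \<equiv> (\<lambda>M. dtau n z (psum M) t)"
  shows "(a - b) * (T (a # b # L) \<otimes>\<^bsub>CS n\<^esub> T L) \<rho> =
    a * (T (b # L) \<otimes>\<^bsub>CS n\<^esub> T (a # L)) \<rho> - b * (T (a # L) \<otimes>\<^bsub>CS n\<^esub> T (b # L)) \<rho> +
    a * b * ((T' (b # L) \<otimes>\<^bsub>CS n\<^esub> T (a # L)) \<rho> - (T' (a # L) \<otimes>\<^bsub>CS n\<^esub> T (b # L)) \<rho>)"
proof -
  define A where "A = (\<lambda>c. (T (c # b # L) \<otimes>\<^bsub>CS n\<^esub> T (a # L)) \<rho>)"
  define B where "B = (\<lambda>c. (T (c # a # L) \<otimes>\<^bsub>CS n\<^esub> T (b # L)) \<rho>)"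
  define C where "C = (\<lambda>c. (T (a # b # L) \<otimes>\<^bsub>CS n\<^esub> T (c # L)) \<rho>)"
  \<comment> \<open>The three-term expression as a function of its third letter. Up to a factor, its
    value at 0 is the commutator of \<open>T (a # L)\<close> and \<open>T (b # L)\<close>.\<close>
  define G where "G = (\<lambda>c. a * (c - b) * A c + b * (a - c) * B c + c * (b - a) * C c)"
  have letter: "((\<lambda>c. T (c # M) \<sigma>) has_field_derivative - T' M \<sigma>) (at 0)" for M \<sigma>
    unfolding T_def T'_def psum_Cons[abs_def] using tau_letter_deriv .
  have T0: "T (0 # M) = T M" for M
    unfolding T_def by (rule tau_cong) (simp add: psum_Cons)
  have A: "(A has_field_derivative - (T' (b # L) \<otimes>\<^bsub>CS n\<^esub> T (a # L)) \<rho>) (at 0)"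
    unfolding A_def CS_mult_uminus_left[symmetric] by (rule CS_mult_deriv_left[OF letter])
  have B: "(B has_field_derivative - (T' (a # L) \<otimes>\<^bsub>CS n\<^esub> T (b # L)) \<rho>) (at 0)"
    unfolding B_def CS_mult_uminus_left[symmetric] by (rule CS_mult_deriv_left[OF letter])
  have C: "(C has_field_derivative (T (a # b # L) \<otimes>\<^bsub>CS n\<^esub> (\<lambda>\<sigma>. - T' L \<sigma>)) \<rho>) (at 0)"
    unfolding C_def by (rule CS_mult_deriv_right[OF letter])
  have dG: "(G has_field_derivative a * A 0 + a * b * (T' (b # L) \<otimes>\<^bsub>CS n\<^esub> T (a # L)) \<rho> -
      b * B 0 - a * b * (T' (a # L) \<otimes>\<^bsub>CS n\<^esub> T (b # L)) \<rho> + (b - a) * C 0) (at 0)"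
    unfolding G_def by (rule derivative_eq_intros A B C refl)+ (simp add: algebra_simps)
  have ev: "eventually (\<lambda>c. G c = 0) (at 0)"
  proof -
    have "eventually (\<lambda>c. c \<noteq> a) (at 0)" "eventually (\<lambda>c. c \<noteq> b) (at 0)" "eventually (\<lambda>c::complex. c \<noteq> 0) (at 0)"
      using nz by (auto intro: tendsto_imp_eventually_ne[OF tendsto_ident_at] eventually_neq_at_within)
    then show ?thesis
    proof eventually_elim
      case (elim c)
      then show ?case
        using tau_three_term[of a b c L n z t \<rho>] ab nz by (simp add: G_def A_def B_def C_def T_def)
    qed
  qed
  \<comment> \<open>The relation holds for small nonzero c only; continuity supplies c = 0, so G
    vanishes on a neighbourhood and its derivative is 0.\<close>
  have "(G \<longlongrightarrow> G 0) (at 0)"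
    using DERIV_isCont[OF dG] by (simp add: isCont_def)
  then have "G 0 = 0"
    using tendsto_unique[OF _ _ tendsto_eventually[OF ev]] by simp
  with ev have "eventually (\<lambda>c. G c = 0) (nhds 0)"
    by (simp add: eventually_nhds_conv_at)
  then have "(G has_field_derivative 0) (at 0)"
    using DERIV_cong_ev[of 0 0 G "\<lambda>_. 0" 0 0] by simp
  from DERIV_unique[OF dG this] show ?thesis
    by (simp add: A_def B_def C_def T0 algebra_simps)
qed

section \<open>Membership in a subalgebra containing the one-letter sums\<close>

lemma sum_card_orbs:
  assumes "\<sigma> permutes N" "finite N"
  shows "(\<Sum>c\<in>orbs \<sigma> N. card c) = card N"
proof -
  have "card (\<Union>(orbs \<sigma> N)) = (\<Sum>c\<in>orbs \<sigma> N. card c)"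
    using orbs_disjoint[OF assms] finite_in_orbs[OF assms]
    by (intro card_Union_disjoint) (auto simp: pairwise_def disjnt_def)
  then show ?thesis
    by (simp add: Union_orbs[OF assms])
qed

text \<open>Only the factors of fixed points involve t, so the degree is at most the number of fixed
  points, and the identity alone reaches n.\<close>

lemma tau_poly_t:
  "\<exists>q. (\<forall>t. tau n z p t \<sigma> = poly q t) \<and> degree q \<le> n \<and> coeff q n = bvec id \<sigma>"
proof (cases "\<sigma> permutes {1..n}")
  case False
  then have "\<sigma> \<noteq> id"
    by (auto simp: permutes_id)
  with False show ?thesis
    by (intro exI[of _ 0]) (simp add: tau_0 bvec_def)
next
  case True
  define f where "f = (\<lambda>c. pCons (p (card c) + fixw z c) (if card c = 1 then 1 else 0 :: complex poly))"
  define q where "q = (\<Prod>c\<in>orbs \<sigma> {1..n}. f c)"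
  have eval: "tau n z p t \<sigma> = poly q t" for t
    using True unfolding tau_def cyc_weight_def q_def f_def fixw_shift
    by (auto simp: poly_prod intro!: prod.cong)
  have pos: "card c > 0" if "c \<in> orbs \<sigma> {1..n}" for c
    using finite_in_orbs[OF True _ that] orbs_nonempty[OF that] by (simp add: card_gt_0_iff)
  have deg: "degree q \<le> (\<Sum>c\<in>orbs \<sigma> {1..n}. if card c = 1 then 1 else 0)"
    unfolding q_def
    by (rule order_trans[OF degree_prod_sum_le]) (auto simp: f_def intro!: sum_mono)
  also have le: "\<dots> \<le> (\<Sum>c\<in>orbs \<sigma> {1..n}. card c)"
    by (intro sum_mono) auto
  also have "\<dots> = n"
    using sum_card_orbs[OF True] by simp
  finally have "degree q \<le> n" .
  moreover have "coeff q n = bvec id \<sigma>"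
  proof (cases "\<sigma> = id")
    case True
    have q: "q = (\<Prod>x\<in>{1..n}. [:p 1 + z x, 1:])"
      unfolding q_def True orbs_id by (subst prod.reindex) (auto simp: f_def one_pCons)
    have "lead_coeff q = 1"
      unfolding q lead_coeff_prod by simp
    moreover have "degree q = n"
      unfolding q by (subst degree_prod_eq_sum_degree) auto
    ultimately show ?thesis
      using True by (simp add: bvec_def)
  next
    case False
    then obtain x where x: "\<sigma> x \<noteq> x"
      by (auto simp: fun_eq_iff)
    then have xn: "x \<in> {1..n}"
      using True by (auto simp: permutes_def)
    let ?c = "orbit \<sigma> x"
    have "card ?c \<noteq> 1"
      using x permutes_self_in_orbit[OF True, of x] orbit_eq_singleton_iff[of \<sigma> x]
      by (auto simp: card_1_singleton_iff)
    moreover have "card ?c > 0"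
      using pos[OF orbit_in_orbs[OF xn]] .
    ultimately have "(\<Sum>c\<in>orbs \<sigma> {1..n}. if card c = 1 then 1 else 0) < (\<Sum>c\<in>orbs \<sigma> {1..n}. card c)"
      using orbit_in_orbs[OF xn, of \<sigma>] by (intro sum_strict_mono_ex1) (auto intro!: bexI[of _ ?c])
    with deg sum_card_orbs[OF True] have "degree q < n"
      by simp
    then show ?thesis
      using False by (simp add: coeff_eq_0 bvec_def)
  qed
  ultimately show ?thesis
    using eval by blast
qed

lemma tau_poly_param:
  assumes "\<And>k. \<exists>q. \<forall>s. p s k = poly q s"
  shows "\<exists>q. \<forall>s. tau n z (p s) t \<sigma> = poly q s"
proof (cases "\<sigma> permutes {1..n}")
  case False
  then show ?thesis
    by (intro exI[of _ 0]) (simp add: tau_0)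
next
  case True
  obtain q where q: "p s k = poly (q k) s" for s k
    using choice[of "\<lambda>k q. \<forall>s. p s k = poly q s"] assms by blast
  show ?thesis
    using True
    by (intro exI[of _ "\<Prod>c\<in>orbs \<sigma> {1..n}. q (card c) + [:fixw (\<lambda>i. z i + t) c:]"])
      (simp add: tau_def cyc_weight_def poly_prod q)
qed

lemma CS_mult_bvec_id:
  assumes "f \<in> carrier (CS n)"
  shows "f \<otimes>\<^bsub>CS n\<^esub> bvec id = f"
proof
  fix \<rho>
  show "(f \<otimes>\<^bsub>CS n\<^esub> bvec id) \<rho> = f \<rho>"
  proof (cases "\<rho> permutes {1..n}")
    case True
    have "(\<Sum>\<tau> | \<tau> permutes {1..n}. if \<rho> = \<sigma> \<circ> \<tau> then f \<sigma> * bvec id \<tau> else 0) = (if \<sigma> = \<rho> then f \<sigma> else 0)"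
      if "\<sigma> permutes {1..n}" for \<sigma>
    proof -
      have "(\<Sum>\<tau> | \<tau> permutes {1..n}. if \<rho> = \<sigma> \<circ> \<tau> then f \<sigma> * bvec id \<tau> else 0) =
          (\<Sum>\<tau> | \<tau> permutes {1..n}. if \<tau> = id then (if \<sigma> = \<rho> then f \<sigma> else 0) else 0)"
        by (intro sum.cong refl) (auto simp: bvec_def)
      then show ?thesis
        by (simp add: sum.delta finite_permutations permutes_id)
    qed
    then have "(f \<otimes>\<^bsub>CS n\<^esub> bvec id) \<rho> = (\<Sum>\<sigma> | \<sigma> permutes {1..n}. if \<sigma> = \<rho> then f \<sigma> else 0)"
      unfolding CS_mult_apply by (intro sum.cong refl) auto
    then show ?thesis
      using True by (simp add: sum.delta finite_permutations)
  next
    case False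
    with assms show ?thesis
      by (simp add: CS_mult_0 CS_carrier)
  qed
qed

lemma CS_mult_zero_right: "(f \<otimes>\<^bsub>CS n\<^esub> (\<lambda>_. 0)) = (\<lambda>_. 0)"
  by (rule ext) (simp add: CS_mult_apply cong: if_cong)

text \<open>Division by a monic polynomial over a noncommutative algebra: the leading coefficient of
  the right factor is the unit, so the coefficients of the left factor are found from the highest
  one down.\<close>

lemma right_monic_division:
  fixes q r :: "(nat \<Rightarrow> nat) \<Rightarrow> complex poly"
  assumes V: "fvs.subspace V" and mult: "\<And>f g. f \<in> V \<Longrightarrow> g \<in> V \<Longrightarrow> f \<otimes>\<^bsub>CS n\<^esub> g \<in> V"
    and deg: "\<And>\<sigma>. degree (q \<sigma>) \<le> n" "\<And>\<sigma>. degree (r \<sigma>) \<le> n"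
    and monic: "\<And>\<sigma>. coeff (r \<sigma>) n = bvec id \<sigma>"
    and supp: "\<And>\<sigma>. \<not> \<sigma> permutes {1..n} \<Longrightarrow> q \<sigma> = 0"
    and r: "\<And>k. (\<lambda>\<sigma>. coeff (r \<sigma>) k) \<in> V"
    and prod: "\<And>t. (\<lambda>\<sigma>. poly (q \<sigma>) t) \<otimes>\<^bsub>CS n\<^esub> (\<lambda>\<sigma>. poly (r \<sigma>) t) \<in> V"
  shows "(\<lambda>\<sigma>. coeff (q \<sigma>) m) \<in> V"
proof -
  define Q where "Q = (\<lambda>k \<sigma>. coeff (q \<sigma>) k)"
  define P where "P = (\<lambda>k \<sigma>. coeff (r \<sigma>) k)"
  define H where "H = (\<lambda>\<rho>. \<Sum>\<sigma> | \<sigma> permutes {1..n}. \<Sum>\<tau> | \<tau> permutes {1..n}.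
     if \<rho> = \<sigma> \<circ> \<tau> then q \<sigma> * r \<tau> else 0)"
  have H_eval: "((\<lambda>\<sigma>. poly (q \<sigma>) t) \<otimes>\<^bsub>CS n\<^esub> (\<lambda>\<sigma>. poly (r \<sigma>) t)) \<rho> = poly (H \<rho>) t" for t \<rho>
    unfolding H_def CS_mult_apply poly_sum by (intro sum.cong refl) simp
  have H_deg: "degree (H \<rho>) \<le> n + n" for \<rho>
    unfolding H_def
    by (intro degree_sum_le finite_permutations) (auto intro!: order_trans[OF degree_mult_le] add_mono deg)
  have H_coeff: "coeff (H \<rho>) k = (\<Sum>i\<le>k. (Q i \<otimes>\<^bsub>CS n\<^esub> P (k - i)) \<rho>)" for k \<rho>
  proof -
    have "coeff (H \<rho>) k = (\<Sum>\<sigma> | \<sigma> permutes {1..n}. \<Sum>\<tau> | \<tau> permutes {1..n}. \<Sum>i\<le>k.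
        if \<rho> = \<sigma> \<circ> \<tau> then Q i \<sigma> * P (k - i) \<tau> else 0)"
      unfolding H_def coeff_sum by (intro sum.cong refl) (simp add: coeff_mult Q_def P_def)
    also have "\<dots> = (\<Sum>i\<le>k. (Q i \<otimes>\<^bsub>CS n\<^esub> P (k - i)) \<rho>)"
      unfolding CS_mult_apply by (simp only: sum.swap[of _ "{..k}"])
    finally show ?thesis .
  qed
  have coeffs: "(\<Sum>i\<le>k. Q i \<otimes>\<^bsub>CS n\<^esub> P (k - i)) \<in> V" for k
  proof -
    have "(\<lambda>\<rho>. coeff (H \<rho>) k) \<in> V"
      by (rule polynomial_curve[OF V, where ?s0.0 = 1 and m = "n + n"
            and F = "\<lambda>t. (\<lambda>\<sigma>. poly (q \<sigma>) t) \<otimes>\<^bsub>CS n\<^esub> (\<lambda>\<sigma>. poly (r \<sigma>) t)"])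
        (use H_eval H_deg prod in auto)
    moreover have "(\<lambda>\<rho>. coeff (H \<rho>) k) = (\<Sum>i\<le>k. Q i \<otimes>\<^bsub>CS n\<^esub> P (k - i))"
      by (simp add: fun_eq_iff H_coeff sum_fun_apply)
    ultimately show ?thesis
      by (simp only:)
  qed
  have Q0: "Q i = (\<lambda>_. 0)" if "i > n" for i
    using deg(1) that by (auto simp: Q_def fun_eq_iff intro!: coeff_eq_0 intro: le_less_trans)
  have P0: "P i = (\<lambda>_. 0)" if "i > n" for i
    using deg(2) that by (auto simp: P_def fun_eq_iff intro!: coeff_eq_0 intro: le_less_trans)
  have zero: "(\<lambda>_. 0) \<in> V"
    using fvs.subspace_0[OF V] by (simp add: zero_fun_def)
  have "Q m \<in> V"
  proof (induction "n - m" arbitrary: m rule: less_induct)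
    case less
    show ?case
    proof (cases "m > n")
      case True
      then show ?thesis
        using Q0 zero by simp
    next
      case False
      \<comment> \<open>These are the other terms of the coefficient of degree n + m: for i < m the
        second factor is beyond degree n and vanishes, for i > m the first lies in V by
        induction.\<close>
      have "Q i \<otimes>\<^bsub>CS n\<^esub> P (n + m - i) \<in> V" if "i \<le> n + m" "i \<noteq> m" for i
      proof (cases "i < m")
        case True
        then show ?thesis
          using P0[of "n + m - i"] zero by (simp add: CS_mult_zero_right)
      next
        case False
        then have "Q i \<in> V"
          using less[of i] Q0[of i] zero that \<open>\<not> n < m\<close> by (cases "i > n") auto
        then show ?thesis
          using r by (auto intro: mult simp: P_def)
      qed
      then have "(\<Sum>i\<in>{..n + m} - {m}. Q i \<otimes>\<^bsub>CS n\<^esub> P (n + m - i)) \<in> V"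
        by (intro fvs.subspace_sum V) auto
      from fvs.subspace_diff[OF V coeffs[of "n + m"] this] have "Q m \<otimes>\<^bsub>CS n\<^esub> P n \<in> V"
        by (simp add: sum.remove[of _ m])
      moreover have "P n = bvec id"
        by (simp add: P_def monic fun_eq_iff)
      moreover have "Q m \<in> carrier (CS n)"
        by (simp add: CS_carrier Q_def supp)
      ultimately show ?thesis
        by (simp add: CS_mult_bvec_id)
    qed
  qed
  then show ?thesis
    by (simp add: Q_def)
qed

text \<open>The properties of the Bethe algebra that enter the membership argument; one letter
  already encodes all column generators, see \<open>tau_one_letter\<close>.\<close>

locale one_letter_subalgebra =
  fixes n :: nat and z :: "nat \<Rightarrow> complex" and V :: "((nat \<Rightarrow> nat) \<Rightarrow> complex) set"
  assumes V: "fvs.subspace V"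
    and mult: "\<And>f g. f \<in> V \<Longrightarrow> g \<in> V \<Longrightarrow> f \<otimes>\<^bsub>CS n\<^esub> g \<in> V"
    and one_letter: "\<And>s t. tau n z (psum [s]) t \<in> V"
begin

lemma tau_curve:
  assumes "\<And>k. \<exists>q. \<forall>s. p s k = poly q s" "s0 \<noteq> 0"
    and "\<And>i::nat. tau n z (p (s0 * 2 ^ i)) t \<in> V"
  shows "tau n z (p s) t \<in> V"
  by (rule polynomial_curve_pointwise[OF V assms(2), where S = "{\<sigma>. \<sigma> permutes {1..n}}"
        and F = "\<lambda>s. tau n z (p s) t"])
    (use tau_poly_param[OF assms(1)] assms(3) in \<open>auto simp: finite_permutations tau_0\<close>)

lemma tau_t_coeffs:
  assumes "\<And>t. tau n z p t \<in> V"
  obtains q where "\<And>\<sigma> t. tau n z p t \<sigma> = poly (q \<sigma>) t" "\<And>\<sigma>. degree (q \<sigma>) \<le> n"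
    "\<And>\<sigma>. coeff (q \<sigma>) n = bvec id \<sigma>" "\<And>k. (\<lambda>\<sigma>. coeff (q \<sigma>) k) \<in> V"
proof -
  obtain q where q: "\<And>\<sigma> t. tau n z p t \<sigma> = poly (q \<sigma>) t" "\<And>\<sigma>. degree (q \<sigma>) \<le> n"
      "\<And>\<sigma>. coeff (q \<sigma>) n = bvec id \<sigma>"
    using choice[of "\<lambda>\<sigma> q. (\<forall>t. tau n z p t \<sigma> = poly q t) \<and> degree q \<le> n \<and> coeff q n = bvec id \<sigma>"]
      tau_poly_t[of n z p] by blast
  have "(\<lambda>\<sigma>. coeff (q \<sigma>) k) \<in> V" for k
    by (rule polynomial_curve[OF V, where ?s0.0 = 1 and F = "tau n z p", OF _ q(1,2)]) (use assms in auto)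
  with q that show ?thesis
    by blast
qed

lemma dtau_mem:
  assumes "\<And>t. tau n z p t \<in> V"
  shows "dtau n z p t \<in> V"
proof -
  obtain q where q: "\<And>\<sigma> t. tau n z p t \<sigma> = poly (q \<sigma>) t" "\<And>\<sigma>. degree (q \<sigma>) \<le> n"
      "\<And>\<sigma>. coeff (q \<sigma>) n = bvec id \<sigma>" "\<And>k. (\<lambda>\<sigma>. coeff (q \<sigma>) k) \<in> V"
    using tau_t_coeffs[OF assms] by blast
  have eval: "dtau n z p t \<sigma> = poly (pderiv (q \<sigma>)) t" for \<sigma> t
    using tau_deriv[of n z p \<sigma> t] unfolding q(1) by (rule DERIV_unique[OF _ poly_DERIV])
  show ?thesis
  proof (rule polynomial_curve_values[OF V, where F = "dtau n z p" and m = n])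
    show "dtau n z p s \<sigma> = poly (pderiv (q \<sigma>)) s" for \<sigma> s
      by (rule eval)
    show "degree (pderiv (q \<sigma>)) \<le> n" for \<sigma>
      using q(2)[of \<sigma>] by (simp add: degree_pderiv)
    have "(\<lambda>\<sigma>. coeff (pderiv (q \<sigma>)) k) = scl (of_nat (Suc k)) (\<lambda>\<sigma>. coeff (q \<sigma>) (Suc k))" for k
      by (simp add: scl_def coeff_pderiv fun_eq_iff)
    then show "(\<lambda>\<sigma>. coeff (pderiv (q \<sigma>)) k) \<in> V" for k
      using fvs.subspace_scale[OF V q(4)] by simp
  qed
qed

text \<open>The differential relation puts the product with \<open>tau n z (psum L) t\<close> into
  V, and this factor is monic in t. All t are treated together because the division works on
  coefficients in t.\<close>

lemma two_letter_step:
  assumes ab: "a \<noteq> b" "a \<noteq> 0" "b \<noteq> 0" and L: "0 \<notin> set L"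
    and T: "\<And>t. tau n z (psum L) t \<in> V" "\<And>t. tau n z (psum (a # L)) t \<in> V" "\<And>t. tau n z (psum (b # L)) t \<in> V"
  shows "tau n z (psum (a # b # L)) t \<in> V"
proof -
  obtain r where r: "\<And>\<sigma> t. tau n z (psum L) t \<sigma> = poly (r \<sigma>) t" "\<And>\<sigma>. degree (r \<sigma>) \<le> n"
      "\<And>\<sigma>. coeff (r \<sigma>) n = bvec id \<sigma>" "\<And>k. (\<lambda>\<sigma>. coeff (r \<sigma>) k) \<in> V"
    using tau_t_coeffs[OF T(1)] by blast
  obtain q where q: "\<And>\<sigma> t. tau n z (psum (a # b # L)) t \<sigma> = poly (q \<sigma>) t" "\<And>\<sigma>. degree (q \<sigma>) \<le> n"
    using choice[of "\<lambda>\<sigma> q. (\<forall>t. tau n z (psum (a # b # L)) t \<sigma> = poly q t) \<and> degree q \<le> n"]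
      tau_poly_t[of n z "psum (a # b # L)"] by blast
  have prod: "(\<lambda>\<sigma>. poly (q \<sigma>) t) \<otimes>\<^bsub>CS n\<^esub> (\<lambda>\<sigma>. poly (r \<sigma>) t) \<in> V" for t
  proof -
    define X where "X = tau n z (psum (a # b # L)) t \<otimes>\<^bsub>CS n\<^esub> tau n z (psum L) t"
    let ?T = "\<lambda>M. tau n z (psum M) t" and ?D = "\<lambda>M. dtau n z (psum M) t"
    have "scl (a - b) X = scl a (?T (b # L) \<otimes>\<^bsub>CS n\<^esub> ?T (a # L)) - scl b (?T (a # L) \<otimes>\<^bsub>CS n\<^esub> ?T (b # L)) +
        scl (a * b) ((?D (b # L) \<otimes>\<^bsub>CS n\<^esub> ?T (a # L)) - (?D (a # L) \<otimes>\<^bsub>CS n\<^esub> ?T (b # L)))"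
      unfolding X_def fun_eq_iff scl_def plus_fun_def fun_diff_def
      using tau_differential[OF ab L] by blast
    also have "\<dots> \<in> V"
      by (intro fvs.subspace_add fvs.subspace_diff fvs.subspace_scale V mult T dtau_mem)
    finally have "X \<in> V"
      using subspace_scaleD[OF V, of "a - b" X] ab by simp
    moreover have "?T M = (\<lambda>\<sigma>. ?T M \<sigma>)" for M
      by simp
    ultimately show ?thesis
      by (simp add: X_def q(1)[symmetric] r(1)[symmetric])
  qed
  have supp: "q \<sigma> = 0" if "\<not> \<sigma> permutes {1..n}" for \<sigma>
  proof -
    have "poly (q \<sigma>) t = poly 0 t" for t
      using q(1)[of t \<sigma>] tau_0[OF that] by simp
    then show ?thesis
      by (simp add: poly_all_0_iff_0[symmetric])
  qed
  show ?thesis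
    by (rule polynomial_curve_values[OF V q(1,2) right_monic_division[OF V mult q(2) r(2,3) supp r(4) prod]])
qed

text \<open>Induction on the number of letters. The step requires its two letters to be distinct; a
  repeated letter is reached by interpolation in the second one.\<close>

lemma letters_nonzero:
  "0 \<notin> set L \<Longrightarrow> tau n z (psum L) t \<in> V"
proof (induction "length L" arbitrary: L t rule: less_induct)
  case less
  consider "L = []" | a where "L = [a]" | a b M where "L = a # b # M"
    by (metis list.exhaust)
  then show ?case
  proof cases
    case 1
    \<comment> \<open>The powers \<open>0 ^ k\<close> with k \<ge> 1 vanish, so the letter 0
      represents the empty alphabet.\<close>
    then have "tau n z (psum L) t = tau n z (psum [0]) t"
      by (intro tau_cong) (simp add: psum_def)
    then show ?thesis
      by (simp add: one_letter)
  next
    case 2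
    then show ?thesis
      by (simp add: one_letter)
  next
    case 3
    with less.prems have nz: "a \<noteq> 0" "b \<noteq> 0" "0 \<notin> set M"
      by auto
    have step: "tau n z (psum (a # c # M)) t \<in> V" if "c \<noteq> 0" "c \<noteq> a" for c
      by (rule two_letter_step) (use that nz less.hyps 3 in auto)
    \<comment> \<open>The sample letters \<open>2 * a * 2 ^ i\<close> differ from 0 and from a,
      whatever b is.\<close>
    have "tau n z ((\<lambda>s k. psum (a # s # M) k) b) t \<in> V"
    proof (rule tau_curve[where ?s0.0 = "2 * a" and s = b and p = "\<lambda>s k. psum (a # s # M) k"])
      show "\<exists>q. \<forall>s. psum (a # s # M) k = poly q s" for k
        by (rule exI[of _ "[:psum M k - a ^ k:] - monom 1 k"]) (simp add: psum_Cons poly_monom)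
      fix i :: nat
      have "norm ((2::complex) * 2 ^ i) \<ge> 2"
        by (simp add: norm_mult norm_power)
      then have "(2::complex) * 2 ^ i \<noteq> 1"
        using norm_one[where ?'a = complex] by fastforce
      then have "2 * a * 2 ^ i \<noteq> a"
        using nz(1) by (metis mult.assoc mult.commute mult_cancel_left2)
      then show "tau n z (psum (a # (2 * a * 2 ^ i) # M)) t \<in> V"
        using nz by (intro step) auto
    qed (use nz in simp)
    then show ?thesis
      by (simp add: 3)
  qed
qed

lemma letters: "tau n z (psum L) t \<in> V"
proof -
  have "psum L k = psum (filter (\<lambda>s. s \<noteq> 0) L) k" if "k \<ge> 1" for k
    using that by (induction L) (auto simp: psum_def)
  then have "tau n z (psum L) t = tau n z (psum (filter (\<lambda>s. s \<noteq> 0) L)) t"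
    by (intro tau_cong) auto
  then show ?thesis
    by (simp add: letters_nonzero)
qed

text \<open>Allowing an arbitrary extra alphabet makes the property survive successive changes of
  p.\<close>

definition good :: "(nat \<Rightarrow> complex) \<Rightarrow> bool" where
  "good p \<longleftrightarrow> (\<forall>L t. tau n z (\<lambda>k. p k + psum L k) t \<in> V)"

lemma good_cong:
  assumes "\<And>k. 1 \<le> k \<Longrightarrow> k \<le> n \<Longrightarrow> p k = r k"
  shows "good p \<longleftrightarrow> good r"
  unfolding good_def using tau_cong[of n "\<lambda>k. p k + psum L k" "\<lambda>k. r k + psum L k" for L] assms by metis

text \<open>For a negative integer c the change amounts to adding -c copies of the letter s to the
  alphabet. The sums are polynomial in c, so the samples c = \<open>- (2 ^ i)\<close> determine all
  c.\<close>

lemma good_add_powers: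
  assumes "good p"
  shows "good (\<lambda>k. p k + c * s ^ k)"
  unfolding good_def
proof (intro allI)
  fix L t
  have "tau n z ((\<lambda>c k. p k + c * s ^ k + psum L k) c) t \<in> V"
  proof (rule tau_curve[where ?s0.0 = "-1" and s = c and p = "\<lambda>c k. p k + c * s ^ k + psum L k"])
    show "\<exists>q. \<forall>c. p k + c * s ^ k + psum L k = poly q c" for k
      by (rule exI[of _ "[:p k + psum L k, s ^ k:]"]) simp
    fix i :: nat
    have rep: "psum (replicate m s @ L) k = psum L k - of_nat m * s ^ k" for m k
      by (induction m) (simp_all add: psum_Cons algebra_simps)
    have "tau n z (\<lambda>k. p k + psum (replicate (2 ^ i) s @ L) k) t \<in> V"
      using assms by (simp add: good_def)
    moreover have "(\<lambda>k. p k + psum (replicate (2 ^ i) s @ L) k) = (\<lambda>k. p k + - 1 * 2 ^ i * s ^ k + psum L k)"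
      by (simp add: fun_eq_iff rep)
    ultimately show "tau n z (\<lambda>k. p k + - 1 * 2 ^ i * s ^ k + psum L k) t \<in> V"
      by (simp only:)
  qed simp
  then show "tau n z (\<lambda>k. p k + c * s ^ k + psum L k) t \<in> V"
    by simp
qed

text \<open>H consists of the directions in which a good p may be moved by any amount. It is a
  subspace containing all truncated geometric sequences, hence every unit vector up to n, so p can
  be built up from 0.\<close>

lemma tau_mem: "tau n z p t \<in> V"
proof -
  define H where "H = {d. \<forall>p c. good p \<longrightarrow> good (\<lambda>k. p k + c * d k)}"
  have H: "fvs.subspace H"
  proof (rule fvs.subspaceI)
    show "0 \<in> H"
      by (simp add: H_def)
    fix d e assume *: "d \<in> H" "e \<in> H"
    show "d + e \<in> H"
      unfolding H_def
    proof (intro CollectI allI impI)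
      fix p c assume "good p"
      with * have "good (\<lambda>k. (p k + c * d k) + c * e k)"
        by (auto simp: H_def)
      then show "good (\<lambda>k. p k + c * (d + e) k)"
        by (simp add: algebra_simps)
    qed
  next
    fix d b assume *: "d \<in> H"
    show "scl b d \<in> H"
      unfolding H_def
    proof (intro CollectI allI impI)
      fix p c assume "good p"
      with * have "good (\<lambda>k. p k + (c * b) * d k)"
        by (auto simp: H_def)
      then show "good (\<lambda>k. p k + c * scl b d k)"
        by (simp add: scl_def mult.assoc)
    qed
  qed
  \<comment> \<open>Cutting off beyond n does not affect goodness and makes the sequence a finite
    combination of unit vectors.\<close>
  have trunc: "(\<lambda>k. if k \<le> n then s ^ k else 0) \<in> H" for s
    unfolding H_def
  proof (intro CollectI allI impI)
    fix p c assume "good p"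
    then show "good (\<lambda>k. p k + c * (if k \<le> n then s ^ k else 0))"
      using good_cong[of "\<lambda>k. p k + c * s ^ k" "\<lambda>k. p k + c * (if k \<le> n then s ^ k else 0)"]
        good_add_powers by auto
  qed
  \<comment> \<open>The truncated sequence of the letter \<open>2 ^ i\<close> is the combination of
    the unit vectors with coefficients \<open>(2 ^ j) ^ i\<close>.\<close>
  have "\<forall>j\<in>{..n}. bvec j \<in> H"
  proof (rule subspace_exponential_sum[OF H, where r = "\<lambda>j. 2 ^ j"])
    show "inj_on (\<lambda>j. 2 ^ j :: complex) {..n}"
      by (rule inj_on_subset[OF inj_two_power]) simp
    fix i :: nat
    have "((2::complex) ^ j) ^ i = (2 ^ i) ^ j" for j
      by (simp only: power_mult[symmetric] mult.commute)
    then have "(\<Sum>j\<le>n. scl ((2 ^ j) ^ i) (bvec j)) = (\<lambda>k. if k \<le> n then (2 ^ i) ^ k else 0)"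
      by (auto simp: fun_eq_iff sum_fun_apply scl_def bvec_def if_distrib cong: if_cong)
    then show "(\<Sum>j\<le>n. scl ((2 ^ j) ^ i) (bvec j)) \<in> H"
      using trunc by simp
  qed simp
  then have "(\<Sum>j\<le>n. scl (p j) (bvec j)) \<in> H"
    by (intro fvs.subspace_sum fvs.subspace_scale H) auto
  moreover have "good (\<lambda>_. 0)"
    using letters by (simp add: good_def)
  ultimately have "good (\<lambda>k. 0 + 1 * (\<Sum>j\<le>n. scl (p j) (bvec j)) k)"
    unfolding H_def by blast
  then have "tau n z (\<lambda>k. 0 + 1 * (\<Sum>j\<le>n. scl (p j) (bvec j)) k + psum [] k) t \<in> V"
    unfolding good_def by blast
  moreover have "tau n z (\<lambda>k. 0 + 1 * (\<Sum>j\<le>n. scl (p j) (bvec j)) k + psum [] k) t = tau n z p t"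
    by (rule tau_cong) (simp add: psum_def sum_fun_apply scl_def bvec_def if_distrib cong: if_cong)
  ultimately show ?thesis
    by simp
qed

end

text \<open>In the factor \<open>p 1 + (z x + t)\<close> of every fixed point one summand is chosen.
  The points where \<open>p 1\<close> is taken, together with the moved points, form X; this is the
  shape of the sums in \<open>beta\<close>.\<close>

lemma tau_expand:
  "tau n z p t = (\<Sum>X\<in>Pow {1..n}. \<Sum>\<sigma> | \<sigma> permutes X.
     scl ((\<Prod>c\<in>orbs \<sigma> X. p (card c)) * (\<Prod>i\<in>{1..n} - X. z i + t)) (bvec \<sigma>))"
proof
  fix \<sigma>
  let ?N = "{1..n}"
  let ?term = "\<lambda>X. (\<Prod>c\<in>orbs \<sigma> X. p (card c)) * (\<Prod>i\<in>?N - X. z i + t)"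
  have finP: "finite {\<sigma>. \<sigma> permutes X}" if "X \<subseteq> ?N" for X
    using that finite_subset by (blast intro: finite_permutations)
  have "(\<Sum>X\<in>Pow ?N. \<Sum>\<tau> | \<tau> permutes X.
      scl ((\<Prod>c\<in>orbs \<tau> X. p (card c)) * (\<Prod>i\<in>?N - X. z i + t)) (bvec \<tau>)) \<sigma> =
      (\<Sum>X\<in>Pow ?N. \<Sum>\<tau> | \<tau> permutes X. if \<sigma> = \<tau> then ?term X else 0)"
    unfolding sum_fun_apply by (intro sum.cong refl) (auto simp: scl_def bvec_def)
  also have "\<dots> = (\<Sum>X\<in>Pow ?N. if \<sigma> permutes X then ?term X else 0)"
    by (intro sum.cong refl) (simp add: sum.delta' finP)
  also have "\<dots> = tau n z p t \<sigma>"
  proof (cases "\<sigma> permutes ?N")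
    case False
    then have "\<not> \<sigma> permutes X" if "X \<in> Pow ?N" for X
      using that permutes_subset by blast
    then show ?thesis
      using False by (simp add: tau_0)
  next
    case True
    define M where "M = {x \<in> ?N. \<sigma> x \<noteq> x}"
    define F where "F = {x \<in> ?N. \<sigma> x = x}"
    define A where "A = (\<Prod>c\<in>orbs \<sigma> M. p (card c))"
    have N: "?N = M \<union> F" "M \<inter> F = {}" and finMF: "finite M" "finite F"
      by (auto simp: M_def F_def)
    have F_fix: "\<sigma> x = x" if "x \<in> F" for x
      using that by (simp add: F_def)
    have split: "orbs \<sigma> (M \<union> Y) = orbs \<sigma> M \<union> (\<lambda>x. {x}) ` Y" if "Y \<subseteq> F" for Y
      using fixed_orbs[of Y \<sigma>] that F_fix by (auto simp: orbs_def image_Un)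
    have Mcard: "card c \<noteq> 1" if "c \<in> orbs \<sigma> M" for c
    proof -
      from that obtain x where x: "x \<in> M" "c = orbit \<sigma> x"
        by (auto simp: orbs_def)
      then show ?thesis
        using permutes_self_in_orbit[OF True, of x] orbit_eq_singleton_iff[of \<sigma> x]
        by (auto simp: card_1_singleton_iff M_def)
    qed
    have dis: "orbs \<sigma> M \<inter> (\<lambda>x. {x}) ` Y = {}" for Y
      using Mcard by fastforce
    have prod_split: "(\<Prod>c\<in>orbs \<sigma> (M \<union> Y). g c) = (\<Prod>c\<in>orbs \<sigma> M. g c) * (\<Prod>x\<in>Y. g {x})"
      if "Y \<subseteq> F" for g :: "nat set \<Rightarrow> complex" and Y
    proof -
      have "finite Y"
        using that finMF finite_subset by blast
      then show ?thesis
        unfolding split[OF that] using dis finMF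
        by (subst prod.union_disjoint) (auto simp: prod.reindex)
    qed
    have perm: "\<sigma> permutes X \<longleftrightarrow> M \<subseteq> X" if "X \<subseteq> ?N" for X
    proof
      assume "\<sigma> permutes X"
      then show "M \<subseteq> X"
        by (auto simp: M_def permutes_def)
    next
      assume "M \<subseteq> X"
      then show "\<sigma> permutes X"
        using True by (intro permutes_superset[OF True]) (auto simp: M_def)
    qed
    have "tau n z p t \<sigma> = (\<Prod>c\<in>orbs \<sigma> (M \<union> F). p (card c) + fixw (\<lambda>i. z i + t) c)"
      using True by (simp add: tau_def cyc_weight_def N(1)[symmetric])
    also have "\<dots> = A * (\<Prod>x\<in>F. p 1 + (z x + t))"
      unfolding prod_split[OF order_refl] A_def using Mcard
      by (intro arg_cong2[where f = "(*)"] prod.cong refl) (auto simp: fixw_def)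
    also have "(\<Prod>x\<in>F. p 1 + (z x + t)) = (\<Sum>Y\<in>Pow F. (\<Prod>x\<in>Y. p 1) * (\<Prod>x\<in>F - Y. z x + t))"
      by (rule prod_add[OF finMF(2)])
    also have "A * \<dots> = (\<Sum>Y\<in>Pow F. ?term (M \<union> Y))"
      unfolding sum_distrib_left
    proof (rule sum.cong[OF refl])
      fix Y assume "Y \<in> Pow F"
      then have Y: "Y \<subseteq> F" by simp
      have "?N - (M \<union> Y) = F - Y"
        using N by auto
      then show "A * ((\<Prod>x\<in>Y. p 1) * (\<Prod>x\<in>F - Y. z x + t)) = ?term (M \<union> Y)"
        unfolding prod_split[OF Y] by (simp add: A_def)
    qed
    also have "\<dots> = (\<Sum>X\<in>{X \<in> Pow ?N. M \<subseteq> X}. ?term X)"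
      by (rule sum.reindex_bij_witness[where i = "\<lambda>X. X - M" and j = "\<lambda>Y. M \<union> Y"])
        (use N in auto)
    also have "\<dots> = (\<Sum>X\<in>Pow ?N. if \<sigma> permutes X then ?term X else 0)"
      by (subst sum.inter_filter) (auto intro!: sum.cong simp: perm)
    finally show ?thesis ..
  qed
  finally show "tau n z p t \<sigma> = (\<Sum>X\<in>Pow ?N. \<Sum>\<tau> | \<tau> permutes X.
      scl ((\<Prod>c\<in>orbs \<tau> X. p (card c)) * (\<Prod>i\<in>?N - X. z i + t)) (bvec \<tau>)) \<sigma>" ..
qed

section \<open>Class functions\<close>

definition cycle_type :: "'a set \<Rightarrow> ('a \<Rightarrow> 'a) \<Rightarrow> nat multiset" where
  "cycle_type X \<sigma> = image_mset card (mset_set (orbs \<sigma> X))"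

lemma ex_inj_primes: "\<exists>g :: nat \<Rightarrow> nat. inj g \<and> (\<forall>k. Factorial_Ring.prime (g k))"
proof -
  obtain g :: "nat \<Rightarrow> nat" where "inj g" "range g \<subseteq> {p. Factorial_Ring.prime p}"
    using infinite_countable_subset[OF primes_infinite] by blast
  then show ?thesis
    by (intro exI[of _ g]) blast
qed

context one_letter_subalgebra
begin

text \<open>Putting the \<open>i\<close>-th power of the \<open>k\<close>-th prime for the \<open>k\<close>-th power sum makes the monomials of different
  cycle types into powers of different numbers.\<close>

lemma class_sum_mem:
  "(\<Sum>X\<in>Pow {1..n}. \<Sum>\<sigma> | \<sigma> permutes X.
     scl (f (cycle_type X \<sigma>) * (\<Prod>i\<in>{1..n} - X. z i + t)) (bvec \<sigma>)) \<in> V"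
proof -
  obtain g :: "nat \<Rightarrow> nat" where g: "inj g" "\<And>k. Factorial_Ring.prime (g k)"
    using ex_inj_primes by blast
  define P where "P = (SIGMA X:Pow {1..n}. {\<sigma>. \<sigma> permutes X})"
  define y :: "nat set \<times> (nat \<Rightarrow> nat) \<Rightarrow> (nat \<Rightarrow> nat) \<Rightarrow> complex" where "y = (\<lambda>(X, \<sigma>). scl (\<Prod>i\<in>{1..n} - X. z i + t) (bvec \<sigma>))"
  define ct :: "nat set \<times> (nat \<Rightarrow> nat) \<Rightarrow> nat multiset" where "ct = (\<lambda>(X, \<sigma>). cycle_type X \<sigma>)"
  define r where "r = (\<lambda>m. of_nat (prod_mset (image_mset g m)) :: complex)"
  define x where "x = (\<lambda>m. \<Sum>q\<in>{q \<in> P. ct q = m}. y q)"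
  have finPerm: "finite {\<sigma>. \<sigma> permutes X}" if "X \<in> Pow {1..n}" for X
    using that finite_subset by (blast intro: finite_permutations)
  have finP: "finite P"
    unfolding P_def by (intro finite_SigmaI finPerm) auto
  have group: "(\<Sum>X\<in>Pow {1..n}. \<Sum>\<sigma> | \<sigma> permutes X. scl (h (cycle_type X \<sigma>) * (\<Prod>i\<in>{1..n} - X. z i + t)) (bvec \<sigma>)) =
      (\<Sum>m\<in>ct ` P. scl (h m) (x m))" for h
  proof -
    have "(\<Sum>X\<in>Pow {1..n}. \<Sum>\<sigma> | \<sigma> permutes X. scl (h (cycle_type X \<sigma>) * (\<Prod>i\<in>{1..n} - X. z i + t)) (bvec \<sigma>)) =
        (\<Sum>q\<in>P. scl (h (ct q)) (y q))"
      unfolding P_def by (subst sum.Sigma) (auto simp: finPerm ct_def y_def intro!: sum.cong)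
    also have "\<dots> = (\<Sum>m\<in>ct ` P. \<Sum>q\<in>{q \<in> P. ct q = m}. scl (h (ct q)) (y q))"
      by (rule sum.image_gen[OF finP])
    also have "\<dots> = (\<Sum>m\<in>ct ` P. scl (h m) (x m))"
      unfolding x_def fvs.scale_sum_right by (intro sum.cong refl) auto
    finally show ?thesis .
  qed
  \<comment> \<open>Unique factorization: the prime factors with multiplicity recover the multiset
    of cycle lengths.\<close>
  have inj_r: "inj_on r (ct ` P)"
  proof (rule inj_onI)
    fix m m' assume "r m = r m'"
    then have "prod_mset (image_mset g m) = prod_mset (image_mset g m')"
      by (simp add: r_def)
    then have "prime_factorization (prod_mset (image_mset g m)) = prime_factorization (prod_mset (image_mset g m'))"
      by simp
    moreover have "prime_factorization (prod_mset (image_mset g m)) = image_mset g m" for m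
      by (rule prime_factorization_prod_mset_primes) (use g(2) in auto)
    ultimately have "image_mset g m = image_mset g m'"
      by simp
    then show "m = m'"
      by (rule injD[OF multiset.inj_map[OF g(1)]])
  qed
  have "\<forall>m\<in>ct ` P. x m \<in> V"
  proof (rule subspace_exponential_sum[OF V _ inj_r])
    fix i :: nat
    have "r (cycle_type X \<sigma>) = of_nat (\<Prod>c\<in>orbs \<sigma> X. g (card c))" for X and \<sigma> :: "nat \<Rightarrow> nat"
      unfolding r_def cycle_type_def prod_unfold_prod_mset
      by (simp add: image_mset.compositionality o_def)
    then have "(\<Prod>c\<in>orbs \<sigma> X. of_nat (g (card c)) ^ i) = r (cycle_type X \<sigma>) ^ i" for X and \<sigma> :: "nat \<Rightarrow> nat"
      by (simp add: prod_power_distrib)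
    then have "(\<Sum>m\<in>ct ` P. scl (r m ^ i) (x m)) = tau n z (\<lambda>k. of_nat (g k) ^ i) t"
      unfolding tau_expand group[symmetric]
      by (intro sum.cong refl) simp
    then show "(\<Sum>m\<in>ct ` P. scl (r m ^ i) (x m)) \<in> V"
      using tau_mem by simp
  qed (use finP in simp)
  then show ?thesis
    unfolding group by (intro fvs.subspace_sum fvs.subspace_scale V) auto
qed

end

section \<open>Cycle types and conjugacy\<close>

lemma sum_mset_cycle_type:
  assumes "\<sigma> permutes X" "finite X"
  shows "sum_mset (cycle_type X \<sigma>) = card X"
  using sum_card_orbs[OF assms] by (simp add: cycle_type_def sum_unfold_sum_mset)

text \<open>Serves to match the cycles of two permutations of the same cycle type by length.\<close>

lemma bij_betw_of_image_mset_eq: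
  assumes "finite A" "finite B" "image_mset f (mset_set A) = image_mset g (mset_set B)"
  shows "\<exists>h. bij_betw h A B \<and> (\<forall>a\<in>A. g (h a) = f a)"
  using assms
proof (induction A arbitrary: B rule: finite_induct)
  case empty
  then have "B = {}"
    by (metis image_mset_empty image_mset_is_empty_iff mset_set.empty mset_set_empty_iff)
  then show ?case
    by (auto simp: bij_betw_def)
next
  case (insert a A)
  then have "f a \<in># image_mset g (mset_set B)"
    by (metis finite.insertI finite_set_mset_mset_set image_eqI insertI1 set_image_mset)
  then obtain b where b: "b \<in> B" "g b = f a"
    using insert.prems(1) by auto
  have "image_mset g (mset_set B) = add_mset (g b) (image_mset g (mset_set (B - {b})))"
    using b(1) insert.prems(1) by (simp add: mset_set.remove)
  then have "image_mset f (mset_set A) = image_mset g (mset_set (B - {b}))"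
    using insert.prems(2) insert.hyps b(2) by simp
  from insert.IH[OF _ this] insert.prems(1) obtain h
    where h: "bij_betw h A (B - {b})" "\<forall>a\<in>A. g (h a) = f a"
    by auto
  define h' where "h' = h(a := b)"
  have "bij_betw h' A (B - {b})"
    using h(1) insert.hyps(2) by (subst bij_betw_cong[of A h' h]) (auto simp: h'_def)
  moreover have "bij_betw h' {a} {b}"
    by (simp add: h'_def bij_betw_def)
  ultimately have "bij_betw h' (A \<union> {a}) (B - {b} \<union> {b})"
    by (rule bij_betw_combine) auto
  moreover have "A \<union> {a} = insert a A" "B - {b} \<union> {b} = B"
    using b(1) by auto
  moreover have "\<forall>a'\<in>insert a A. g (h' a') = f a'"
    using h(2) b(2) insert.hyps(2) by (auto simp: h'_def)
  ultimately show ?case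
    by auto
qed

text \<open>The bijection sends \<open>(\<sigma> ^^ j) x\<close> to \<open>(\<tau> ^^ j) y\<close>;
  equal lengths make it compatible with the last step of the cycle.\<close>

lemma orbit_conjugation:
  assumes \<sigma>: "\<sigma> permutes X" "finite X" and \<tau>: "\<tau> permutes Y" "finite Y"
    and card: "card (orbit \<sigma> x) = card (orbit \<tau> y)"
  shows "\<exists>h. bij_betw h (orbit \<sigma> x) (orbit \<tau> y) \<and> (\<forall>v\<in>orbit \<sigma> x. h (\<sigma> v) = \<tau> (h v))"
proof -
  define m where "m = card (orbit \<sigma> x)"
  note e1 = orbit_enum[OF \<sigma>, of x, folded m_def]
  note e2 = orbit_enum[OF \<tau>, of y, folded card, folded m_def]
  let ?s = "\<lambda>j. (\<sigma> ^^ j) x" and ?t = "\<lambda>j. (\<tau> ^^ j) y"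
  define h where "h = ?t \<circ> inv_into {..<m} ?s"
  have h: "h (?s j) = ?t j" if "j < m" for j
    using inv_into_f_f[OF e1(4), of j] that by (simp add: h_def)
  have "bij_betw (inv_into {..<m} ?s) (orbit \<sigma> x) {..<m}"
    unfolding e1(3) by (intro bij_betw_inv_into) (use e1(4) in \<open>auto simp: bij_betw_def\<close>)
  moreover have "bij_betw ?t {..<m} (orbit \<tau> y)"
    using e2 by (simp add: bij_betw_def)
  ultimately have "bij_betw h (orbit \<sigma> x) (orbit \<tau> y)"
    unfolding h_def by (rule bij_betw_trans)
  moreover have "h (\<sigma> v) = \<tau> (h v)" if "v \<in> orbit \<sigma> x" for v
  proof -
    from that e1(3) obtain j where j: "j < m" "v = ?s j"
      by auto
    show ?thesis
    proof (cases "Suc j < m")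
      case True
      then show ?thesis
        using h[OF True] h[OF j(1)] j(2) by simp
    next
      case False
      then have "Suc j = m"
        using j(1) by simp
      then have "\<sigma> v = ?s 0" "\<tau> (?t j) = ?t 0"
        using e1(2) e2(2) j(2) by (metis funpow.simps(2) funpow_0 o_apply)+
      then show ?thesis
        using h[OF j(1)] h[OF e1(1)] j(2) by simp
    qed
  qed
  ultimately show ?thesis
    by blast
qed

text \<open>Cycles are matched by length, conjugated one by one, and the bijections are glued with
  the identity off N.\<close>

lemma cycle_type_eq_imp_conj:
  assumes \<sigma>: "\<sigma> permutes N" and \<tau>: "\<tau> permutes N" and fin: "finite N"
    and eq: "cycle_type N \<sigma> = cycle_type N \<tau>"
  obtains g where "g permutes N" "\<tau> = g \<circ> \<sigma> \<circ> inv g"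
proof -
  obtain \<phi> where \<phi>: "bij_betw \<phi> (orbs \<sigma> N) (orbs \<tau> N)" "\<And>c. c \<in> orbs \<sigma> N \<Longrightarrow> card (\<phi> c) = card c"
    using bij_betw_of_image_mset_eq[OF _ _ eq[unfolded cycle_type_def]] fin by auto
  have "\<exists>h. bij_betw h c (\<phi> c) \<and> (\<forall>v\<in>c. h (\<sigma> v) = \<tau> (h v))" if c: "c \<in> orbs \<sigma> N" for c
  proof -
    have "\<phi> c \<in> orbs \<tau> N"
      using \<phi>(1) c by (auto simp: bij_betw_def)
    then obtain x y where "c = orbit \<sigma> x" "\<phi> c = orbit \<tau> y"
      using c by (auto simp: orbs_def)
    then show ?thesis
      using orbit_conjugation[OF \<sigma> fin \<tau> fin, of x y] \<phi>(2)[OF c] by simp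
  qed
  then obtain h where h: "\<And>c. c \<in> orbs \<sigma> N \<Longrightarrow> bij_betw (h c) c (\<phi> c)"
      "\<And>c v. c \<in> orbs \<sigma> N \<Longrightarrow> v \<in> c \<Longrightarrow> h c (\<sigma> v) = \<tau> (h c v)"
    by metis
  define g where "g = (\<lambda>v. if v \<in> N then h (orbit \<sigma> v) v else v)"
  have g_h: "g v = h c v" if "c \<in> orbs \<sigma> N" "v \<in> c" for c v
    using orbs_eq_orbit[OF \<sigma> fin that] orbs_subset[OF \<sigma> that(1)] that(2) by (auto simp: g_def)
  have "bij_betw g (\<Union>c\<in>orbs \<sigma> N. c) (\<Union>c\<in>orbs \<sigma> N. \<phi> c)"
  proof (rule bij_betw_UNION_disjoint)
    show "disjoint_family_on \<phi> (orbs \<sigma> N)"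
      unfolding disjoint_family_on_def
    proof (intro ballI impI)
      fix c d assume *: "c \<in> orbs \<sigma> N" "d \<in> orbs \<sigma> N" "c \<noteq> d"
      then have "\<phi> c \<noteq> \<phi> d" "\<phi> c \<in> orbs \<tau> N" "\<phi> d \<in> orbs \<tau> N"
        using \<phi>(1) by (auto simp: bij_betw_def inj_on_def)
      then show "\<phi> c \<inter> \<phi> d = {}"
        by (intro orbs_disjoint[OF \<tau> fin])
    qed
    show "bij_betw g c (\<phi> c)" if "c \<in> orbs \<sigma> N" for c
      using h(1)[OF that] g_h[OF that] by (subst bij_betw_cong[of c g "h c"]) auto
  qed
  moreover have "(\<Union>c\<in>orbs \<sigma> N. \<phi> c) = N"
    using \<phi>(1) Union_orbs[OF \<tau> fin] by (auto simp: bij_betw_def)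
  ultimately have "bij_betw g N N"
    using Union_orbs[OF \<sigma> fin] by simp
  then have g: "g permutes N"
    by (rule bij_imp_permutes) (simp add: g_def)
  have "g (\<sigma> v) = \<tau> (g v)" for v
  proof (cases "v \<in> N")
    case True
    let ?c = "orbit \<sigma> v"
    have c: "?c \<in> orbs \<sigma> N" "v \<in> ?c" "\<sigma> v \<in> ?c"
      using orbit_in_orbs[OF True] permutes_self_in_orbit[OF \<sigma> fin] by (auto intro: orbit.base)
    then show ?thesis
      using h(2)[OF c(1,2)] g_h[OF c(1,2)] g_h[OF c(1,3)] by simp
  next
    case False
    then show ?thesis
      using \<sigma> \<tau> by (simp add: g_def permutes_not_in)
  qed
  then have "\<tau> \<circ> g = g \<circ> \<sigma>"
    by (simp add: fun_eq_iff)
  then have "\<tau> \<circ> g \<circ> inv g = g \<circ> \<sigma> \<circ> inv g"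
    by simp
  then have "\<tau> = g \<circ> \<sigma> \<circ> inv g"
    using permutes_inv_o(1)[OF g] by (simp add: o_assoc[symmetric])
  with g that show ?thesis
    by blast
qed

lemma cycle_type_map_permutation:
  assumes "inj_on f A" "\<sigma> permutes A" "finite A"
  shows "cycle_type (f ` A) (map_permutation A f \<sigma>) = cycle_type A \<sigma>"
proof -
  let ?m = "map_permutation A f \<sigma>"
  have sub: "orbit \<sigma> x \<subseteq> A" if "x \<in> A" for x
    using permutes_orbit_subset[OF assms(2) that] .
  have orb: "orbit ?m (f x) = f ` orbit \<sigma> x" if x: "x \<in> A" for x
  proof -
    have "(?m ^^ j) (f x) = f ((\<sigma> ^^ j) x) \<and> (\<sigma> ^^ j) x \<in> A" for j
    proof (induction j)
      case (Suc j)
      then show ?case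
        using map_permutation_apply[OF assms(1), of "(\<sigma> ^^ j) x" \<sigma>] permutes_in_image[OF assms(2)] by simp
    qed (simp add: x)
    then show ?thesis
      unfolding orbit_altdef by auto
  qed
  have "orbs ?m (f ` A) = (`) f ` orbs \<sigma> A"
    unfolding orbs_def image_image using orb by (intro image_cong) auto
  moreover have "inj_on ((`) f) (orbs \<sigma> A)"
    using assms(1) orbs_subset[OF assms(2)] by (auto simp: inj_on_def dest!: inj_on_image_eq_iff[OF assms(1), THEN iffD1, rotated 2])
  ultimately have "cycle_type (f ` A) ?m = image_mset (\<lambda>c. card (f ` c)) (mset_set (orbs \<sigma> A))"
    by (simp add: cycle_type_def image_mset_mset_set[symmetric] image_mset.compositionality o_def)
  also have "\<dots> = cycle_type A \<sigma>"
    unfolding cycle_type_def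
  proof (rule image_mset_cong)
    fix c assume "c \<in># mset_set (orbs \<sigma> A)"
    then have "c \<subseteq> A"
      using orbs_subset[OF assms(2)] assms(3) by simp
    then show "card (f ` c) = card c"
      by (intro card_image inj_on_subset[OF assms(1)])
  qed
  finally show ?thesis .
qed

section \<open>Traces of linear maps\<close>

abbreviation lin :: "(('a \<Rightarrow> complex) \<Rightarrow> 'b \<Rightarrow> complex) \<Rightarrow> bool" where
  "lin \<equiv> module_hom scl scl"

lemma linI:
  assumes "\<And>x y. f (x + y) = f x + f y" "\<And>c x. f (scl c x) = scl c (f x)"
  shows "lin f"
  unfolding module_hom_iff by (intro conjI allI fvs.module_axioms assms)

lemma lin_comp: "lin f \<Longrightarrow> lin g \<Longrightarrow> lin (\<lambda>x. f (g x))"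
  by (rule linI) (simp_all add: module_hom.add module_hom.scale)

text \<open>Matrix times coordinate vector; for the identity map it is the change of
  coordinates.\<close>

lemma representation_lin:
  assumes B: "fvs.independent B" "finite B" and f: "lin f" and v: "v \<in> fvs.span B"
    and B': "fvs.independent B'" and img: "\<And>v. v \<in> fvs.span B \<Longrightarrow> f v \<in> fvs.span B'"
  shows "fvs.representation B' (f v) b' =
    (\<Sum>b\<in>B. fvs.representation B v b * fvs.representation B' (f b) b')"
proof -
  have "f v = f (\<Sum>b\<in>B. scl (fvs.representation B v b) b)"
    using fvs.sum_representation_eq[OF B(1) v B(2)] by simp
  also have "\<dots> = (\<Sum>b\<in>B. scl (fvs.representation B v b) (f b))"
    by (simp add: module_hom.sum[OF f] module_hom.scale[OF f])
  finally have fv: "f v = (\<Sum>b\<in>B. scl (fvs.representation B v b) (f b))" .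
  have mem: "f b \<in> fvs.span B'" if "b \<in> B" for b
    by (rule img[OF fvs.span_base[OF that]])
  have "fvs.representation B' (f v) = (\<lambda>b'. \<Sum>b\<in>B. fvs.representation B' (scl (fvs.representation B v b) (f b)) b')"
    unfolding fv by (rule fvs.representation_sum[OF B' fvs.span_scale[OF mem]])
  then show ?thesis
    by (simp add: fvs.representation_scale[OF B' mem])
qed

text \<open>Both traces equal the same double sum: f from one basis to the other, composed with the
  change of basis in either order.\<close>

lemma trace_basis_independent:
  assumes B: "fvs.independent B" "finite B" and B': "fvs.independent B'" "finite B'"
    and span: "fvs.span B' = fvs.span B"
    and f: "lin f" and img: "\<And>v. v \<in> fvs.span B \<Longrightarrow> f v \<in> fvs.span B"
  shows "(\<Sum>b\<in>B. fvs.representation B (f b) b) = (\<Sum>b\<in>B'. fvs.representation B' (f b) b)"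
proof -
  have id: "lin (\<lambda>v. v)"
    by (rule linI) auto
  have mem: "b \<in> fvs.span B" "c \<in> fvs.span B" if "b \<in> B" "c \<in> B'" for b c
    using that fvs.span_base span by auto
  have "(\<Sum>b\<in>B. fvs.representation B (f b) b) =
      (\<Sum>b\<in>B. \<Sum>c\<in>B'. fvs.representation B' b c * fvs.representation B (f c) b)"
    by (intro sum.cong refl, rule representation_lin[OF B' f _ B(1)]) (use span img fvs.span_base in auto)
  also have "\<dots> = (\<Sum>c\<in>B'. \<Sum>b\<in>B. fvs.representation B (f c) b * fvs.representation B' b c)"
    by (subst sum.swap) (simp add: mult.commute)
  also have "\<dots> = (\<Sum>c\<in>B'. fvs.representation B' (f c) c)"
    by (intro sum.cong refl, rule representation_lin[OF B id _ B'(1), symmetric]) (use span img fvs.span_base in auto)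
  finally show ?thesis .
qed

lemma finite_basis_exists:
  assumes "finite S"
  obtains B where "fvs.independent B" "finite B" "fvs.span B = fvs.span S"
proof -
  obtain B where B: "B \<subseteq> fvs.span S" "fvs.independent B" "fvs.span S \<subseteq> fvs.span B"
    using fvs.maximal_independent_subset by blast
  then have "fvs.span B = fvs.span S"
    using fvs.span_minimal[OF B(1) fvs.subspace_span] by blast
  with B fvs.independent_span_bound[OF assms B(2,1)] that show ?thesis
    by blast
qed

text \<open>Replaces the basis chosen in \<open>trace_on\<close> by any finite one. The chosen basis
  is finite because it is independent inside the span of a finite set.\<close>

lemma trace_on_basis:
  assumes B: "fvs.independent B" "finite B" "fvs.span B = V"
    and f: "lin f" and img: "\<And>v. v \<in> V \<Longrightarrow> f v \<in> V"
  shows "trace_on V f = (\<Sum>b\<in>B. fvs.representation B (f b) b)"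
proof -
  define B' where "B' = (SOME B'. fvs.independent B' \<and> fvs.span B' = V)"
  have B': "fvs.independent B' \<and> fvs.span B' = V"
    unfolding B'_def by (rule someI[of _ B]) (use B in simp)
  have "finite B'"
    using fvs.independent_span_bound[OF B(2), of B'] B' B(3) fvs.span_superset[of B'] by auto
  then show ?thesis
    unfolding trace_on_def B'_def[symmetric] Let_def
    using trace_basis_independent[OF B(1,2) _ _ _ f, of B'] B' B(3) img by auto
qed

lemma trace_on_scale:
  assumes "finite S" and V: "V = fvs.span S" and f: "lin f" and img: "\<And>v. v \<in> V \<Longrightarrow> f v \<in> V"
  shows "trace_on V (\<lambda>v. scl c (f v)) = c * trace_on V f"
proof -
  obtain B where B: "fvs.independent B" "finite B" "fvs.span B = V"
    using finite_basis_exists[OF assms(1)] V by metis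
  have "lin (\<lambda>v. scl c (f v))"
    by (rule linI) (simp_all add: module_hom.add[OF f] module_hom.scale[OF f] fvs.scale_right_distrib mult.commute)
  then have "trace_on V (\<lambda>v. scl c (f v)) = (\<Sum>b\<in>B. fvs.representation B (scl c (f b)) b)"
    using img B(3) fvs.span_scale by (intro trace_on_basis[OF B]) auto
  also have "\<dots> = (\<Sum>b\<in>B. c * fvs.representation B (f b) b)"
  proof (rule sum.cong[OF refl])
    fix b assume "b \<in> B"
    then have "f b \<in> fvs.span B"
      using img B(3) fvs.span_base by blast
    then show "fvs.representation B (scl c (f b)) b = c * fvs.representation B (f b) b"
      by (simp add: fvs.representation_scale[OF B(1)])
  qed
  also have "\<dots> = c * trace_on V f"
    using trace_on_basis[OF B f img] by (simp add: sum_distrib_left)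
  finally show ?thesis .
qed

text \<open>h carries a basis to a basis, and the matrices of f and g agree. All comparisons of
  characters below are instances.\<close>

lemma trace_on_iso:
  assumes fin: "finite S" and V: "V = fvs.span S" and h: "lin h" and inj: "inj_on h V" and W: "h ` V = W"
    and f: "lin f" and g: "lin g" and img: "\<And>v. v \<in> V \<Longrightarrow> f v \<in> V"
    and comm: "\<And>v. v \<in> V \<Longrightarrow> g (h v) = h (f v)"
  shows "trace_on W g = trace_on V f"
proof -
  obtain B where B: "fvs.independent B" "finite B" "fvs.span B = V"
    using finite_basis_exists[OF fin] V by metis
  have BV: "b \<in> V" if "b \<in> B" for b
    using that B(3) fvs.span_base by blast
  have hB: "fvs.independent (h ` B)" "finite (h ` B)" "fvs.span (h ` B) = W"
    using module_hom.independent_injective_image[OF h B(1)] inj B module_hom.span_image[OF h, of B] W by auto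
  have injB: "inj_on h B"
    using inj BV by (auto simp: inj_on_def)
  have rep: "fvs.representation (h ` B) (h v) (h b) = fvs.representation B v b" if v: "v \<in> V" and b: "b \<in> B" for v b
  proof -
    have "fvs.representation (h ` B) (h v) (h b) =
        (\<Sum>c\<in>B. fvs.representation B v c * fvs.representation (h ` B) (h c) (h b))"
      by (rule representation_lin[OF B(1,2) h _ hB(1)]) (use v B(3) hB(3) W in auto)
    also have "\<dots> = (\<Sum>c\<in>B. if c = b then fvs.representation B v c else 0)"
      using injB b by (intro sum.cong refl) (auto simp: fvs.representation_basis[OF hB(1)] inj_on_def)
    finally show ?thesis
      using b B(2) by simp
  qed
  have "trace_on W g = (\<Sum>b\<in>h ` B. fvs.representation (h ` B) (g b) b)"
    by (rule trace_on_basis[OF hB g]) (use W img comm in auto)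
  also have "\<dots> = (\<Sum>b\<in>B. fvs.representation (h ` B) (g (h b)) (h b))"
    by (simp add: sum.reindex[OF injB])
  also have "\<dots> = (\<Sum>b\<in>B. fvs.representation B (f b) b)"
    using BV comm rep img by (intro sum.cong refl) auto
  also have "\<dots> = trace_on V f"
    by (rule trace_on_basis[OF B f img, symmetric])
  finally show ?thesis .
qed

text \<open>The image of a basis is independent and equally large; a basis vector outside its span
  would give a larger independent set.\<close>

lemma injective_endomorphism_surj:
  assumes fin: "finite S" and V: "V = fvs.span S" and g: "lin g" and inj: "inj_on g V" and img: "g ` V \<subseteq> V"
  shows "g ` V = V"
proof -
  obtain B where B: "fvs.independent B" "finite B" "fvs.span B = V"
    using finite_basis_exists[OF fin] V by metis
  have ind: "fvs.independent (g ` B)"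
    using module_hom.independent_injective_image[OF g B(1)] inj B(3) by simp
  have sub: "g ` B \<subseteq> V"
    using img fvs.span_base B(3) by blast
  have card: "card (g ` B) = card B"
    using inj fvs.span_superset[of B] B(3) by (intro card_image inj_on_subset[OF inj]) auto
  have "b \<in> fvs.span (g ` B)" if "b \<in> B" for b
  proof (rule ccontr)
    assume not: "b \<notin> fvs.span (g ` B)"
    then have "fvs.independent (insert b (g ` B))"
      using ind by (rule fvs.independent_insertI)
    moreover have "insert b (g ` B) \<subseteq> fvs.span B"
      using sub that fvs.span_base B(3) by auto
    ultimately have "card (insert b (g ` B)) \<le> card B"
      using fvs.independent_span_bound[OF B(2)] by blast
    moreover have "b \<notin> g ` B"
      using not fvs.span_base by blast
    ultimately show False
      using card B(2) by simp
  qed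
  then have "V \<subseteq> fvs.span (g ` B)"
    using fvs.span_minimal[of B "fvs.span (g ` B)"] B(3) fvs.subspace_span by blast
  also have "\<dots> = g ` V"
    using module_hom.span_image[OF g, of B] B(3) by simp
  finally show ?thesis
    using img by blast
qed

section \<open>Operators on functions of tableaux\<close>

lemma diagram_finite [simp]: "finite (diagram \<mu>)"
proof -
  have "diagram \<mu> = (SIGMA i:{..<length \<mu>}. {..<\<mu> ! i})"
    by (auto simp: diagram_def)
  then show ?thesis
    by simp
qed

lemma row_subset: "row \<mu> i \<subseteq> diagram \<mu>" and column_subset: "column \<mu> i \<subseteq> diagram \<mu>"
  by (auto simp: Defs.row_def Defs.column_def)

lemma finite_tableaux [simp]: "finite (tableaux \<mu>)"
proof -
  have "tableaux \<mu> \<subseteq> (diagram \<mu> \<rightarrow>\<^sub>E {1..sum_list \<mu>})"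
    by (auto simp: tableaux_def PiE_def Pi_def bij_betw_def)
  then show ?thesis
    by (rule finite_subset) (simp add: finite_PiE)
qed

section \<open>The simply transitive action on tableaux and its signs\<close>

definition same_rows :: "nat list \<Rightarrow> tableau \<Rightarrow> tableau \<Rightarrow> bool" where
  "same_rows \<mu> S S' \<longleftrightarrow> (\<forall>i. S ` row \<mu> i = S' ` row \<mu> i)"

definition same_columns :: "nat list \<Rightarrow> tableau \<Rightarrow> tableau \<Rightarrow> bool" where
  "same_columns \<mu> S S' \<longleftrightarrow> (\<forall>j. S ` column \<mu> j = S' ` column \<mu> j)"

lemma act_tableau_image:
  assumes "A \<subseteq> diagram \<mu>"
  shows "act_tableau \<mu> \<pi> S ` A = \<pi> ` S ` A"
  using assms by (force simp: act_tableau_def compose_def)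

lemma act_tableau_mem:
  assumes "\<pi> permutes {1..sum_list \<mu>}" "S \<in> tableaux \<mu>"
  shows "act_tableau \<mu> \<pi> S \<in> tableaux \<mu>"
  using assms bij_betw_compose[of S "diagram \<mu>" "{1..sum_list \<mu>}" \<pi> "{1..sum_list \<mu>}"]
  by (auto simp: tableaux_def act_tableau_def permutes_imp_bij)

lemma act_tableau_comp:
  "act_tableau \<mu> (\<pi> \<circ> \<rho>) S = act_tableau \<mu> \<pi> (act_tableau \<mu> \<rho> S)"
  by (auto simp: act_tableau_def compose_def fun_eq_iff)

lemma act_tableau_id: "S \<in> tableaux \<mu> \<Longrightarrow> act_tableau \<mu> id S = S"
  by (auto simp: act_tableau_def compose_def tableaux_def extensional_def fun_eq_iff)

lemma act_tableau_inv:
  assumes "\<pi> permutes {1..sum_list \<mu>}" "S \<in> tableaux \<mu>"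
  shows "act_tableau \<mu> (inv \<pi>) (act_tableau \<mu> \<pi> S) = S" "act_tableau \<mu> \<pi> (act_tableau \<mu> (inv \<pi>) S) = S"
  using act_tableau_id[OF assms(2)] permutes_inv_o[OF assms(1)]
  by (simp_all add: act_tableau_comp[symmetric])

lemma act_tableau_inj:
  assumes "\<pi> permutes {1..sum_list \<mu>}" "\<rho> permutes {1..sum_list \<mu>}" "S \<in> tableaux \<mu>"
    and eq: "act_tableau \<mu> \<pi> S = act_tableau \<mu> \<rho> S"
  shows "\<pi> = \<rho>"
proof
  fix x
  show "\<pi> x = \<rho> x"
  proof (cases "x \<in> {1..sum_list \<mu>}")
    case True
    then have "x \<in> S ` diagram \<mu>"
      using assms(3) by (simp add: tableaux_def bij_betw_def)
    then obtain c where "c \<in> diagram \<mu>" "S c = x"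
      by blast
    then show ?thesis
      using fun_cong[OF eq, of c] by (simp add: act_tableau_def compose_def)
  next
    case False
    then show ?thesis
      using assms(1,2) by (simp add: permutes_not_in)
  qed
qed

lemma tableaux_transitive:
  assumes "S \<in> tableaux \<mu>" "S' \<in> tableaux \<mu>"
  shows "\<exists>\<pi>. \<pi> permutes {1..sum_list \<mu>} \<and> act_tableau \<mu> \<pi> S = S'"
proof -
  let ?D = "diagram \<mu>" and ?N = "{1..sum_list \<mu>}"
  have b: "bij_betw S ?D ?N" "bij_betw S' ?D ?N" "S' \<in> extensional ?D"
    using assms by (auto simp: tableaux_def)
  define \<pi> where "\<pi> = (\<lambda>x. if x \<in> ?N then S' (inv_into ?D S x) else x)"
  have "bij_betw (S' \<circ> inv_into ?D S) ?N ?N"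
    by (rule bij_betw_trans[OF bij_betw_inv_into[OF b(1)] b(2)])
  then have "bij_betw \<pi> ?N ?N"
    by (subst bij_betw_cong[of ?N \<pi> "S' \<circ> inv_into ?D S"]) (auto simp: \<pi>_def)
  then have "\<pi> permutes ?N"
    by (rule bij_imp_permutes) (auto simp: \<pi>_def)
  moreover have "act_tableau \<mu> \<pi> S = S'"
  proof
    fix c
    show "act_tableau \<mu> \<pi> S c = S' c"
    proof (cases "c \<in> ?D")
      case True
      then have "S c \<in> ?N" "inv_into ?D S (S c) = c"
        using b(1) by (auto simp: bij_betw_def)
      with True show ?thesis
        by (simp add: act_tableau_def compose_def \<pi>_def)
    next
      case False
      then show ?thesis
        using extensional_arb[OF b(3) False] by (simp add: act_tableau_def compose_def)
    qed
  qed
  ultimately show ?thesis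
    by blast
qed

text \<open>Well defined on tableaux because the symmetric group acts on them simply
  transitively.\<close>

definition perm_of :: "nat list \<Rightarrow> tableau \<Rightarrow> tableau \<Rightarrow> nat \<Rightarrow> nat" where
  "perm_of \<mu> S S' = (THE \<pi>. \<pi> permutes {1..sum_list \<mu>} \<and> act_tableau \<mu> \<pi> S = S')"

lemma perm_of:
  assumes "S \<in> tableaux \<mu>" "S' \<in> tableaux \<mu>"
  shows "perm_of \<mu> S S' permutes {1..sum_list \<mu>}" "act_tableau \<mu> (perm_of \<mu> S S') S = S'"
proof -
  have "\<exists>!\<pi>. \<pi> permutes {1..sum_list \<mu>} \<and> act_tableau \<mu> \<pi> S = S'"
    using tableaux_transitive[OF assms] act_tableau_inj[OF _ _ assms(1)] by blast
  from theI'[OF this] show "perm_of \<mu> S S' permutes {1..sum_list \<mu>}" "act_tableau \<mu> (perm_of \<mu> S S') S = S'"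
    by (auto simp: perm_of_def)
qed

lemma perm_of_eqI:
  assumes "S \<in> tableaux \<mu>" "\<pi> permutes {1..sum_list \<mu>}" "act_tableau \<mu> \<pi> S = S'"
  shows "perm_of \<mu> S S' = \<pi>"
  using perm_of[OF assms(1), of S'] act_tableau_mem[OF assms(2,1)] assms
  by (intro act_tableau_inj[OF _ assms(2,1)]) auto

text \<open>The sign relative to an arbitrary reference tableau. Products of two such signs are
  independent of the reference.\<close>

definition tab_sign :: "nat list \<Rightarrow> tableau \<Rightarrow> complex" where
  "tab_sign \<mu> S = of_int (sign (perm_of \<mu> (SOME S0. S0 \<in> tableaux \<mu>) S))"

lemma tab_sign_act:
  assumes "\<pi> permutes {1..sum_list \<mu>}" "S \<in> tableaux \<mu>"
  shows "tab_sign \<mu> (act_tableau \<mu> \<pi> S) = of_int (sign \<pi>) * tab_sign \<mu> S"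
proof -
  define S0 where "S0 = (SOME S0. S0 \<in> tableaux \<mu>)"
  have S0: "S0 \<in> tableaux \<mu>"
    unfolding S0_def using assms(2) by (rule someI[of "\<lambda>S0. S0 \<in> tableaux \<mu>"])
  note p = perm_of[OF S0 assms(2)]
  have "perm_of \<mu> S0 (act_tableau \<mu> \<pi> S) = \<pi> \<circ> perm_of \<mu> S0 S"
    using p assms(1) by (intro perm_of_eqI[OF S0]) (auto intro: permutes_compose simp: act_tableau_comp)
  moreover have "permutation \<pi>" "permutation (perm_of \<mu> S0 S)"
    using assms(1) p(1) by (auto simp: permutation_permutes)
  ultimately show ?thesis
    unfolding tab_sign_def S0_def[symmetric] by (simp add: sign_compose)
qed

lemma tab_sign_sq: "tab_sign \<mu> S * tab_sign \<mu> S = 1"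
  unfolding tab_sign_def by (simp flip: of_int_mult)

lemma tab_sign_sq': "tab_sign \<mu> S * (tab_sign \<mu> S * x) = x"
  by (simp add: tab_sign_sq mult.assoc[symmetric])

lemma cnj_tab_sign [simp]: "cnj (tab_sign \<mu> S) = tab_sign \<mu> S"
  by (simp add: tab_sign_def)

text \<open>By simple transitivity this is a copy of the regular representation, with
  \<open>tab_act\<close> as the action and \<open>row_op\<close>, \<open>col_op\<close> as operators
  commuting with it.\<close>

definition tab_funs :: "nat list \<Rightarrow> (tableau \<Rightarrow> complex) set" where
  "tab_funs \<mu> = {f. \<forall>S. S \<notin> tableaux \<mu> \<longrightarrow> f S = 0}"

definition row_op :: "nat list \<Rightarrow> (tableau \<Rightarrow> complex) \<Rightarrow> tableau \<Rightarrow> complex" where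
  "row_op \<mu> f S = (if S \<in> tableaux \<mu> then \<Sum>S'\<in>{S' \<in> tableaux \<mu>. same_rows \<mu> S S'}. f S' else 0)"

text \<open>The product of the two signs is the sign of the permutation that carries S to
  S'.\<close>

definition col_op :: "nat list \<Rightarrow> (tableau \<Rightarrow> complex) \<Rightarrow> tableau \<Rightarrow> complex" where
  "col_op \<mu> f S = (if S \<in> tableaux \<mu>
     then \<Sum>S'\<in>{S' \<in> tableaux \<mu>. same_columns \<mu> S S'}. tab_sign \<mu> S * tab_sign \<mu> S' * f S' else 0)"

definition tab_act :: "nat list \<Rightarrow> (nat \<Rightarrow> nat) \<Rightarrow> (tableau \<Rightarrow> complex) \<Rightarrow> tableau \<Rightarrow> complex" where
  "tab_act \<mu> \<pi> f S = (if S \<in> tableaux \<mu> then f (act_tableau \<mu> (inv \<pi>) S) else 0)"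

lemma lin_row_op: "lin (row_op \<mu>)"
  by (rule linI) (auto simp: row_op_def fun_eq_iff scl_def sum.distrib sum_distrib_left)

lemma lin_col_op: "lin (col_op \<mu>)"
  by (rule linI) (auto simp: col_op_def fun_eq_iff scl_def sum.distrib sum_distrib_left algebra_simps)

lemma lin_tab_act: "lin (tab_act \<mu> \<pi>)"
  by (rule linI) (auto simp: tab_act_def fun_eq_iff scl_def)

lemma op_tab_funs [simp]:
  "row_op \<mu> f \<in> tab_funs \<mu>" "col_op \<mu> f \<in> tab_funs \<mu>" "tab_act \<mu> \<pi> f \<in> tab_funs \<mu>"
  by (auto simp: tab_funs_def row_op_def col_op_def tab_act_def)

lemma same_rows_act:
  assumes "\<pi> permutes {1..sum_list \<mu>}"
  shows "same_rows \<mu> (act_tableau \<mu> \<pi> S) (act_tableau \<mu> \<pi> S') \<longleftrightarrow> same_rows \<mu> S S'"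
  unfolding same_rows_def act_tableau_image[OF row_subset]
  using inj_image_eq_iff[OF permutes_inj[OF assms]] by simp

lemma same_columns_act:
  assumes "\<pi> permutes {1..sum_list \<mu>}"
  shows "same_columns \<mu> (act_tableau \<mu> \<pi> S) (act_tableau \<mu> \<pi> S') \<longleftrightarrow> same_columns \<mu> S S'"
  unfolding same_columns_def act_tableau_image[OF column_subset]
  using inj_image_eq_iff[OF permutes_inj[OF assms]] by simp

lemma sum_class_act:
  assumes \<pi>: "\<pi> permutes {1..sum_list \<mu>}" and S: "S \<in> tableaux \<mu>"
    and rel: "\<And>S S'. rel (act_tableau \<mu> \<pi> S) (act_tableau \<mu> \<pi> S') \<longleftrightarrow> rel S S'"
  shows "(\<Sum>S'\<in>{S' \<in> tableaux \<mu>. rel (act_tableau \<mu> \<pi> S) S'}. h S') =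
    (\<Sum>S'\<in>{S' \<in> tableaux \<mu>. rel S S'}. h (act_tableau \<mu> \<pi> S'))"
  by (rule sum.reindex_bij_witness[where i = "act_tableau \<mu> \<pi>" and j = "act_tableau \<mu> (inv \<pi>)"])
    (use \<pi> permutes_inv[OF \<pi>] S rel act_tableau_inv[OF \<pi>] act_tableau_mem in \<open>auto, metis+\<close>)

lemma row_op_act:
  assumes "\<pi> permutes {1..sum_list \<mu>}"
  shows "row_op \<mu> (tab_act \<mu> \<pi> f) = tab_act \<mu> \<pi> (row_op \<mu> f)"
proof
  fix S
  note i = permutes_inv[OF assms]
  show "row_op \<mu> (tab_act \<mu> \<pi> f) S = tab_act \<mu> \<pi> (row_op \<mu> f) S"
    using sum_class_act[OF i, of S "same_rows \<mu>" f, OF _ same_rows_act[OF i]] act_tableau_mem[OF i]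
    by (auto simp: row_op_def tab_act_def intro!: sum.cong)
qed

lemma col_op_act:
  assumes "\<pi> permutes {1..sum_list \<mu>}"
  shows "col_op \<mu> (tab_act \<mu> \<pi> f) = tab_act \<mu> \<pi> (col_op \<mu> f)"
proof
  fix S
  note i = permutes_inv[OF assms]
  show "col_op \<mu> (tab_act \<mu> \<pi> f) S = tab_act \<mu> \<pi> (col_op \<mu> f) S"
  proof (cases "S \<in> tableaux \<mu>")
    case True
    have "(of_int (sign (inv \<pi>)) :: complex) * of_int (sign (inv \<pi>)) = 1"
      by (simp flip: of_int_mult)
    then have sgn: "of_int (sign (inv \<pi>)) * x * (of_int (sign (inv \<pi>)) * y) = x * y" for x y :: complex
      by (metis mult.left_commute mult.commute mult_1)
    show ?thesis
      using True act_tableau_mem[OF i]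
        sum_class_act[OF i True, of "same_columns \<mu>", OF same_columns_act[OF i],
          of "\<lambda>S'. tab_sign \<mu> (act_tableau \<mu> (inv \<pi>) S) * tab_sign \<mu> S' * f S'"]
      by (auto simp: col_op_def tab_act_def tab_sign_act[OF i] sgn intro!: sum.cong)
  qed (simp add: col_op_def tab_act_def)
qed

lemma row_op_eq: "S \<in> tableaux \<mu> \<Longrightarrow> row_op \<mu> f S = (\<Sum>S'\<in>tableaux \<mu>. if same_rows \<mu> S S' then f S' else 0)"
  by (simp add: row_op_def sum.inter_filter)

lemma col_op_eq: "S \<in> tableaux \<mu> \<Longrightarrow> col_op \<mu> f S =
    (\<Sum>S'\<in>tableaux \<mu>. if same_columns \<mu> S S' then tab_sign \<mu> S * tab_sign \<mu> S' * f S' else 0)"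
  by (simp add: col_op_def sum.inter_filter)

lemma card_class:
  assumes "S \<in> tableaux \<mu>" "U \<in> tableaux \<mu>"
    and rel: "\<And>\<pi> S S'. \<pi> permutes {1..sum_list \<mu>} \<Longrightarrow>
      rel (act_tableau \<mu> \<pi> S) (act_tableau \<mu> \<pi> S') \<longleftrightarrow> rel S S'"
  shows "card {S' \<in> tableaux \<mu>. rel U S'} = card {S' \<in> tableaux \<mu>. rel S S'}"
proof -
  obtain \<pi> where \<pi>: "\<pi> permutes {1..sum_list \<mu>}" "act_tableau \<mu> \<pi> S = U"
    using tableaux_transitive[OF assms(1,2)] by blast
  from sum_class_act[OF \<pi>(1) assms(1), of rel "\<lambda>_. 1 :: nat", OF rel[OF \<pi>(1)]] show ?thesis
    by (simp add: \<pi>(2))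
qed

text \<open>Having the same rows is an equivalence relation whose classes all have the same size c,
  so the operator is c times a projection.\<close>

lemma row_op_row_op: "\<exists>c. c \<noteq> 0 \<and> (\<forall>f. row_op \<mu> (row_op \<mu> f) = scl c (row_op \<mu> f))"
proof (cases "tableaux \<mu> = {}")
  case True
  then show ?thesis
    by (intro exI[of _ 1]) (simp add: row_op_def fun_eq_iff scl_def)
next
  case False
  then obtain U where U: "U \<in> tableaux \<mu>"
    by blast
  define c where "c = card {S' \<in> tableaux \<mu>. same_rows \<mu> U S'}"
  have "c > 0"
    using U by (auto simp: c_def card_gt_0_iff same_rows_def)
  moreover have "row_op \<mu> (row_op \<mu> f) S = scl (of_nat c) (row_op \<mu> f) S" for f S
  proof (cases "S \<in> tableaux \<mu>")
    case True
    have "row_op \<mu> f S' = row_op \<mu> f S" if "S' \<in> tableaux \<mu>" "same_rows \<mu> S S'" for S'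
    proof -
      have "{S'' \<in> tableaux \<mu>. same_rows \<mu> S' S''} = {S'' \<in> tableaux \<mu>. same_rows \<mu> S S''}"
        using that(2) by (auto simp: same_rows_def)
      then show ?thesis
        using True that by (simp add: row_op_def)
    qed
    then have "row_op \<mu> (row_op \<mu> f) S = (\<Sum>S'\<in>{S' \<in> tableaux \<mu>. same_rows \<mu> S S'}. row_op \<mu> f S)"
      unfolding row_op_def[of \<mu> "row_op \<mu> f"] using True by (auto intro: sum.cong)
    also have "\<dots> = of_nat c * row_op \<mu> f S"
      using card_class[OF U True, of "same_rows \<mu>", OF same_rows_act] by (simp add: c_def)
    finally show ?thesis
      by (simp add: scl_def)
  qed (simp add: row_op_def scl_def)
  ultimately show ?thesis
    by (intro exI[of _ "of_nat c"]) (auto simp: fun_eq_iff)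
qed

text \<open>As for rows; the signs are compatible because \<open>tab_sign\<close> squares to
  1.\<close>

lemma col_op_col_op: "\<exists>c. c \<noteq> 0 \<and> (\<forall>f. col_op \<mu> (col_op \<mu> f) = scl c (col_op \<mu> f))"
proof (cases "tableaux \<mu> = {}")
  case True
  then show ?thesis
    by (intro exI[of _ 1]) (simp add: col_op_def fun_eq_iff scl_def)
next
  case False
  then obtain U where U: "U \<in> tableaux \<mu>"
    by blast
  define c where "c = card {S' \<in> tableaux \<mu>. same_columns \<mu> U S'}"
  have "c > 0"
    using U by (auto simp: c_def card_gt_0_iff same_columns_def)
  moreover have "col_op \<mu> (col_op \<mu> f) S = scl (of_nat c) (col_op \<mu> f) S" for f S
  proof (cases "S \<in> tableaux \<mu>")
    case True
    have "tab_sign \<mu> S * tab_sign \<mu> S' * col_op \<mu> f S' = col_op \<mu> f S"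
      if "S' \<in> tableaux \<mu>" "same_columns \<mu> S S'" for S'
    proof -
      have "{S'' \<in> tableaux \<mu>. same_columns \<mu> S' S''} = {S'' \<in> tableaux \<mu>. same_columns \<mu> S S''}"
        using that(2) by (auto simp: same_columns_def)
      then show ?thesis
        using True that by (simp add: col_op_def sum_distrib_left mult.assoc tab_sign_sq')
    qed
    then have "col_op \<mu> (col_op \<mu> f) S = (\<Sum>S'\<in>{S' \<in> tableaux \<mu>. same_columns \<mu> S S'}. col_op \<mu> f S)"
      unfolding col_op_def[of \<mu> "col_op \<mu> f"] using True by (auto intro: sum.cong)
    also have "\<dots> = of_nat c * col_op \<mu> f S"
      using card_class[OF U True, of "same_columns \<mu>", OF same_columns_act] by (simp add: c_def)
    finally show ?thesis
      by (simp add: scl_def)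
  qed (simp add: col_op_def scl_def)
  ultimately show ?thesis
    by (intro exI[of _ "of_nat c"]) (auto simp: fun_eq_iff)
qed

section \<open>The inner product and the two images\<close>

definition tab_inner :: "nat list \<Rightarrow> (tableau \<Rightarrow> complex) \<Rightarrow> (tableau \<Rightarrow> complex) \<Rightarrow> complex" where
  "tab_inner \<mu> f g = (\<Sum>S\<in>tableaux \<mu>. f S * cnj (g S))"

lemma row_op_self_adjoint: "tab_inner \<mu> (row_op \<mu> f) g = tab_inner \<mu> f (row_op \<mu> g)"
proof -
  have "tab_inner \<mu> (row_op \<mu> f) g =
      (\<Sum>S\<in>tableaux \<mu>. \<Sum>S'\<in>tableaux \<mu>. if same_rows \<mu> S S' then f S' * cnj (g S) else 0)"
    unfolding tab_inner_def
    by (auto simp: row_op_eq sum_distrib_right intro!: sum.cong)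
  also have "\<dots> = (\<Sum>S'\<in>tableaux \<mu>. \<Sum>S\<in>tableaux \<mu>. if same_rows \<mu> S' S then f S' * cnj (g S) else 0)"
    by (subst sum.swap) (intro sum.cong refl, auto simp: same_rows_def)
  also have "\<dots> = tab_inner \<mu> f (row_op \<mu> g)"
    unfolding tab_inner_def
    by (auto simp: row_op_eq sum_distrib_left intro!: sum.cong)
  finally show ?thesis .
qed

lemma col_op_self_adjoint: "tab_inner \<mu> (col_op \<mu> f) g = tab_inner \<mu> f (col_op \<mu> g)"
proof -
  have "tab_inner \<mu> (col_op \<mu> f) g =
      (\<Sum>S\<in>tableaux \<mu>. \<Sum>S'\<in>tableaux \<mu>. if same_columns \<mu> S S' then tab_sign \<mu> S * tab_sign \<mu> S' * f S' * cnj (g S) else 0)"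
    unfolding tab_inner_def
    by (auto simp: col_op_eq sum_distrib_right intro!: sum.cong)
  also have "\<dots> = (\<Sum>S'\<in>tableaux \<mu>. \<Sum>S\<in>tableaux \<mu>. if same_columns \<mu> S' S then tab_sign \<mu> S * tab_sign \<mu> S' * f S' * cnj (g S) else 0)"
    by (subst sum.swap) (intro sum.cong refl, auto simp: same_columns_def)
  also have "\<dots> = tab_inner \<mu> f (col_op \<mu> g)"
    unfolding tab_inner_def
    by (auto simp: col_op_eq sum_distrib_left mult_ac intro!: sum.cong)
  finally show ?thesis .
qed

lemma tab_inner_scl: "tab_inner \<mu> f (scl c g) = cnj c * tab_inner \<mu> f g"
  by (simp add: tab_inner_def scl_def sum_distrib_left mult_ac)

lemma tab_inner_self_zero:
  assumes "f \<in> tab_funs \<mu>" "tab_inner \<mu> f f = 0"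
  shows "f = 0"
proof -
  have "(\<Sum>S\<in>tableaux \<mu>. of_real ((norm (f S))\<^sup>2) :: complex) = 0"
    using assms(2) by (simp only: tab_inner_def complex_norm_square)
  then have "(\<Sum>S\<in>tableaux \<mu>. (norm (f S))\<^sup>2) = 0"
    by (metis of_real_eq_0_iff of_real_sum)
  then have "f S = 0" if "S \<in> tableaux \<mu>" for S
    using that by (subst (asm) sum_nonneg_eq_0_iff) auto
  then show ?thesis
    using assms(1) by (auto simp: tab_funs_def fun_eq_iff)
qed

definition row_col_space :: "nat list \<Rightarrow> (tableau \<Rightarrow> complex) set" where
  "row_col_space \<mu> = (\<lambda>f. row_op \<mu> (col_op \<mu> f)) ` tab_funs \<mu>"

definition col_row_space :: "nat list \<Rightarrow> (tableau \<Rightarrow> complex) set" where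
  "col_row_space \<mu> = (\<lambda>f. col_op \<mu> (row_op \<mu> f)) ` tab_funs \<mu>"

lemma tab_funs_span: "tab_funs \<mu> = fvs.span (bvec ` tableaux \<mu>)"
proof
  show "tab_funs \<mu> \<subseteq> fvs.span (bvec ` tableaux \<mu>)"
  proof
    fix f assume f: "f \<in> tab_funs \<mu>"
    have "f = (\<Sum>S\<in>tableaux \<mu>. scl (f S) (bvec S))"
    proof
      fix x
      show "f x = (\<Sum>S\<in>tableaux \<mu>. scl (f S) (bvec S)) x"
        using f by (auto simp: sum_fun_apply scl_def bvec_def tab_funs_def if_distrib cong: if_cong)
    qed
    also have "\<dots> \<in> fvs.span (bvec ` tableaux \<mu>)"
      by (intro fvs.span_sum fvs.span_scale fvs.span_base) auto
    finally show "f \<in> fvs.span (bvec ` tableaux \<mu>)" .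
  qed
  show "fvs.span (bvec ` tableaux \<mu>) \<subseteq> tab_funs \<mu>"
    by (rule fvs.span_minimal)
      (auto simp: tab_funs_def bvec_def scl_def intro!: fvs.subspaceI)
qed

lemma row_col_space_span: "row_col_space \<mu> = fvs.span ((\<lambda>S. row_op \<mu> (col_op \<mu> (bvec S))) ` tableaux \<mu>)"
  using module_hom.span_image[OF lin_comp[OF lin_row_op lin_col_op], of \<mu> \<mu> "bvec ` tableaux \<mu>"]
  by (simp add: row_col_space_def tab_funs_span image_image)

lemma col_row_space_span: "col_row_space \<mu> = fvs.span ((\<lambda>S. col_op \<mu> (row_op \<mu> (bvec S))) ` tableaux \<mu>)"
  using module_hom.span_image[OF lin_comp[OF lin_col_op lin_row_op], of \<mu> \<mu> "bvec ` tableaux \<mu>"]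
  by (simp add: col_row_space_def tab_funs_span image_image)

text \<open>If \<open>y = r (c x)\<close> and \<open>c y = 0\<close>, then \<open>\<langle>y, y\<rangle> = \<langle>c x, r y\<rangle>\<close> is a multiple of
  \<open>\<langle>c x, y\<rangle> = \<langle>x, c y\<rangle> = 0\<close>.\<close>

lemma col_op_kernel:
  assumes "y \<in> row_col_space \<mu>" "col_op \<mu> y = 0"
  shows "y = 0"
proof -
  obtain x where y: "y = row_op \<mu> (col_op \<mu> x)"
    using assms(1) by (auto simp: row_col_space_def)
  obtain c where c: "\<And>f. row_op \<mu> (row_op \<mu> f) = scl c (row_op \<mu> f)"
    using row_op_row_op by blast
  have "tab_inner \<mu> y y = tab_inner \<mu> (col_op \<mu> x) (row_op \<mu> y)"
    by (simp add: y row_op_self_adjoint)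
  also have "\<dots> = cnj c * tab_inner \<mu> (col_op \<mu> x) y"
    by (simp add: y c tab_inner_scl)
  also have "tab_inner \<mu> (col_op \<mu> x) y = tab_inner \<mu> x (col_op \<mu> y)"
    by (rule col_op_self_adjoint)
  finally show ?thesis
    using assms(2) by (intro tab_inner_self_zero[of _ \<mu>]) (simp_all add: y tab_inner_def)
qed

lemma row_op_kernel:
  assumes "y \<in> col_row_space \<mu>" "row_op \<mu> y = 0"
  shows "y = 0"
proof -
  obtain x where y: "y = col_op \<mu> (row_op \<mu> x)"
    using assms(1) by (auto simp: col_row_space_def)
  obtain c where c: "\<And>f. col_op \<mu> (col_op \<mu> f) = scl c (col_op \<mu> f)"
    using col_op_col_op by blast
  have "tab_inner \<mu> y y = tab_inner \<mu> (row_op \<mu> x) (col_op \<mu> y)"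
    by (simp add: y col_op_self_adjoint)
  also have "\<dots> = cnj c * tab_inner \<mu> (row_op \<mu> x) y"
    by (simp add: y c tab_inner_scl)
  also have "tab_inner \<mu> (row_op \<mu> x) y = tab_inner \<mu> x (row_op \<mu> y)"
    by (rule row_op_self_adjoint)
  finally show ?thesis
    using assms(2) by (intro tab_inner_self_zero[of _ \<mu>]) (simp_all add: y tab_inner_def)
qed

lemma lin_inj_onI:
  assumes "lin h" "fvs.subspace V" "\<And>v. v \<in> V \<Longrightarrow> h v = 0 \<Longrightarrow> v = 0"
  shows "inj_on h V"
proof (rule inj_onI)
  fix x y assume *: "x \<in> V" "y \<in> V" "h x = h y"
  then have "h (x - y) = 0"
    by (simp add: module_hom.diff[OF assms(1)])
  then show "x = y"
    using assms(3)[OF fvs.subspace_diff[OF assms(2) *(1,2)]] by simp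
qed

lemma subspace_row_col_space: "fvs.subspace (row_col_space \<mu>)"
  and subspace_col_row_space: "fvs.subspace (col_row_space \<mu>)"
  by (simp_all add: row_col_space_span col_row_space_span)

text \<open>The composition of \<open>col_op\<close> and \<open>row_op\<close> is injective on
  \<open>row_col_space\<close>, hence onto by dimension. For w in \<open>col_row_space\<close> this
  gives v with \<open>row_op \<mu> w = row_op \<mu> (col_op \<mu> v)\<close>, and injectivity of
  \<open>row_op\<close> yields \<open>w = col_op \<mu> v\<close>.\<close>

lemma col_op_image: "col_op \<mu> ` row_col_space \<mu> = col_row_space \<mu>"
proof -
  let ?g = "\<lambda>f. row_op \<mu> (col_op \<mu> f)"
  have injR: "inj_on (row_op \<mu>) (col_row_space \<mu>)"
    by (rule lin_inj_onI[OF lin_row_op subspace_col_row_space row_op_kernel])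
  have injC: "inj_on (col_op \<mu>) (row_col_space \<mu>)"
    by (rule lin_inj_onI[OF lin_col_op subspace_row_col_space col_op_kernel])
  have colV: "col_op \<mu> v \<in> col_row_space \<mu>" if "v \<in> row_col_space \<mu>" for v
    using that by (auto simp: row_col_space_def col_row_space_def)
  have rowV: "row_op \<mu> v \<in> row_col_space \<mu>" if "v \<in> col_row_space \<mu>" for v
    using that by (auto simp: row_col_space_def col_row_space_def)
  have "?g ` row_col_space \<mu> = row_col_space \<mu>"
  proof (rule injective_endomorphism_surj[OF _ row_col_space_span lin_comp[OF lin_row_op lin_col_op]])
    show "inj_on ?g (row_col_space \<mu>)"
      using injR injC colV by (auto simp: inj_on_def)
    show "?g ` row_col_space \<mu> \<subseteq> row_col_space \<mu>"
      using colV rowV by auto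
  qed simp
  then have surj: "\<exists>v\<in>row_col_space \<mu>. row_op \<mu> w = ?g v" if "w \<in> col_row_space \<mu>" for w
    using rowV[OF that] by blast
  show ?thesis
  proof
    show "col_op \<mu> ` row_col_space \<mu> \<subseteq> col_row_space \<mu>"
      using colV by auto
    show "col_row_space \<mu> \<subseteq> col_op \<mu> ` row_col_space \<mu>"
    proof
      fix w assume w: "w \<in> col_row_space \<mu>"
      with surj obtain v where "v \<in> row_col_space \<mu>" "row_op \<mu> w = row_op \<mu> (col_op \<mu> v)"
        by blast
      with inj_onD[OF injR _ w colV] show "w \<in> col_op \<mu> ` row_col_space \<mu>"
        by blast
    qed
  qed
qed

lemma tab_act_row_col_space:
  assumes "\<pi> permutes {1..sum_list \<mu>}" "v \<in> row_col_space \<mu>"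
  shows "tab_act \<mu> \<pi> v \<in> row_col_space \<mu>"
  using assms(2) by (auto simp: row_col_space_def row_op_act[OF assms(1), symmetric] col_op_act[OF assms(1), symmetric])

lemma tab_act_col_row_space:
  assumes "\<pi> permutes {1..sum_list \<mu>}" "v \<in> col_row_space \<mu>"
  shows "tab_act \<mu> \<pi> v \<in> col_row_space \<mu>"
  using assms(2) by (auto simp: col_row_space_def row_op_act[OF assms(1), symmetric] col_op_act[OF assms(1), symmetric])

lemma trace_row_col_eq_col_row:
  assumes "\<pi> permutes {1..sum_list \<mu>}"
  shows "trace_on (col_row_space \<mu>) (tab_act \<mu> \<pi>) = trace_on (row_col_space \<mu>) (tab_act \<mu> \<pi>)"
proof (rule trace_on_iso[OF _ row_col_space_span lin_col_op _ col_op_image lin_tab_act lin_tab_act])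
  show "inj_on (col_op \<mu>) (row_col_space \<mu>)"
    by (rule lin_inj_onI[OF lin_col_op subspace_row_col_space col_op_kernel])
qed (simp_all add: tab_act_row_col_space[OF assms] col_op_act[OF assms])

section \<open>The Specht module as a space of functions of tableaux\<close>

text \<open>Functions on tabloids viewed as functions of tableaux that are constant on classes with
  the same rows.\<close>

definition pull_tabloid :: "nat list \<Rightarrow> (tableau set \<Rightarrow> complex) \<Rightarrow> tableau \<Rightarrow> complex" where
  "pull_tabloid \<mu> v S = (if S \<in> tableaux \<mu> then v (tabloid \<mu> S) else 0)"

lemma lin_pull_tabloid: "lin (pull_tabloid \<mu>)"
  by (rule linI) (auto simp: pull_tabloid_def fun_eq_iff scl_def)

lemma tabloid_eq_iff:
  assumes "S \<in> tableaux \<mu>" "S' \<in> tableaux \<mu>"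
  shows "tabloid \<mu> S = tabloid \<mu> S' \<longleftrightarrow> same_rows \<mu> S S'"
proof
  have mem: "S'' \<in> tabloid \<mu> W \<longleftrightarrow> S'' \<in> tableaux \<mu> \<and> same_rows \<mu> S'' W" for S'' W
    by (simp add: tabloid_def same_rows_def)
  assume "tabloid \<mu> S = tabloid \<mu> S'"
  moreover have "S \<in> tabloid \<mu> S"
    using assms by (simp add: mem same_rows_def)
  ultimately show "same_rows \<mu> S S'"
    by (simp add: mem)
next
  assume "same_rows \<mu> S S'"
  then show "tabloid \<mu> S = tabloid \<mu> S'"
    by (simp add: tabloid_def same_rows_def)
qed

text \<open>The column group of U, applied to U, runs once through the tableaux with the same
  columns, with the signs of \<open>col_op\<close>. The basis vector of a tabloid becomes the
  indicator of a row class, which \<open>row_op\<close> produces.\<close>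

lemma pull_polytabloid:
  assumes U: "U \<in> tableaux \<mu>"
  shows "pull_tabloid \<mu> (polytabloid \<mu> U) = row_op \<mu> (col_op \<mu> (bvec U))"
proof
  fix S
  show "pull_tabloid \<mu> (polytabloid \<mu> U) S = row_op \<mu> (col_op \<mu> (bvec U)) S"
  proof (cases "S \<in> tableaux \<mu>")
    case True
    let ?CG = "column_group \<mu> U"
    have perm: "\<pi> permutes {1..sum_list \<mu>}" if "\<pi> \<in> ?CG" for \<pi>
      using that by (simp add: column_group_def)
    have CG: "\<pi> \<in> ?CG \<longleftrightarrow> \<pi> permutes {1..sum_list \<mu>} \<and> same_columns \<mu> (act_tableau \<mu> \<pi> U) U" for \<pi>
      by (simp add: column_group_def same_columns_def act_tableau_image[OF column_subset])
    have "pull_tabloid \<mu> (polytabloid \<mu> U) S =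
        (\<Sum>\<pi>\<in>?CG. if same_rows \<mu> S (act_tableau \<mu> \<pi> U) then of_int (sign \<pi>) else 0)"
      using True unfolding pull_tabloid_def polytabloid_def sum_fun_apply
      by (auto simp: scl_def bvec_def tabloid_eq_iff act_tableau_mem[OF perm U] intro!: sum.cong)
    also have "\<dots> = (\<Sum>S'\<in>{S' \<in> tableaux \<mu>. same_columns \<mu> S' U}.
        if same_rows \<mu> S S' then tab_sign \<mu> S' * tab_sign \<mu> U else 0)"
    proof (rule sum.reindex_bij_witness[where i = "perm_of \<mu> U" and j = "\<lambda>\<pi>. act_tableau \<mu> \<pi> U"])
      fix \<pi> assume \<pi>: "\<pi> \<in> ?CG"
      then show "perm_of \<mu> U (act_tableau \<mu> \<pi> U) = \<pi>"
        using perm by (intro perm_of_eqI[OF U]) auto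
      show "act_tableau \<mu> \<pi> U \<in> {S' \<in> tableaux \<mu>. same_columns \<mu> S' U}"
        using \<pi> CG act_tableau_mem[OF perm U] by auto
      show "(if same_rows \<mu> S (act_tableau \<mu> \<pi> U) then tab_sign \<mu> (act_tableau \<mu> \<pi> U) * tab_sign \<mu> U else 0) =
          (if same_rows \<mu> S (act_tableau \<mu> \<pi> U) then of_int (sign \<pi>) else 0)"
        by (simp add: tab_sign_act[OF perm[OF \<pi>] U] mult.assoc tab_sign_sq)
    next
      fix S' assume "S' \<in> {S' \<in> tableaux \<mu>. same_columns \<mu> S' U}"
      then show "act_tableau \<mu> (perm_of \<mu> U S') U = S'" "perm_of \<mu> U S' \<in> ?CG"
        using perm_of[OF U] CG by auto
    qed
    also have "\<dots> = (\<Sum>S'\<in>{S' \<in> tableaux \<mu>. same_rows \<mu> S S'}.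
        if same_columns \<mu> S' U then tab_sign \<mu> S' * tab_sign \<mu> U else 0)"
      by (simp add: sum.inter_filter flip: sum.inter_filter) (auto intro!: sum.cong)
    also have "\<dots> = (\<Sum>S'\<in>{S' \<in> tableaux \<mu>. same_rows \<mu> S S'}. col_op \<mu> (bvec U) S')"
    proof (rule sum.cong[OF refl])
      fix S' assume "S' \<in> {S' \<in> tableaux \<mu>. same_rows \<mu> S S'}"
      then have S': "S' \<in> tableaux \<mu>"
        by simp
      have "col_op \<mu> (bvec U) S' = (\<Sum>S''\<in>tableaux \<mu>. if S'' = U then
          (if same_columns \<mu> S' U then tab_sign \<mu> S' * tab_sign \<mu> U else 0) else 0)"
        unfolding col_op_eq[OF S'] by (rule sum.cong) (auto simp: bvec_def)
      then show "(if same_columns \<mu> S' U then tab_sign \<mu> S' * tab_sign \<mu> U else 0) = col_op \<mu> (bvec U) S'"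
        using U by simp
    qed
    finally show ?thesis
      using True by (simp add: row_op_def)
  qed (simp add: pull_tabloid_def row_op_def)
qed

definition tabloid_funs :: "nat list \<Rightarrow> (tableau set \<Rightarrow> complex) set" where
  "tabloid_funs \<mu> = {v. \<forall>A. A \<notin> tabloid \<mu> ` tableaux \<mu> \<longrightarrow> v A = 0}"

lemma subspace_tabloid_funs: "fvs.subspace (tabloid_funs \<mu>)"
  by (auto simp: tabloid_funs_def scl_def intro!: fvs.subspaceI)

lemma bvec_tabloid_funs: "A \<in> tabloid \<mu> ` tableaux \<mu> \<Longrightarrow> bvec A \<in> tabloid_funs \<mu>"
  by (auto simp: tabloid_funs_def bvec_def)

lemma specht_subset: "specht \<mu> \<subseteq> tabloid_funs \<mu>"
  unfolding specht_def
proof (rule fvs.span_minimal[OF _ subspace_tabloid_funs], clarify)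
  fix U assume "U \<in> tableaux \<mu>"
  then show "polytabloid \<mu> U \<in> tabloid_funs \<mu>"
    unfolding polytabloid_def
    by (intro fvs.subspace_sum fvs.subspace_scale subspace_tabloid_funs bvec_tabloid_funs imageI act_tableau_mem)
      (auto simp: column_group_def)
qed

lemma pull_tabloid_inj: "inj_on (pull_tabloid \<mu>) (tabloid_funs \<mu>)"
proof (rule lin_inj_onI[OF lin_pull_tabloid subspace_tabloid_funs])
  fix v assume v: "v \<in> tabloid_funs \<mu>" "pull_tabloid \<mu> v = 0"
  have "v (tabloid \<mu> S) = 0" if "S \<in> tableaux \<mu>" for S
    using fun_cong[OF v(2), of S] that by (simp add: pull_tabloid_def)
  then have "v A = 0" for A
    using v(1) by (cases "A \<in> tabloid \<mu> ` tableaux \<mu>") (auto simp: tabloid_funs_def)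
  then show "v = 0"
    by (simp add: fun_eq_iff)
qed

lemma pull_specht: "pull_tabloid \<mu> ` specht \<mu> = row_col_space \<mu>"
proof -
  have "pull_tabloid \<mu> ` polytabloid \<mu> ` tableaux \<mu> = (\<lambda>U. row_op \<mu> (col_op \<mu> (bvec U))) ` tableaux \<mu>"
    unfolding image_image by (intro image_cong refl pull_polytabloid)
  then show ?thesis
    unfolding specht_def row_col_space_span module_hom.span_image[OF lin_pull_tabloid, symmetric] by simp
qed

lemma act_tabloid:
  assumes "\<pi> permutes {1..sum_list \<mu>}" "U \<in> tableaux \<mu>"
  shows "act_tableau \<mu> \<pi> ` tabloid \<mu> U = tabloid \<mu> (act_tableau \<mu> \<pi> U)"
proof
  have *: "act_tableau \<mu> \<rho> ` tabloid \<mu> W \<subseteq> tabloid \<mu> (act_tableau \<mu> \<rho> W)"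
    if "\<rho> permutes {1..sum_list \<mu>}" "W \<in> tableaux \<mu>" for \<rho> W
  proof (clarify)
    fix S assume "S \<in> tabloid \<mu> W"
    then have S: "S \<in> tableaux \<mu>" "\<And>i. S ` row \<mu> i = W ` row \<mu> i"
      by (simp_all add: tabloid_def)
    show "act_tableau \<mu> \<rho> S \<in> tabloid \<mu> (act_tableau \<mu> \<rho> W)"
      unfolding tabloid_def
      by (simp add: act_tableau_mem[OF that(1) S(1)] act_tableau_image[OF row_subset] S(2))
  qed
  show "act_tableau \<mu> \<pi> ` tabloid \<mu> U \<subseteq> tabloid \<mu> (act_tableau \<mu> \<pi> U)"
    by (rule *[OF assms])
  show "tabloid \<mu> (act_tableau \<mu> \<pi> U) \<subseteq> act_tableau \<mu> \<pi> ` tabloid \<mu> U"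
  proof
    fix S assume S: "S \<in> tabloid \<mu> (act_tableau \<mu> \<pi> U)"
    then have "act_tableau \<mu> (inv \<pi>) S \<in> tabloid \<mu> U"
      using *[OF permutes_inv[OF assms(1)] act_tableau_mem[OF assms]] act_tableau_inv(1)[OF assms] by auto
    moreover have "S = act_tableau \<mu> \<pi> (act_tableau \<mu> (inv \<pi>) S)"
      using S act_tableau_inv(2)[OF assms(1)] by (simp add: tabloid_def)
    ultimately show "S \<in> act_tableau \<mu> \<pi> ` tabloid \<mu> U"
      by blast
  qed
qed

lemma lin_act_module: "lin (act_module \<mu> \<pi>)"
  by (rule linI)
    (auto simp: act_module_def scl_def fun_eq_iff sum_fun_apply sum.distrib sum_distrib_left algebra_simps)

lemma act_module_mem:
  assumes "\<pi> permutes {1..sum_list \<mu>}"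
  shows "act_module \<mu> \<pi> v \<in> tabloid_funs \<mu>"
  unfolding act_module_def
proof (intro fvs.subspace_sum fvs.subspace_scale subspace_tabloid_funs bvec_tabloid_funs)
  fix A assume "A \<in> tabloid \<mu> ` tableaux \<mu>"
  then show "act_tableau \<mu> \<pi> ` A \<in> tabloid \<mu> ` tableaux \<mu>"
    using act_tabloid[OF assms] act_tableau_mem[OF assms] by auto
qed

lemma pull_act_module:
  assumes \<pi>: "\<pi> permutes {1..sum_list \<mu>}"
  shows "pull_tabloid \<mu> (act_module \<mu> \<pi> v) = tab_act \<mu> \<pi> (pull_tabloid \<mu> v)"
proof
  fix S
  show "pull_tabloid \<mu> (act_module \<mu> \<pi> v) S = tab_act \<mu> \<pi> (pull_tabloid \<mu> v) S"
  proof (cases "S \<in> tableaux \<mu>")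
    case True
    note i = permutes_inv[OF \<pi>]
    define S' where "S' = act_tableau \<mu> (inv \<pi>) S"
    have S': "S' \<in> tableaux \<mu>" "act_tableau \<mu> \<pi> S' = S"
      using act_tableau_mem[OF i True] act_tableau_inv(2)[OF \<pi> True] by (simp_all add: S'_def)
    have eq: "act_tableau \<mu> \<pi> ` A = tabloid \<mu> S \<longleftrightarrow> A = tabloid \<mu> S'" if "A \<in> tabloid \<mu> ` tableaux \<mu>" for A
    proof -
      from that obtain U where U: "U \<in> tableaux \<mu>" "A = tabloid \<mu> U"
        by blast
      have "act_tableau \<mu> \<pi> ` A = tabloid \<mu> S \<longleftrightarrow> same_rows \<mu> (act_tableau \<mu> \<pi> U) (act_tableau \<mu> \<pi> S')"
        by (simp add: U act_tabloid[OF \<pi>] tabloid_eq_iff act_tableau_mem[OF \<pi>] True S'(2))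
      then show ?thesis
        by (simp add: same_rows_act[OF \<pi>] U tabloid_eq_iff S'(1))
    qed
    have "act_module \<mu> \<pi> v (tabloid \<mu> S) =
        (\<Sum>A\<in>tabloid \<mu> ` tableaux \<mu>. if A = tabloid \<mu> S' then v A else 0)"
      unfolding act_module_def sum_fun_apply scl_def bvec_def
      by (intro sum.cong refl) (simp add: eq eq_commute[of "tabloid \<mu> S"])
    also have "\<dots> = v (tabloid \<mu> S')"
      using S' by simp
    finally show ?thesis
      using True S' by (simp add: pull_tabloid_def tab_act_def S'_def[symmetric])
  qed (simp add: pull_tabloid_def tab_act_def)
qed

lemma specht_char_eq_trace:
  assumes \<pi>: "\<pi> permutes {1..sum_list \<mu>}"
  shows "specht_char \<mu> \<pi> = trace_on (row_col_space \<mu>) (tab_act \<mu> \<pi>)"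
  unfolding specht_char_def
proof (rule trace_on_iso[OF _ specht_def lin_pull_tabloid _ pull_specht lin_act_module lin_tab_act, symmetric])
  show "inj_on (pull_tabloid \<mu>) (specht \<mu>)"
    by (rule inj_on_subset[OF pull_tabloid_inj specht_subset])
  \<comment> \<open>Stability under the action is read off in \<open>row_col_space\<close> and
    transported back by injectivity on all functions of tabloids.\<close>
  show "act_module \<mu> \<pi> v \<in> specht \<mu>" if "v \<in> specht \<mu>" for v
  proof -
    have "pull_tabloid \<mu> (act_module \<mu> \<pi> v) \<in> pull_tabloid \<mu> ` specht \<mu>"
      unfolding pull_act_module[OF \<pi>] pull_specht
      by (rule tab_act_row_col_space[OF \<pi>]) (use that pull_specht in blast)
    then obtain w where w: "w \<in> specht \<mu>" "pull_tabloid \<mu> (act_module \<mu> \<pi> v) = pull_tabloid \<mu> w"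
      by blast
    then have "act_module \<mu> \<pi> v = w"
      using inj_onD[OF pull_tabloid_inj w(2) act_module_mem[OF \<pi>]] specht_subset by blast
    with w(1) show ?thesis
      by simp
  qed
qed (simp_all add: pull_act_module[OF \<pi>])

lemma tab_act_comp:
  assumes "\<rho> permutes {1..sum_list \<mu>}" "\<pi> permutes {1..sum_list \<mu>}"
  shows "tab_act \<mu> \<rho> (tab_act \<mu> \<pi> f) = tab_act \<mu> (\<rho> \<circ> \<pi>) f"
  using act_tableau_mem[OF permutes_inv[OF assms(1)]]
  by (auto simp: tab_act_def fun_eq_iff act_tableau_comp
      o_inv_distrib[OF permutes_bij[OF assms(1)] permutes_bij[OF assms(2)]])

lemma tab_act_inverse:
  assumes "\<rho> permutes {1..sum_list \<mu>}" "f \<in> tab_funs \<mu>"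
  shows "tab_act \<mu> (inv \<rho>) (tab_act \<mu> \<rho> f) = f" "tab_act \<mu> \<rho> (tab_act \<mu> (inv \<rho>) f) = f"
proof -
  have "tab_act \<mu> id f = f"
    using assms(2) by (auto simp: tab_act_def fun_eq_iff tab_funs_def act_tableau_id)
  then show "tab_act \<mu> (inv \<rho>) (tab_act \<mu> \<rho> f) = f" "tab_act \<mu> \<rho> (tab_act \<mu> (inv \<rho>) f) = f"
    unfolding tab_act_comp[OF assms(1) permutes_inv[OF assms(1)]]
      tab_act_comp[OF permutes_inv[OF assms(1)] assms(1)] permutes_inv_o[OF assms(1)]
    by simp_all
qed

lemma row_col_space_subset: "row_col_space \<mu> \<subseteq> tab_funs \<mu>"
  and col_row_space_subset: "col_row_space \<mu> \<subseteq> tab_funs \<mu>"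
  by (auto simp: row_col_space_def col_row_space_def)

text \<open>The action of \<open>\<rho>\<close> is itself the isomorphism that intertwines the two
  permutations.\<close>

lemma specht_char_conj:
  assumes \<pi>: "\<pi> permutes {1..sum_list \<mu>}" and \<rho>: "\<rho> permutes {1..sum_list \<mu>}"
  shows "specht_char \<mu> (\<rho> \<circ> \<pi> \<circ> inv \<rho>) = specht_char \<mu> \<pi>"
proof -
  let ?V = "row_col_space \<mu>"
  note i = permutes_inv[OF \<rho>]
  have p: "\<rho> \<circ> \<pi> \<circ> inv \<rho> permutes {1..sum_list \<mu>}"
    by (intro permutes_compose \<pi> \<rho> i)
  have "trace_on ?V (tab_act \<mu> (\<rho> \<circ> \<pi> \<circ> inv \<rho>)) = trace_on ?V (tab_act \<mu> \<pi>)"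
  proof (rule trace_on_iso[OF _ row_col_space_span lin_tab_act[of \<mu> \<rho>] _ _ lin_tab_act lin_tab_act])
    show "inj_on (tab_act \<mu> \<rho>) ?V"
      using tab_act_inverse(1)[OF \<rho>] row_col_space_subset by (intro inj_on_inverseI[of _ "tab_act \<mu> (inv \<rho>)"]) blast
    show "tab_act \<mu> \<rho> ` ?V = ?V"
    proof
      show "tab_act \<mu> \<rho> ` ?V \<subseteq> ?V"
        using tab_act_row_col_space[OF \<rho>] by blast
      show "?V \<subseteq> tab_act \<mu> \<rho> ` ?V"
      proof
        fix v assume v: "v \<in> ?V"
        then have "v = tab_act \<mu> \<rho> (tab_act \<mu> (inv \<rho>) v)"
          using tab_act_inverse(2)[OF \<rho>] row_col_space_subset by fastforce
        then show "v \<in> tab_act \<mu> \<rho> ` ?V"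
          using tab_act_row_col_space[OF i v] by blast
      qed
    qed
    show "tab_act \<mu> \<pi> v \<in> ?V" if "v \<in> ?V" for v
      by (rule tab_act_row_col_space[OF \<pi> that])
    have "\<rho> \<circ> \<pi> \<circ> inv \<rho> \<circ> \<rho> = \<rho> \<circ> \<pi>"
      by (simp add: o_assoc[symmetric] permutes_inv_o[OF \<rho>])
    then show "tab_act \<mu> (\<rho> \<circ> \<pi> \<circ> inv \<rho>) (tab_act \<mu> \<rho> v) = tab_act \<mu> \<rho> (tab_act \<mu> \<pi> v)" for v
      unfolding tab_act_comp[OF p \<rho>] tab_act_comp[OF \<rho> \<pi>] by simp
  qed simp
  then show ?thesis
    unfolding specht_char_eq_trace[OF p] specht_char_eq_trace[OF \<pi>] .
qed

section \<open>Transposed shapes and the sign twist\<close>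

definition tab_transpose :: "nat list \<Rightarrow> tableau \<Rightarrow> tableau" where
  "tab_transpose \<nu> S = (\<lambda>c\<in>diagram \<nu>. S (prod.swap c))"

text \<open>Expressed by diagrams, the relation is symmetric, so every fact can be used in both
  directions through \<open>transposed_sym\<close>.\<close>

locale transposed_shapes =
  fixes \<mu> \<nu> :: "nat list"
  assumes diag: "diagram \<nu> = prod.swap ` diagram \<mu>" and size: "sum_list \<nu> = sum_list \<mu>"
begin

lemma diag': "diagram \<mu> = prod.swap ` diagram \<nu>"
  by (auto simp: diag image_image)

lemma swap_row: "row \<nu> i = prod.swap ` column \<mu> i" and swap_column: "column \<nu> i = prod.swap ` row \<mu> i"
  by (auto simp: Defs.row_def Defs.column_def diag image_iff)

lemma transpose_image:
  assumes "A \<subseteq> diagram \<mu>"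
  shows "tab_transpose \<nu> S ` prod.swap ` A = S ` A"
proof -
  have "tab_transpose \<nu> S (prod.swap c) = S c" if "c \<in> A" for c
    using assms that by (auto simp: tab_transpose_def diag)
  then show ?thesis
    unfolding image_image by (rule image_cong[OF refl])
qed

lemma transpose_mem:
  assumes "S \<in> tableaux \<mu>"
  shows "tab_transpose \<nu> S \<in> tableaux \<nu>"
proof -
  have "bij_betw prod.swap (diagram \<nu>) (diagram \<mu>)"
    unfolding diag' by (rule bij_betw_imageI) (auto simp: inj_on_def)
  moreover have "bij_betw S (diagram \<mu>) {1..sum_list \<mu>}"
    using assms by (simp add: tableaux_def)
  ultimately have "bij_betw (S \<circ> prod.swap) (diagram \<nu>) {1..sum_list \<mu>}"
    by (rule bij_betw_trans)
  then have "bij_betw (tab_transpose \<nu> S) (diagram \<nu>) {1..sum_list \<mu>}"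
    by (subst bij_betw_cong[of _ _ "S \<circ> prod.swap"]) (auto simp: tab_transpose_def)
  then show ?thesis
    by (simp add: tableaux_def size tab_transpose_def)
qed

lemma transpose_transpose:
  assumes "S \<in> tableaux \<mu>"
  shows "tab_transpose \<mu> (tab_transpose \<nu> S) = S"
proof
  fix c
  show "tab_transpose \<mu> (tab_transpose \<nu> S) c = S c"
  proof (cases "c \<in> diagram \<mu>")
    case True
    then have "prod.swap c \<in> diagram \<nu>"
      by (simp add: diag)
    with True show ?thesis
      by (simp add: tab_transpose_def)
  next
    case False
    then show ?thesis
      using assms extensional_arb[of S "diagram \<mu>" c] by (simp add: tab_transpose_def tableaux_def)
  qed
qed

lemma same_rows_transpose: "same_rows \<nu> (tab_transpose \<nu> S) (tab_transpose \<nu> S') \<longleftrightarrow> same_columns \<mu> S S'"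
  by (simp add: same_rows_def same_columns_def swap_row transpose_image column_subset)

lemma same_columns_transpose: "same_columns \<nu> (tab_transpose \<nu> S) (tab_transpose \<nu> S') \<longleftrightarrow> same_rows \<mu> S S'"
  by (simp add: same_rows_def same_columns_def swap_column transpose_image row_subset)

lemma transpose_act: "tab_transpose \<nu> (act_tableau \<mu> \<pi> S) = act_tableau \<nu> \<pi> (tab_transpose \<nu> S)"
proof
  fix c
  have "prod.swap c \<in> diagram \<mu> \<longleftrightarrow> c \<in> diagram \<nu>"
    by (auto simp: diag intro: image_eqI[of _ _ "prod.swap c"])
  then show "tab_transpose \<nu> (act_tableau \<mu> \<pi> S) c = act_tableau \<nu> \<pi> (tab_transpose \<nu> S) c"
    by (auto simp: tab_transpose_def act_tableau_def compose_def)
qed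

lemma transposed_sym: "transposed_shapes \<nu> \<mu>"
  by unfold_locales (use diag' size in auto)

text \<open>Transposition exchanges row and column classes, and the factor \<open>tab_sign\<close>
  exchanges plain and signed sums. Together they exchange the row symmetrizer and the column
  antisymmetrizer.\<close>

definition sign_transpose :: "(tableau \<Rightarrow> complex) \<Rightarrow> tableau \<Rightarrow> complex" where
  "sign_transpose f S =
    (if S \<in> tableaux \<nu> then tab_sign \<mu> (tab_transpose \<mu> S) * f (tab_transpose \<mu> S) else 0)"

lemma lin_sign_transpose: "lin sign_transpose"
  by (rule linI) (auto simp: sign_transpose_def fun_eq_iff scl_def algebra_simps)

lemma sum_tableaux_transpose: "(\<Sum>S\<in>tableaux \<nu>. h S) = (\<Sum>S\<in>tableaux \<mu>. h (tab_transpose \<nu> S))"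
proof -
  interpret sym: transposed_shapes \<nu> \<mu>
    by (rule transposed_sym)
  show ?thesis
    by (rule sum.reindex_bij_witness[where i = "tab_transpose \<nu>" and j = "tab_transpose \<mu>"])
      (auto simp: transpose_mem sym.transpose_mem transpose_transpose sym.transpose_transpose)
qed

text \<open>The reference tableaux of the two shapes are unrelated, so single signs may differ.
  Products agree because transposition commutes with the action.\<close>

lemma tab_sign_transpose_product:
  assumes "S \<in> tableaux \<mu>" "S' \<in> tableaux \<mu>"
  shows "tab_sign \<nu> (tab_transpose \<nu> S) * tab_sign \<nu> (tab_transpose \<nu> S') = tab_sign \<mu> S * tab_sign \<mu> S'"
proof -
  obtain \<pi> where \<pi>: "\<pi> permutes {1..sum_list \<mu>}" "act_tableau \<mu> \<pi> S = S'"
    using tableaux_transitive[OF assms] by blast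
  have "tab_sign \<nu> (tab_transpose \<nu> S') = of_int (sign \<pi>) * tab_sign \<nu> (tab_transpose \<nu> S)"
    unfolding \<pi>(2)[symmetric] transpose_act using \<pi>(1) transpose_mem[OF assms(1)]
    by (intro tab_sign_act) (simp_all add: size)
  moreover have "tab_sign \<mu> S' = of_int (sign \<pi>) * tab_sign \<mu> S"
    unfolding \<pi>(2)[symmetric] by (rule tab_sign_act[OF \<pi>(1) assms(1)])
  ultimately show ?thesis
    by (simp add: mult.left_commute[of _ "of_int (sign \<pi>)"] tab_sign_sq)
qed

lemma sign_transpose_col_op: "sign_transpose (col_op \<mu> f) = row_op \<nu> (sign_transpose f)"
proof
  interpret sym: transposed_shapes \<nu> \<mu>
    by (rule transposed_sym)
  fix S
  show "sign_transpose (col_op \<mu> f) S = row_op \<nu> (sign_transpose f) S"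
  proof (cases "S \<in> tableaux \<nu>")
    case True
    define U where "U = tab_transpose \<mu> S"
    have U: "U \<in> tableaux \<mu>" "S = tab_transpose \<nu> U"
      using sym.transpose_mem[OF True] sym.transpose_transpose[OF True] by (simp_all add: U_def)
    have "row_op \<nu> (sign_transpose f) S =
        (\<Sum>U'\<in>tableaux \<mu>. if same_columns \<mu> U U' then tab_sign \<mu> U' * f U' else 0)"
      unfolding row_op_eq[OF True] sum_tableaux_transpose unfolding U(2) same_rows_transpose
      by (intro sum.cong refl) (simp add: sign_transpose_def transpose_mem transpose_transpose)
    also have "\<dots> = tab_sign \<mu> U * col_op \<mu> f U"
      unfolding col_op_eq[OF U(1)] sum_distrib_left
      by (intro sum.cong refl) (simp add: mult.assoc tab_sign_sq')
    finally show ?thesis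
      using True by (simp add: sign_transpose_def U_def)
  qed (simp add: sign_transpose_def row_op_def)
qed

lemma sign_transpose_row_op: "sign_transpose (row_op \<mu> f) = col_op \<nu> (sign_transpose f)"
proof
  interpret sym: transposed_shapes \<nu> \<mu>
    by (rule transposed_sym)
  fix S
  show "sign_transpose (row_op \<mu> f) S = col_op \<nu> (sign_transpose f) S"
  proof (cases "S \<in> tableaux \<nu>")
    case True
    define U where "U = tab_transpose \<mu> S"
    have U: "U \<in> tableaux \<mu>" "S = tab_transpose \<nu> U"
      using sym.transpose_mem[OF True] sym.transpose_transpose[OF True] by (simp_all add: U_def)
    have "col_op \<nu> (sign_transpose f) S =
        (\<Sum>U'\<in>tableaux \<mu>. if same_rows \<mu> U U' then tab_sign \<mu> U * tab_sign \<mu> U' * (tab_sign \<mu> U' * f U') else 0)"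
      unfolding col_op_eq[OF True] sum_tableaux_transpose unfolding U(2) same_columns_transpose
      by (intro sum.cong refl)
        (simp add: sign_transpose_def transpose_mem transpose_transpose tab_sign_transpose_product U(1))
    also have "\<dots> = tab_sign \<mu> U * row_op \<mu> f U"
      unfolding row_op_eq[OF U(1)] sum_distrib_left
      by (intro sum.cong refl) (simp add: mult.assoc tab_sign_sq')
    finally show ?thesis
      using True by (simp add: sign_transpose_def U_def)
  qed (simp add: sign_transpose_def col_op_def)
qed

lemma sign_transpose_act:
  assumes \<pi>: "\<pi> permutes {1..sum_list \<mu>}"
  shows "sign_transpose (tab_act \<mu> \<pi> f) = scl (of_int (sign \<pi>)) (tab_act \<nu> \<pi> (sign_transpose f))"
proof
  interpret sym: transposed_shapes \<nu> \<mu>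
    by (rule transposed_sym)
  note i = permutes_inv[OF \<pi>]
  have sgn: "sign (inv \<pi>) = sign \<pi>"
    using \<pi> by (intro sign_inverse) (auto simp: permutation_permutes)
  fix S
  show "sign_transpose (tab_act \<mu> \<pi> f) S = scl (of_int (sign \<pi>)) (tab_act \<nu> \<pi> (sign_transpose f)) S"
  proof (cases "S \<in> tableaux \<nu>")
    case True
    have m: "tab_transpose \<mu> S \<in> tableaux \<mu>" "act_tableau \<nu> (inv \<pi>) S \<in> tableaux \<nu>"
      using sym.transpose_mem[OF True] act_tableau_mem[of "inv \<pi>" \<nu> S] i True by (simp_all add: size)
    show ?thesis
      using True m
      by (simp add: sign_transpose_def tab_act_def scl_def sym.transpose_act tab_sign_act[OF i] sgn sign_sq mult.assoc)
  qed (simp add: sign_transpose_def tab_act_def scl_def)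
qed

lemma sign_transpose_inj: "inj_on sign_transpose (tab_funs \<mu>)"
proof (rule lin_inj_onI[OF lin_sign_transpose])
  show "fvs.subspace (tab_funs \<mu>)"
    by (simp add: tab_funs_span)
  fix f assume f: "f \<in> tab_funs \<mu>" "sign_transpose f = 0"
  have "f S = 0" if S: "S \<in> tableaux \<mu>" for S
  proof -
    have "tab_sign \<mu> S * f S = 0"
      using fun_cong[OF f(2), of "tab_transpose \<nu> S"] S
      by (simp add: sign_transpose_def transpose_mem transpose_transpose)
    then show ?thesis
      using tab_sign_sq'[of \<mu> S "f S"] by (metis mult_zero_right)
  qed
  then show "f = 0"
    using f(1) by (auto simp: tab_funs_def fun_eq_iff)
qed

lemma sign_transpose_image: "sign_transpose ` tab_funs \<mu> = tab_funs \<nu>"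
proof
  interpret sym: transposed_shapes \<nu> \<mu>
    by (rule transposed_sym)
  show "sign_transpose ` tab_funs \<mu> \<subseteq> tab_funs \<nu>"
    by (auto simp: sign_transpose_def tab_funs_def)
  show "tab_funs \<nu> \<subseteq> sign_transpose ` tab_funs \<mu>"
  proof
    fix g assume g: "g \<in> tab_funs \<nu>"
    define f where "f = (\<lambda>S. if S \<in> tableaux \<mu> then tab_sign \<mu> S * g (tab_transpose \<nu> S) else 0)"
    have "sign_transpose f = g"
      using g by (auto simp: fun_eq_iff sign_transpose_def f_def tab_funs_def sym.transpose_mem
          sym.transpose_transpose tab_sign_sq')
    moreover have "f \<in> tab_funs \<mu>"
      by (simp add: f_def tab_funs_def)
    ultimately show "g \<in> sign_transpose ` tab_funs \<mu>"
      by blast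
  qed
qed

text \<open>\<open>sign_transpose\<close> identifies the image of c r for \<mu> with the image of r
  c for \<nu> and twists the action by the sign; the image of c r for \<mu> has the same character
  as the Specht module of \<mu>.\<close>

lemma specht_char_transpose:
  assumes \<pi>: "\<pi> permutes {1..sum_list \<mu>}"
  shows "specht_char \<nu> \<pi> = of_int (sign \<pi>) * specht_char \<mu> \<pi>"
proof -
  let ?s = "of_int (sign \<pi>) :: complex"
  have \<pi>': "\<pi> permutes {1..sum_list \<nu>}"
    using \<pi> by (simp add: size)
  have img: "sign_transpose ` col_row_space \<mu> = row_col_space \<nu>"
    unfolding col_row_space_def row_col_space_def sign_transpose_image[symmetric] image_image
    by (simp add: sign_transpose_col_op sign_transpose_row_op)
  have "trace_on (row_col_space \<nu>) (\<lambda>v. scl ?s (tab_act \<nu> \<pi> v)) = trace_on (col_row_space \<mu>) (tab_act \<mu> \<pi>)"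
  proof (rule trace_on_iso[OF _ col_row_space_span lin_sign_transpose _ img lin_tab_act])
    show "inj_on sign_transpose (col_row_space \<mu>)"
      by (rule inj_on_subset[OF sign_transpose_inj col_row_space_subset])
    show "lin (\<lambda>v. scl ?s (tab_act \<nu> \<pi> v))"
      by (rule linI) (simp_all add: module_hom.add[OF lin_tab_act] module_hom.scale[OF lin_tab_act]
          fvs.scale_right_distrib mult.commute)
  qed (simp_all add: tab_act_col_row_space[OF \<pi>] sign_transpose_act[OF \<pi>])
  also have "\<dots> = specht_char \<mu> \<pi>"
    using trace_row_col_eq_col_row[OF \<pi>] specht_char_eq_trace[OF \<pi>] by simp
  also have "trace_on (row_col_space \<nu>) (\<lambda>v. scl ?s (tab_act \<nu> \<pi> v)) = ?s * specht_char \<nu> \<pi>"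
    unfolding specht_char_eq_trace[OF \<pi>']
    by (rule trace_on_scale[OF _ row_col_space_span lin_tab_act]) (auto intro: tab_act_row_col_space[OF \<pi>'])
  finally have "?s * (?s * specht_char \<nu> \<pi>) = ?s * specht_char \<mu> \<pi>"
    by simp
  then show ?thesis
    by (simp only: sign_sq)
qed

end

section \<open>The conjugate partition\<close>

lemma card_diagram: "card (diagram \<mu>) = sum_list \<mu>"
proof -
  have "diagram \<mu> = (SIGMA i:{..<length \<mu>}. {..<\<mu> ! i})"
    by (auto simp: diagram_def)
  then have "card (diagram \<mu>) = (\<Sum>i<length \<mu>. \<mu> ! i)"
    by simp
  then show ?thesis
    by (simp add: sum_list_sum_nth lessThan_atLeast0)
qed

text \<open>In a decreasing list the entries above a bound form an initial segment.\<close>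

lemma less_length_filter_iff:
  assumes "sorted_wrt (\<ge>) (\<mu> :: nat list)"
  shows "j < length (filter (\<lambda>p. i < p) \<mu>) \<longleftrightarrow> j < length \<mu> \<and> i < \<mu> ! j"
  using assms
proof (induction \<mu> arbitrary: j)
  case (Cons p \<mu>)
  show ?case
  proof (cases "i < p")
    case True
    with Cons show ?thesis
      by (cases j) auto
  next
    case False
    then have "\<forall>q\<in>set \<mu>. \<not> i < q"
      using Cons.prems by fastforce
    moreover from this False have "\<not> i < (p # \<mu>) ! j" if "j < length (p # \<mu>)"
      using that nth_mem[of j "p # \<mu>"] by auto
    ultimately show ?thesis
      using False by (auto simp: filter_empty_conv)
  qed
qed simp

lemma less_foldr_max_iff: "i < foldr max \<mu> (0 :: nat) \<longleftrightarrow> (\<exists>p\<in>set \<mu>. i < p)"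
  by (induction \<mu>) (auto simp: less_max_iff_disj)

lemma transposed_conj_partition:
  assumes "is_partition \<mu>"
  shows "transposed_shapes \<mu> (conj_partition \<mu>)"
proof
  have sorted: "sorted_wrt (\<ge>) \<mu>"
    using assms by (simp add: is_partition_def)
  have "(i, j) \<in> diagram (conj_partition \<mu>) \<longleftrightarrow> (j, i) \<in> diagram \<mu>" for i j
  proof (cases "i < foldr max \<mu> 0")
    case True
    then show ?thesis
      using less_length_filter_iff[OF sorted, of j i] by (simp add: diagram_def conj_partition_def)
  next
    case False
    then show ?thesis
      using nth_mem[of j \<mu>] by (auto simp: diagram_def conj_partition_def less_foldr_max_iff)
  qed
  then show diag: "diagram (conj_partition \<mu>) = prod.swap ` diagram \<mu>"
    by (auto simp: image_iff) force
  \<comment> \<open>Both sizes count the cells of a diagram.\<close>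
  show "sum_list (conj_partition \<mu>) = sum_list \<mu>"
    unfolding card_diagram[symmetric] diag by (rule card_image) (auto simp: inj_on_def)
qed

section \<open>Single columns\<close>

lemma row_one_column: "row (replicate k (Suc 0)) i = (if i < k then {(i, 0)} else {})"
  by (auto simp: Defs.row_def diagram_def)

lemma column_one_column: "column (replicate k (Suc 0)) j = (if j = 0 then (\<lambda>i. (i, 0)) ` {..<k} else {})"
  by (auto simp: Defs.column_def diagram_def)

text \<open>In a single column the row classes are single tableaux and all tableaux share their
  columns. So \<open>row_op\<close> is the identity on functions of tableaux and the image of
  \<open>col_op\<close> is the line spanned by the sign function \<open>e\<close>.\<close>

lemma specht_char_one_column:
  assumes \<pi>: "\<pi> permutes {1..k}"
  shows "specht_char (replicate k 1) \<pi> = of_int (sign \<pi>)"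
proof -
  define \<mu> where "\<mu> = replicate k (Suc 0)"
  have size: "sum_list \<mu> = k"
    by (simp add: \<mu>_def sum_list_replicate)
  have diag: "diagram \<mu> = (\<lambda>i. (i, 0)) ` {..<k}"
    by (auto simp: \<mu>_def diagram_def)
  have \<pi>': "\<pi> permutes {1..sum_list \<mu>}"
    using \<pi> by (simp add: size)
  note i = permutes_inv[OF \<pi>']
  define S0 where "S0 = (\<lambda>c\<in>diagram \<mu>. Suc (fst c))"
  have S0: "S0 \<in> tableaux \<mu>"
  proof -
    have "bij_betw S0 (diagram \<mu>) {1..k}"
      unfolding bij_betw_def S0_def diag by (auto simp: inj_on_def image_image image_Suc_lessThan)
    then show ?thesis
      by (simp add: tableaux_def size S0_def)
  qed
  have rows: "same_rows \<mu> S S' \<longleftrightarrow> S = S'" if "S \<in> tableaux \<mu>" "S' \<in> tableaux \<mu>" for S S'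
  proof
    assume *: "same_rows \<mu> S S'"
    show "S = S'"
    proof (rule extensionalityI[of _ "diagram \<mu>"])
      fix c assume "c \<in> diagram \<mu>"
      then obtain j where "j < k" "c = (j, 0)"
        by (auto simp: diag)
      then show "S c = S' c"
        using *[unfolded same_rows_def, rule_format, of j] by (simp add: \<mu>_def row_one_column)
    qed (use that in \<open>auto simp: tableaux_def\<close>)
  qed (simp add: same_rows_def)
  have cols: "same_columns \<mu> S S'" if "S \<in> tableaux \<mu>" "S' \<in> tableaux \<mu>" for S S'
  proof -
    have "S ` diagram \<mu> = S' ` diagram \<mu>"
      using that by (simp add: tableaux_def bij_betw_def)
    then show ?thesis
      by (simp add: same_columns_def \<mu>_def column_one_column diag[unfolded \<mu>_def])
  qed
  define e where "e = (\<lambda>S. if S \<in> tableaux \<mu> then tab_sign \<mu> S else 0)"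
  have row_id: "row_op \<mu> f = f" if "f \<in> tab_funs \<mu>" for f
  proof
    fix S
    show "row_op \<mu> f S = f S"
    proof (cases "S \<in> tableaux \<mu>")
      case True
      then have "{S' \<in> tableaux \<mu>. same_rows \<mu> S S'} = {S}"
        using rows by auto
      with True show ?thesis
        by (simp add: row_op_def)
    qed (use that in \<open>simp add: row_op_def tab_funs_def\<close>)
  qed
  have col_bvec: "col_op \<mu> (bvec U) = scl (tab_sign \<mu> U) e" if U: "U \<in> tableaux \<mu>" for U
  proof
    fix S
    show "col_op \<mu> (bvec U) S = scl (tab_sign \<mu> U) e S"
    proof (cases "S \<in> tableaux \<mu>")
      case True
      have "col_op \<mu> (bvec U) S = (\<Sum>S'\<in>tableaux \<mu>. if S' = U then tab_sign \<mu> S * tab_sign \<mu> U else 0)"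
        unfolding col_op_eq[OF True] by (rule sum.cong) (auto simp: bvec_def cols True)
      with True U show ?thesis
        by (simp add: e_def scl_def mult.commute)
    qed (simp add: col_op_def e_def scl_def)
  qed
  have e_ne: "e \<noteq> 0"
  proof
    assume "e = 0"
    from fun_cong[OF this, of S0] S0 have "tab_sign \<mu> S0 = 0"
      by (simp add: e_def)
    with tab_sign_sq[of \<mu> S0] show False
      by simp
  qed
  have space: "fvs.span {e} = row_col_space \<mu>"
  proof
    have gen: "row_op \<mu> (col_op \<mu> (bvec U)) = scl (tab_sign \<mu> U) e" if "U \<in> tableaux \<mu>" for U
      unfolding row_id[OF op_tab_funs(2)] by (rule col_bvec[OF that])
    show "row_col_space \<mu> \<subseteq> fvs.span {e}"
      unfolding row_col_space_span
      by (rule fvs.span_minimal) (auto simp: gen intro: fvs.span_scale fvs.span_base)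
    have "scl (tab_sign \<mu> S0) (row_op \<mu> (col_op \<mu> (bvec S0))) \<in> row_col_space \<mu>"
      unfolding row_col_space_span by (intro fvs.span_scale fvs.span_base) (use S0 in auto)
    then have "e \<in> row_col_space \<mu>"
      by (simp add: gen[OF S0] tab_sign_sq)
    then show "fvs.span {e} \<subseteq> row_col_space \<mu>"
      by (intro fvs.span_minimal subspace_row_col_space) auto
  qed
  have ind: "fvs.independent {e}"
    using e_ne by simp
  have act: "tab_act \<mu> \<pi> e = scl (of_int (sign \<pi>)) e"
  proof
    fix S
    have "sign (inv \<pi>) = sign \<pi>"
      using \<pi> by (intro sign_inverse) (auto simp: permutation_permutes)
    then show "tab_act \<mu> \<pi> e S = scl (of_int (sign \<pi>)) e S"
      using act_tableau_mem[OF i] tab_sign_act[OF i] by (simp add: tab_act_def e_def scl_def)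
  qed
  have "specht_char \<mu> \<pi> = (\<Sum>b\<in>{e}. fvs.representation {e} (tab_act \<mu> \<pi> b) b)"
    unfolding specht_char_eq_trace[OF \<pi>']
    by (rule trace_on_basis[OF ind _ space lin_tab_act]) (auto intro: tab_act_row_col_space[OF \<pi>'])
  also have "\<dots> = of_int (sign \<pi>)"
    by (simp add: act fvs.representation_scale[OF ind fvs.span_base] fvs.representation_basis[OF ind])
  finally show ?thesis
    by (simp add: \<mu>_def)
qed

section \<open>The Bethe algebra\<close>

lemma rank_bij:
  assumes "finite (X :: nat set)"
  shows "bij_betw (\<lambda>i. card {j \<in> X. j \<le> i}) X {1..card X}"
proof -
  let ?r = "\<lambda>i. card {j \<in> X. j \<le> i}"
  have less: "?r i < ?r j" if "i < j" "j \<in> X" for i j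
  proof (rule psubset_card_mono)
    have "j \<in> {k \<in> X. k \<le> j} - {k \<in> X. k \<le> i}"
      using that by auto
    moreover have "{k \<in> X. k \<le> i} \<subseteq> {k \<in> X. k \<le> j}"
      using that by auto
    ultimately show "{k \<in> X. k \<le> i} \<subset> {k \<in> X. k \<le> j}"
      by blast
  qed (use assms in simp)
  have inj: "inj_on ?r X"
  proof (rule inj_onI)
    fix i j assume "i \<in> X" "j \<in> X" "?r i = ?r j"
    then show "i = j"
      using less[of i j] less[of j i] by (cases i j rule: linorder_cases) auto
  qed
  have "?r i \<in> {1..card X}" if "i \<in> X" for i
    using that assms by (auto simp: Suc_le_eq card_gt_0_iff intro!: card_mono)
  then have "?r ` X = {1..card X}"
    using card_image[OF inj] by (intro card_subset_eq) auto
  with inj show ?thesis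
    by (simp add: bij_betw_def)
qed

text \<open>Relabelling in increasing order keeps the cycle type, the cycle type determines the
  conjugacy class, and characters are constant on it.\<close>

lemma specht_char_on_cycle_type:
  "\<exists>f. \<forall>X \<sigma>. finite X \<longrightarrow> card X = sum_list \<mu> \<longrightarrow> \<sigma> permutes X \<longrightarrow>
    specht_char_on X \<mu> \<sigma> = f (cycle_type X \<sigma>)"
proof -
  let ?N = "{1..sum_list \<mu>}"
  \<comment> \<open>The character at a chosen permutation of each cycle type; multisets that are not
    cycle types get an arbitrary value.\<close>
  define f where "f = (\<lambda>m. specht_char \<mu> (SOME \<sigma>. \<sigma> permutes ?N \<and> cycle_type ?N \<sigma> = m))"
  have "specht_char_on X \<mu> \<sigma> = f (cycle_type X \<sigma>)"
    if X: "finite X" "card X = sum_list \<mu>" and \<sigma>: "\<sigma> permutes X" for X \<sigma>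
  proof -
    define \<tau> where "\<tau> = map_permutation X (\<lambda>i. card {j \<in> X. j \<le> i}) \<sigma>"
    define \<rho> where "\<rho> = (SOME \<rho>. \<rho> permutes ?N \<and> cycle_type ?N \<rho> = cycle_type X \<sigma>)"
    note r = rank_bij[OF X(1), unfolded X(2)]
    have \<tau>: "\<tau> permutes ?N" "cycle_type ?N \<tau> = cycle_type X \<sigma>"
      unfolding \<tau>_def using map_permutation_permutes[OF r \<sigma>]
        cycle_type_map_permutation[OF bij_betw_imp_inj_on[OF r] \<sigma> X(1)] bij_betw_imp_surj_on[OF r]
      by auto
    then have \<rho>: "\<rho> permutes ?N" "cycle_type ?N \<rho> = cycle_type X \<sigma>"
      unfolding \<rho>_def by (metis (mono_tags, lifting) someI_ex)+
    obtain g where g: "g permutes ?N" "\<tau> = g \<circ> \<rho> \<circ> inv g"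
      using cycle_type_eq_imp_conj[OF \<rho>(1) \<tau>(1)] \<rho>(2) \<tau>(2) by auto
    have "specht_char_on X \<mu> \<sigma> = specht_char \<mu> \<tau>"
      by (simp add: specht_char_on_def \<tau>_def)
    also have "\<dots> = specht_char \<mu> \<rho>"
      unfolding g(2) by (rule specht_char_conj[OF \<rho>(1) g(1)])
    finally show ?thesis
      by (simp add: f_def \<rho>_def)
  qed
  then show ?thesis
    by blast
qed

lemma beta_eq_sum_Pow:
  "beta n z \<mu> t = (\<Sum>X\<in>Pow {1..n}. \<Sum>\<sigma> | \<sigma> permutes X.
     scl ((if card X = sum_list \<mu> then specht_char_on X \<mu> \<sigma> else 0) * (\<Prod>i\<in>{1..n} - X. z i + t)) (bvec \<sigma>))"
proof -
  have "beta n z \<mu> t = (\<Sum>X\<in>{X \<in> Pow {1..n}. card X = sum_list \<mu>}. \<Sum>\<sigma> | \<sigma> permutes X.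
      scl (specht_char_on X \<mu> \<sigma> * (\<Prod>i\<in>{1..n} - X. (z i + t))) (bvec \<sigma>))"
    unfolding beta_def by (intro sum.cong) auto
  also have "\<dots> = (\<Sum>X\<in>Pow {1..n}. if card X = sum_list \<mu> then \<Sum>\<sigma> | \<sigma> permutes X.
      scl (specht_char_on X \<mu> \<sigma> * (\<Prod>i\<in>{1..n} - X. (z i + t))) (bvec \<sigma>) else 0)"
    by (rule sum.inter_filter) simp
  also have "\<dots> = (\<Sum>X\<in>Pow {1..n}. \<Sum>\<sigma> | \<sigma> permutes X.
     scl ((if card X = sum_list \<mu> then specht_char_on X \<mu> \<sigma> else 0) * (\<Prod>i\<in>{1..n} - X. z i + t)) (bvec \<sigma>))"
    by (intro sum.cong refl) simp
  finally show ?thesis .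
qed

lemma specht_char_on_one_column:
  assumes "finite X" "card X = k" "\<sigma> permutes X"
  shows "specht_char_on X (replicate k 1) \<sigma> = of_int (sign \<sigma>)"
proof -
  note r = rank_bij[OF assms(1), unfolded assms(2)]
  have "map_permutation X (\<lambda>i. card {j \<in> X. j \<le> i}) \<sigma> permutes {1..k}"
    by (rule map_permutation_permutes[OF r assms(3)])
  then show ?thesis
    using specht_char_one_column sign_map_permutation[OF bij_betw_imp_inj_on[OF r] assms(3,1)]
    by (simp add: specht_char_on_def)
qed

text \<open>For \<open>psum [s] k = - s ^ k\<close> the cycles on X contribute
  \<open>(- 1) ^ card (orbs \<sigma> X) * s ^ card X\<close>, which is \<open>(- s) ^ card X\<close>
  times the sign, and the sign is the character of a column.\<close>

lemma tau_one_letter: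
  "tau n z (psum [s]) t = (\<Sum>k\<le>n. scl ((- s) ^ k) (beta n z (replicate k 1) t))"
proof -
  have size: "sum_list (replicate k (1::nat)) = k" for k
    by (simp add: sum_list_replicate)
  have "(\<Sum>k\<le>n. scl ((- s) ^ k) (beta n z (replicate k 1) t)) =
      (\<Sum>X\<in>Pow {1..n}. \<Sum>\<sigma> | \<sigma> permutes X. \<Sum>k\<le>n.
        scl ((- s) ^ k) (scl ((if card X = k then specht_char_on X (replicate k 1) \<sigma> else 0) *
          (\<Prod>i\<in>{1..n} - X. z i + t)) (bvec \<sigma>)))"
    unfolding beta_eq_sum_Pow fvs.scale_sum_right size by (simp only: sum.swap[of _ _ "{..n}"])
  also have "\<dots> = tau n z (psum [s]) t"
    unfolding tau_expand
  proof (intro sum.cong refl)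
    fix X \<sigma> assume "X \<in> Pow {1..n}" "\<sigma> \<in> {\<sigma>. \<sigma> permutes X}"
    then have X: "finite X" "card X \<le> n" and \<sigma>: "\<sigma> permutes X"
      using finite_subset[of X "{1..n}"] card_mono[of "{1..n}" X] by auto
    let ?u = "\<Prod>i\<in>{1..n} - X. z i + t"
    have "(\<Prod>c\<in>orbs \<sigma> X. psum [s] (card c)) = (\<Prod>c\<in>orbs \<sigma> X. - 1 * s ^ card c)"
      by (simp add: psum_def)
    also have "\<dots> = (- 1) ^ card (orbs \<sigma> X) * s ^ card X"
      unfolding prod.distrib using sum_card_orbs[OF \<sigma> X(1)] by (simp add: power_sum[symmetric])
    also have "\<dots> = (- s) ^ card X * of_int (sign \<sigma>)"
    proof -
      have "(- 1 :: complex) ^ card X * (- 1) ^ card X = 1"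
        by (simp add: power_mult_distrib[symmetric])
      then have "(- 1) ^ card X * s ^ card X * ((- 1) ^ card X * (- 1) ^ card (orbs \<sigma> X)) =
          (- 1) ^ card (orbs \<sigma> X) * s ^ card X"
        by (metis mult.assoc mult.commute mult_1)
      then show ?thesis
        unfolding sign_orbs[OF \<sigma> X(1)] power_add power_minus[of s] by (rule sym)
    qed
    finally have prod: "(\<Prod>c\<in>orbs \<sigma> X. psum [s] (card c)) = (- s) ^ card X * of_int (sign \<sigma>)" .
    have "(\<Sum>k\<le>n. scl ((- s) ^ k) (scl ((if card X = k then specht_char_on X (replicate k 1) \<sigma> else 0) * ?u) (bvec \<sigma>))) =
        (\<Sum>k\<le>n. if k = card X then scl ((- s) ^ card X * of_int (sign \<sigma>) * ?u) (bvec \<sigma>) else 0)"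
    proof (rule sum.cong[OF refl])
      fix k
      show "scl ((- s) ^ k) (scl ((if card X = k then specht_char_on X (replicate k 1) \<sigma> else 0) * ?u) (bvec \<sigma>)) =
          (if k = card X then scl ((- s) ^ card X * of_int (sign \<sigma>) * ?u) (bvec \<sigma>) else 0)"
        using specht_char_on_one_column[OF X(1) refl \<sigma>] by (cases "k = card X") (simp_all add: mult.assoc)
    qed
    also have "\<dots> = scl ((\<Prod>c\<in>orbs \<sigma> X. psum [s] (card c)) * ?u) (bvec \<sigma>)"
      unfolding prod using X(2) by simp
    finally show "(\<Sum>k\<le>n. scl ((- s) ^ k) (scl ((if card X = k then specht_char_on X (replicate k 1) \<sigma> else 0) * ?u) (bvec \<sigma>))) =
        scl ((\<Prod>c\<in>orbs \<sigma> X. psum [s] (card c)) * ?u) (bvec \<sigma>)" .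
  qed
  finally show ?thesis ..
qed

section \<open>Membership of all \<open>beta\<close> and stability under \<open>star\<close>\<close>

lemma carrier_bethe_algebra:
  "carrier (bethe_algebra n z) = generated_algebra (CS n) {beta n z (replicate k 1) t | k t. True}"
  by (simp add: bethe_algebra_def)

lemma CS_add: "f \<oplus>\<^bsub>CS n\<^esub> g = f + g"
  by (simp add: group_algebra_def)

lemma bethe_one_letter_subalgebra: "one_letter_subalgebra n z (carrier (bethe_algebra n z))"
proof
  let ?S = "{beta n z (replicate k 1) t | k t. True}"
  show sub: "fvs.subspace (carrier (bethe_algebra n z))"
    unfolding carrier_bethe_algebra
  proof (rule fvs.subspaceI)
    show "0 \<in> generated_algebra (CS n) ?S"
      using generated_algebra.scale[OF generated_algebra.one, of 0] by simp
    show "x + y \<in> generated_algebra (CS n) ?S"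
      if "x \<in> generated_algebra (CS n) ?S" "y \<in> generated_algebra (CS n) ?S" for x y
      using generated_algebra.add[OF that] by (simp add: CS_add)
  qed (rule generated_algebra.scale)
  show "f \<otimes>\<^bsub>CS n\<^esub> g \<in> carrier (bethe_algebra n z)"
    if "f \<in> carrier (bethe_algebra n z)" "g \<in> carrier (bethe_algebra n z)" for f g
    using that unfolding carrier_bethe_algebra by (rule generated_algebra.mult)
  show "tau n z (psum [s]) t \<in> carrier (bethe_algebra n z)" for s t
    unfolding tau_one_letter
    by (intro fvs.subspace_sum fvs.subspace_scale sub)
      (auto simp: carrier_bethe_algebra intro: generated_algebra.gen)
qed

lemma beta_mem: "beta n z \<mu> t \<in> carrier (bethe_algebra n z)"
proof -
  interpret one_letter_subalgebra n z "carrier (bethe_algebra n z)"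
    by (rule bethe_one_letter_subalgebra)
  obtain f where f: "\<And>X \<sigma>. finite X \<Longrightarrow> card X = sum_list \<mu> \<Longrightarrow> \<sigma> permutes X \<Longrightarrow>
      specht_char_on X \<mu> \<sigma> = f (cycle_type X \<sigma>)"
    using specht_char_on_cycle_type[of \<mu>] by blast
  \<comment> \<open>The size of X is the sum of its cycle lengths, so the restriction to sets of the
    right size is part of the class function.\<close>
  define h where "h = (\<lambda>m. if sum_mset m = sum_list \<mu> then f m else 0)"
  have "beta n z \<mu> t = (\<Sum>X\<in>Pow {1..n}. \<Sum>\<sigma> | \<sigma> permutes X.
     scl (h (cycle_type X \<sigma>) * (\<Prod>i\<in>{1..n} - X. z i + t)) (bvec \<sigma>))"
    unfolding beta_eq_sum_Pow
  proof (intro sum.cong refl)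
    fix X \<sigma> assume "X \<in> Pow {1..n}" "\<sigma> \<in> {\<sigma>. \<sigma> permutes X}"
    then have X: "finite X" and \<sigma>: "\<sigma> permutes X"
      using finite_subset[of X "{1..n}"] by auto
    then show "scl ((if card X = sum_list \<mu> then specht_char_on X \<mu> \<sigma> else 0) * (\<Prod>i\<in>{1..n} - X. z i + t)) (bvec \<sigma>) =
        scl (h (cycle_type X \<sigma>) * (\<Prod>i\<in>{1..n} - X. z i + t)) (bvec \<sigma>)"
      using f[OF X _ \<sigma>] sum_mset_cycle_type[OF \<sigma> X] by (simp add: h_def)
  qed
  then show ?thesis
    using class_sum_mem by simp
qed

lemma star_beta:
  assumes "is_partition \<mu>"
  shows "star n (beta n z \<mu> t) = beta n z (conj_partition \<mu>) t"
proof -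
  interpret transposed_shapes \<mu> "conj_partition \<mu>"
    by (rule transposed_conj_partition[OF assms])
  have lin: "lin (star n)"
    by (rule linI) (auto simp: star_apply scl_def fun_eq_iff algebra_simps)
  have "star n (beta n z \<mu> t) = (\<Sum>X | X \<subseteq> {1..n} \<and> card X = sum_list \<mu>. \<Sum>\<sigma> | \<sigma> permutes X.
      scl (specht_char_on X \<mu> \<sigma> * (\<Prod>i\<in>{1..n} - X. (z i + t))) (star n (bvec \<sigma>)))"
    by (simp add: beta_def module_hom.sum[OF lin] module_hom.scale[OF lin])
  also have "\<dots> = (\<Sum>X | X \<subseteq> {1..n} \<and> card X = sum_list \<mu>. \<Sum>\<sigma> | \<sigma> permutes X.
      scl (specht_char_on X (conj_partition \<mu>) \<sigma> * (\<Prod>i\<in>{1..n} - X. (z i + t))) (bvec \<sigma>))"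
  proof (intro sum.cong refl)
    fix X \<sigma> assume "X \<in> {X. X \<subseteq> {1..n} \<and> card X = sum_list \<mu>}" "\<sigma> \<in> {\<sigma>. \<sigma> permutes X}"
    then have X: "X \<subseteq> {1..n}" "finite X" "card X = sum_list \<mu>" and \<sigma>: "\<sigma> permutes X"
      using finite_subset[of X "{1..n}"] by auto
    note r = rank_bij[OF X(2), unfolded X(3)]
    have "map_permutation X (\<lambda>i. card {j \<in> X. j \<le> i}) \<sigma> permutes {1..sum_list \<mu>}"
      by (rule map_permutation_permutes[OF r \<sigma>])
    then have "specht_char_on X (conj_partition \<mu>) \<sigma> = of_int (sign \<sigma>) * specht_char_on X \<mu> \<sigma>"
      using specht_char_transpose sign_map_permutation[OF bij_betw_imp_inj_on[OF r] \<sigma> X(2)]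
      by (simp add: specht_char_on_def)
    then show "scl (specht_char_on X \<mu> \<sigma> * (\<Prod>i\<in>{1..n} - X. (z i + t))) (star n (bvec \<sigma>)) =
        scl (specht_char_on X (conj_partition \<mu>) \<sigma> * (\<Prod>i\<in>{1..n} - X. (z i + t))) (bvec \<sigma>)"
      using star_bvec[OF permutes_subset[OF \<sigma> X(1)]] by (simp add: mult_ac)
  qed
  also have "\<dots> = beta n z (conj_partition \<mu>) t"
    by (simp add: beta_def size)
  finally show ?thesis .
qed

text \<open>Induction on generation. The image of a generator is the \<open>beta\<close> of a row,
  and its membership is where \<open>beta_mem\<close>, and with it the three-term relation, is
  used.\<close>

lemma star_bethe_mem:
  assumes "a \<in> carrier (bethe_algebra n z)"
  shows "star n a \<in> carrier (bethe_algebra n z)"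
  using assms unfolding carrier_bethe_algebra
proof (induction rule: generated_algebra.induct)
  case one
  have "star n \<one>\<^bsub>CS n\<^esub> = \<one>\<^bsub>CS n\<^esub>"
    by (rule ext) (auto simp: star_apply group_algebra_def sym_group_def bvec_def permutes_id)
  then show ?case
    using generated_algebra.one by metis
next
  case (gen a)
  then obtain k t where "a = beta n z (replicate k 1) t"
    by blast
  moreover have "is_partition (replicate k 1)"
    by (simp add: is_partition_def sorted_wrt_iff_nth_less)
  ultimately show ?case
    using beta_mem[of n z _ t] by (simp add: star_beta carrier_bethe_algebra)
next
  case (scale a c)
  have "star n (scl c a) = scl c (star n a)"
    by (auto simp: star_apply scl_def fun_eq_iff)
  with scale show ?case
    by (simp add: generated_algebra.scale)
next
  case (add a b)
  have "star n (a \<oplus>\<^bsub>CS n\<^esub> b) = star n a \<oplus>\<^bsub>CS n\<^esub> star n b"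
    by (auto simp: star_apply CS_add fun_eq_iff algebra_simps)
  with add.IH show ?case
    by (simp add: generated_algebra.add)
next
  case (mult a b)
  with star_mult show ?case
    by (simp add: generated_algebra.mult)
qed

lemma bethe_subset_CS: "carrier (bethe_algebra n z) \<subseteq> carrier (CS n)"
proof
  fix a assume "a \<in> carrier (bethe_algebra n z)"
  then show "a \<in> carrier (CS n)"
    unfolding carrier_bethe_algebra
  proof (induction rule: generated_algebra.induct)
    case one
    then show ?case
      by (auto simp: CS_carrier group_algebra_def sym_group_def bvec_def permutes_id)
  next
    case (gen a)
    then show ?case
      by (auto simp: CS_carrier beta_def sum_fun_apply scl_def bvec_def intro!: sum.neutral)
        (meson permutes_subset)
  qed (auto simp: CS_carrier CS_add scl_def CS_mult_0)
qed

theorem proposition5p20: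
  fixes n :: nat and z :: "nat \<Rightarrow> complex"
  shows "involutive_algebra_automorphism (bethe_algebra n z) (star n) \<and>
    (\<forall>\<mu> t. is_partition \<mu> \<longrightarrow>
      beta n z \<mu> t \<in> carrier (bethe_algebra n z) \<and>
      star n (beta n z \<mu> t) = beta n z (conj_partition \<mu>) t)"
proof (intro conjI allI impI)
  let ?B = "bethe_algebra n z"
  have hom: "star n \<in> ring_hom (CS n) (CS n)"
    using involutive_algebra_automorphism_star[of n]
    by (simp add: involutive_algebra_automorphism_def ring_iso_def)
  have inv: "star n (star n a) = a" if "a \<in> carrier ?B" for a
    using star_star bethe_subset_CS that by blast
  have ops: "\<one>\<^bsub>?B\<^esub> = \<one>\<^bsub>CS n\<^esub>" "a \<otimes>\<^bsub>?B\<^esub> b = a \<otimes>\<^bsub>CS n\<^esub> b" "a \<oplus>\<^bsub>?B\<^esub> b = a \<oplus>\<^bsub>CS n\<^esub> b" for a b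
    by (simp_all add: bethe_algebra_def)
  have "star n \<in> ring_hom ?B ?B"
  proof (rule ring_hom_memI)
    fix a b assume ab: "a \<in> carrier ?B" "b \<in> carrier ?B"
    then have "a \<in> carrier (CS n)" "b \<in> carrier (CS n)"
      using bethe_subset_CS by blast+
    then show "star n (a \<otimes>\<^bsub>?B\<^esub> b) = star n a \<otimes>\<^bsub>?B\<^esub> star n b" "star n (a \<oplus>\<^bsub>?B\<^esub> b) = star n a \<oplus>\<^bsub>?B\<^esub> star n b"
      using hom by (simp_all add: ops ring_hom_mult ring_hom_add)
  qed (use hom in \<open>simp_all add: star_bethe_mem ops ring_hom_one\<close>)
  \<comment> \<open>An involution that maps the carrier into itself is its own inverse
    there.\<close>
  moreover have "bij_betw (star n) (carrier ?B) (carrier ?B)"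
    by (rule bij_betwI[where g = "star n"]) (auto simp: star_bethe_mem inv)
  moreover have "star n (scl c a) = scl c (star n a)" for c a
    by (auto simp: star_apply scl_def fun_eq_iff)
  ultimately show "involutive_algebra_automorphism ?B (star n)"
    by (simp add: involutive_algebra_automorphism_def ring_iso_def inv)
  fix \<mu> t assume "is_partition \<mu>"
  then show "beta n z \<mu> t \<in> carrier ?B" "star n (beta n z \<mu> t) = beta n z (conj_partition \<mu>) t"
    by (simp_all add: beta_mem star_beta)
qed

end
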